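(* Let $a,b>0$ and $0<\alpha<\beta$. (i) If $\frac{\alpha+\beta}{2} \geq \frac{b}{a} \geq \frac{2}{1/\beta+1/\alpha}$, then for every $\delta >0$ $$ \mathbb{P}\left(\text{there is an optimal path for }L^{\alpha,\beta}(at,bt)\text{ not wholly contained in }D_{t\delta,\frac{b}{a}}\right) \longrightarrow 0\quad (t\to +\infty). $$ (ii) If $\frac{b}{a} > \frac{\alpha+\beta}{2}$, then for every $\delta >0$ $$ \mathbb{P}\left(\text{there is an optimal path for }L^{\alpha,\beta}(at,bt)\text{ which, for every } c\ge 0, \text{ is not wholly contained in }(0,c) + D_{t\delta,\frac{\alpha+\beta}{2}}\right)\longrightarrow 0\quad (t\to +\infty). $$ (iii) If $\frac{b}{a} < \frac{2}{1/\beta+1/\alpha}$, then for every $\delta >0$ $$ \mathbb{P}\left(\text{there is an optimal path for }L^{\alpha,\beta}(at,bt)\text{ which, for every } c\ge 0, \text{ is not wholly contained in }(c,0) + D_{t\delta,\frac{2}{1/\beta+1/\alpha}}\right)\longrightarrow 0\quad (t\to +\infty). $$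
   Context: $\Xi$ is a homogeneous Poisson point process with intensity one in the quarter-plane $[0,+\infty)^2$. For $0<\alpha<\beta$, the partial order $\stackrel{\alpha,\beta}{\preccurlyeq}$ on $[0,+\infty)^2$ is defined by: $(x,y)\stackrel{\alpha,\beta}{\preccurlyeq}(x',y')$ if and only if $x\le x'$ and $\alpha(x'-x)\le y'-y\le \beta(x'-x)$ (i.e. $x\le x'$ and $\alpha\le \frac{y'-y}{x'-x}\le\beta$). For $x,y\ge 0$, $L^{\alpha,\beta}(x,y)$ denotes the maximal number $L$ of (distinct) points $(u_1,v_1),\dots,(u_L,v_L)$ of $\Xi\cap([0,x]\times[0,y])$ such that $(u_1,v_1)\stackrel{\alpha,\beta}{\preccurlyeq}\cdots\stackrel{\alpha,\beta}{\preccurlyeq}(u_L,v_L)$. An optimal path for $L^{\alpha,\beta}(x,y)$ is such a chain of points of $\Xi\cap([0,x]\times[0,y])$ having the maximal number $L^{\alpha,\beta}(x,y)$ of points. For $R>0$ and a slope $\theta\in\mathbb{R}$, $$D_{R,\theta} =\{(x,y)\in \mathbb{R}_+^2\;:\; |y-\theta x|\leq R\},$$ and $(p,q)+D_{R,\theta}$ denotes the translate of $D_{R,\theta}$ by the vector $(p,q)$. *)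

theory Defs
  imports "HOL-Probability.Probability"
begin

definition quadrant :: "(real \<times> real) set" where
  "quadrant = {0..} \<times> {0..}"

text \<open>
  A point process on \<open>S\<close> is given by its random set of points. Being locally finite, this set is
  described by the finite counts \<open>card (\<Xi> \<omega> \<inter> A)\<close> with \<open>A\<close> bounded and Borel. The Poisson
  probabilities are written out, so that they also cover sets \<open>A\<close> of measure zero
  (where \<open>0 ^ 0 = 1\<close>).
\<close>

definition homogeneous_poisson_process ::
  "'w measure \<Rightarrow> (real \<times> real) set \<Rightarrow> real \<Rightarrow> ('w \<Rightarrow> (real \<times> real) set) \<Rightarrow> bool" where
  "homogeneous_poisson_process M S r \<Xi> \<longleftrightarrow>
     prob_space M \<and>
     (\<forall>\<omega>\<in>space M. \<Xi> \<omega> \<subseteq> S \<and> (\<forall>K. bounded K \<longrightarrow> finite (\<Xi> \<omega> \<inter> K))) \<and>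
     (\<forall>A\<in>sets borel. A \<subseteq> S \<and> bounded A \<longrightarrow>
        (\<lambda>\<omega>. card (\<Xi> \<omega> \<inter> A)) \<in> measurable M (count_space UNIV) \<and>
        (\<forall>k. measure M {\<omega>\<in>space M. card (\<Xi> \<omega> \<inter> A) = k} =
             exp (- (r * measure lborel A)) * (r * measure lborel A) ^ k / fact k)) \<and>
     (\<forall>(n::nat) A. (\<forall>i<n. A i \<in> sets borel \<and> A i \<subseteq> S \<and> bounded (A i)) \<and>
        disjoint_family_on A {..<n} \<longrightarrow>
        prob_space.indep_vars M (\<lambda>_. count_space UNIV) (\<lambda>i \<omega>. card (\<Xi> \<omega> \<inter> A i)) {..<n})"

definition slope_le :: "real \<Rightarrow> real \<Rightarrow> real \<times> real \<Rightarrow> real \<times> real \<Rightarrow> bool" where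
  "slope_le \<alpha> \<beta> p q \<longleftrightarrow>
     fst p \<le> fst q \<and>
     \<alpha> * (fst q - fst p) \<le> snd q - snd p \<and> snd q - snd p \<le> \<beta> * (fst q - fst p)"

definition slope_chain ::
  "real \<Rightarrow> real \<Rightarrow> (real \<times> real) set \<Rightarrow> real \<Rightarrow> real \<Rightarrow> (real \<times> real) list \<Rightarrow> bool" where
  "slope_chain \<alpha> \<beta> X x y ps \<longleftrightarrow>
     set ps \<subseteq> X \<inter> ({0..x} \<times> {0..y}) \<and> distinct ps \<and> successively (slope_le \<alpha> \<beta>) ps"

text \<open>
  The maximum is meaningful because it is only used for locally finite \<open>X\<close>: the lengths are then
  bounded by \<open>card (X \<inter> ({0..x} \<times> {0..y}))\<close>, and the empty list is always a chain.
\<close>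

definition max_chain_length :: "real \<Rightarrow> real \<Rightarrow> (real \<times> real) set \<Rightarrow> real \<Rightarrow> real \<Rightarrow> nat" where
  "max_chain_length \<alpha> \<beta> X x y = Max {length ps | ps. slope_chain \<alpha> \<beta> X x y ps}"

definition optimal_path ::
  "real \<Rightarrow> real \<Rightarrow> (real \<times> real) set \<Rightarrow> real \<Rightarrow> real \<Rightarrow> (real \<times> real) list \<Rightarrow> bool" where
  "optimal_path \<alpha> \<beta> X x y ps \<longleftrightarrow>
     slope_chain \<alpha> \<beta> X x y ps \<and> length ps = max_chain_length \<alpha> \<beta> X x y"

definition strip :: "real \<Rightarrow> real \<Rightarrow> (real \<times> real) set" where
  "strip R \<theta> = {(x, y). 0 \<le> x \<and> 0 \<le> y \<and> \<bar>y - \<theta> * x\<bar> \<le> R}"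

text \<open>
  The probability of \<open>E t\<close> tends to \<open>0\<close> as \<open>t\<close> tends to infinity. Measurability is part of
  the claim, since \<open>measure M\<close> is \<open>0\<close> on sets that are not measurable.
\<close>

definition vanishing_probability ::
  "'w measure \<Rightarrow> (real \<Rightarrow> 'w \<Rightarrow> bool) \<Rightarrow> bool" where
  "vanishing_probability M E \<longleftrightarrow>
     (\<forall>t>0. {\<omega>\<in>space M. E t \<omega>} \<in> sets M) \<and>
     ((\<lambda>t. measure M {\<omega>\<in>space M. E t \<omega>}) \<longlongrightarrow> 0) at_top"

end

theory Submission
  imports Defs
begin

text \<open>
  In the light-cone coordinates \<open>((\<beta> x - y) / \<kappa>, (y - \<alpha> x) / \<kappa>)\<close> with \<open>\<kappa>\<^sup>2 = \<beta> - \<alpha>\<close>, which preserve area,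
  the slope order becomes the componentwise order. An increasing chain in a rectangle with sides
  \<open>u, v\<close> can be squeezed into a square of side \<open>sqrt (u v)\<close> without changing the law of the process, so
  its maximal length is about \<open>c sqrt (u v)\<close>. The constant \<open>c\<close> is the supremum of the mean length in a
  square divided by its side: disjoint diagonal squares give the lower tail, and since no mean
  exceeds \<open>c s\<close>, the lower tail forces the upper tail. By AM-GM, \<open>sqrt (u v)\<close> lies below its tangent at the
  optimal displacement, with equality only on the optimal ray. By compactness a chain through a
  misplaced pair of points therefore loses a fixed proportion of the optimum, and a union bound over a
  finite grid of rectangles rules out such chains.
\<close>

section \<open>Coarse graining a Poisson process\<close>

text \<open>The hypothesis speaks only of counts in bounded Borel sets, whereas the claim concerns
  paths, and measurability is part of it. So measurability, invariance under area-preserving maps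
  and independence over disjoint regions all have to be extracted from counts. Cutting chain lengths
  off at a level \<open>K\<close> keeps every random variable bounded, so that Chebyshev's
  inequality applies. The critical slopes are the zeros of the two coefficients of
  \<open>tangent\<close>: that of the height vanishes at the arithmetic mean of \<alpha> and
  \<beta>, that of the width at their harmonic mean. Between these slopes both coefficients are
  nonnegative and an optimal displacement crosses the whole box. Beyond them one side of the box
  ceases to bind, and the optimal segment can be translated along that side. A path can then not be
  tested against one fixed line, so a pair of its points is tested instead, and the path is cut into
  three pieces at that pair.\<close>

definition cell :: "nat \<Rightarrow> real \<times> real \<Rightarrow> int \<times> int" where
  "cell n z = (\<lfloor>real n * fst z\<rfloor>, \<lfloor>real n * snd z\<rfloor>)"

definition path_in :: "('a list \<Rightarrow> bool) \<Rightarrow> 'a set \<Rightarrow> bool" where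
  "path_in C X \<longleftrightarrow> (\<exists>ps. distinct ps \<and> set ps \<subseteq> X \<and> C ps)"

text \<open>
  The cells that are met by the process have an explicit law, and the indicator of the coarse event below
  converges pointwise to that of \<open>path_in\<close>. This gives measurability of path events, and it transfers
  laws and independence from counts to path events, at the same time.
\<close>

definition coarse_path_in :: "nat \<Rightarrow> ((real \<times> real) list \<Rightarrow> bool) \<Rightarrow> (int \<times> int) set \<Rightarrow> bool" where
  "coarse_path_in n C J \<longleftrightarrow> (\<exists>qs. distinct (map (cell n) qs) \<and> cell n ` set qs \<subseteq> J \<and> C qs)"

text \<open>A coarse path locates its points only up to the cell size, so a condition on paths has
  to survive the passage to the limit. The length is constant along the sequence, which makes
  entrywise convergence the right notion.\<close>

definition limit_closed :: "('a::topological_space list \<Rightarrow> bool) \<Rightarrow> bool" where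
  "limit_closed C \<longleftrightarrow> (\<forall>q p. (\<forall>j::nat. C (q j) \<and> length (q j) = length p) \<and>
     (\<forall>i<length p. (\<lambda>j. q j ! i) \<longlonglongrightarrow> p ! i) \<longrightarrow> C p)"

lemma cell_eq_dist:
  assumes "cell n p = cell n q" "n > 0"
  shows "\<bar>fst p - fst q\<bar> \<le> 1 / n" "\<bar>snd p - snd q\<bar> \<le> 1 / n"
proof -
  have "\<bar>x - y\<bar> \<le> 1 / n" if "\<lfloor>real n * x\<rfloor> = \<lfloor>real n * y\<rfloor>" for x y :: real
  proof -
    have "\<bar>real n * x - real n * y\<bar> \<le> 1" using that by linarith
    then have "real n * \<bar>x - y\<bar> \<le> 1"
      by (metis abs_mult abs_of_nat right_diff_distrib)
    then show ?thesis using \<open>n > 0\<close> by (simp add: field_simps)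
  qed
  then show "\<bar>fst p - fst q\<bar> \<le> 1 / n" "\<bar>snd p - snd q\<bar> \<le> 1 / n"
    using assms(1) by (auto simp: cell_def)
qed

lemma eventually_cell_neq:
  assumes "p \<noteq> q"
  shows "\<forall>\<^sub>F n in sequentially. cell n p \<noteq> cell n q"
proof -
  define d where "d = max \<bar>fst p - fst q\<bar> \<bar>snd p - snd q\<bar>"
  have "d > 0" using assms by (auto simp: d_def prod_eq_iff)
  then have "\<forall>\<^sub>F n in sequentially. 1 / real n < d"
    using lim_1_over_n order_tendstoD(2) by blast
  with eventually_gt_at_top[of 0] show ?thesis
  proof eventually_elim
    case (elim n)
    then show ?case using cell_eq_dist[of n p q] by (auto simp: d_def)
  qed
qed

lemma eventually_inj_on_cell:
  assumes "finite X"
  shows "\<forall>\<^sub>F n in sequentially. inj_on (cell n) X"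
proof -
  have "\<forall>\<^sub>F n in sequentially. \<forall>p\<in>X. \<forall>q\<in>X. p \<noteq> q \<longrightarrow> cell n p \<noteq> cell n q"
    using assms by (intro eventually_ball_finite ballI) (auto intro: eventually_cell_neq)
  then show ?thesis by eventually_elim (auto simp: inj_on_def)
qed

text \<open>A path in \<open>X\<close> is seen as soon as the cells separate the points of
  \<open>X\<close>. Conversely, if coarse paths occur for infinitely many \<open>n\<close>, one and
  the same list is approximated infinitely often, because a finite \<open>X\<close> carries only
  finitely many distinct lists. The witnesses converge to that list, and \<open>limit_closed\<close>
  applies.\<close>

lemma eventually_coarse_path_in:
  assumes X: "finite X" and C: "limit_closed C"
  shows "\<forall>\<^sub>F n in sequentially. coarse_path_in n C (cell n ` X) \<longleftrightarrow> path_in C X"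
proof (cases "path_in C X")
  case True
  then obtain ps where ps: "distinct ps" "set ps \<subseteq> X" "C ps" by (auto simp: path_in_def)
  have "\<forall>\<^sub>F n in sequentially. coarse_path_in n C (cell n ` X)"
    using eventually_inj_on_cell[OF X]
  proof eventually_elim
    case (elim n)
    then show ?case using ps unfolding coarse_path_in_def
      by (intro exI[of _ ps]) (auto simp: distinct_map intro: inj_on_subset)
  qed
  then show ?thesis by eventually_elim (use True in simp)
next
  case False
  have "\<forall>\<^sub>F n in sequentially. \<not> coarse_path_in n C (cell n ` X)"
  proof (rule ccontr)
    assume "\<not> ?thesis"
    then have "\<exists>\<^sub>F n in sequentially. coarse_path_in n C (cell n ` X)"
      by (simp add: frequently_def)
    then have inf: "infinite {n. coarse_path_in n C (cell n ` X)}"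
      by (simp add: frequently_cofinite cofinite_eq_sequentially[symmetric])
    \<comment> \<open>At resolution 0 all points share one cell, which carries no information on
      distances.\<close>
    define S where "S = {n. coarse_path_in n C (cell n ` X)} - {0}"
    have "infinite S" using inf by (simp add: S_def)
    have "\<exists>qs ps. distinct ps \<and> set ps \<subseteq> X \<and> C qs \<and> map (cell n) ps = map (cell n) qs"
      if "n \<in> S" for n
    proof -
      obtain qs where qs: "distinct (map (cell n) qs)" "cell n ` set qs \<subseteq> cell n ` X" "C qs"
        using \<open>n \<in> S\<close> by (auto simp: S_def coarse_path_in_def)
      \<comment> \<open>Every cell of the coarse path is replaced by an actual point of
        \<open>X\<close> in that cell; distinct cells keep these points distinct.\<close>
      define ps where "ps = map (\<lambda>q. SOME p. p \<in> X \<and> cell n p = cell n q) qs"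
      have *: "(SOME p. p \<in> X \<and> cell n p = cell n q) \<in> X \<and>
          cell n (SOME p. p \<in> X \<and> cell n p = cell n q) = cell n q" if "q \<in> set qs" for q
      proof -
        have "cell n q \<in> cell n ` X" using that qs(2) by blast
        then have "\<exists>p. p \<in> X \<and> cell n p = cell n q" by (metis imageE)
        then show ?thesis by (rule someI_ex)
      qed
      have m: "map (cell n) ps = map (cell n) qs" using * by (simp add: ps_def)
      have "set ps \<subseteq> X" using * by (auto simp: ps_def)
      moreover have "distinct ps" using m qs(1) by (metis distinct_map)
      ultimately show ?thesis using m qs(3) by blast
    qed
    then obtain qs ps where qp: "\<And>n. n \<in> S \<Longrightarrow> distinct (ps n) \<and> set (ps n) \<subseteq> X \<and> C (qs n) \<and>
        map (cell n) (ps n) = map (cell n) (qs n)" by metis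
    have "ps ` S \<subseteq> {xs. set xs \<subseteq> X \<and> distinct xs}" using qp by auto
    then have "finite (ps ` S)" using finite_subset_distinct[OF X] finite_subset by blast
    from pigeonhole_infinite[OF \<open>infinite S\<close> this] obtain n0
      where n0: "n0 \<in> S" "infinite {n \<in> S. ps n = ps n0}" by auto
    define T where "T = {n \<in> S. ps n = ps n0}"
    have T: "infinite T" using n0 by (simp add: T_def)
    define r where "r = enumerate T"
    have rT: "r j \<in> T" for j using enumerate_in_set[OF T] by (simp add: r_def)
    have sm: "strict_mono r" using strict_mono_enumerate[OF T] by (simp add: r_def)
    define p where "p = ps n0"
    have r1: "r j > 0" "C (qs (r j))" "map (cell (r j)) p = map (cell (r j)) (qs (r j))" for j
      using rT[of j] qp[of "r j"] by (auto simp: T_def S_def p_def)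
    have len: "length (qs (r j)) = length p" for j
      using r1(3)[of j] by (metis length_map)
    have lim0: "(\<lambda>j. 1 / real (r j)) \<longlonglongrightarrow> 0"
      using LIMSEQ_subseq_LIMSEQ[OF lim_1_over_n sm] by (simp add: o_def)
    have "(\<lambda>j. qs (r j) ! i) \<longlonglongrightarrow> p ! i" if i: "i < length p" for i
    proof -
      have eq: "cell (r j) (qs (r j) ! i) = cell (r j) (p ! i)" for j
        using r1(3)[of j] i len[of j] by (metis nth_map)
      have "(\<lambda>j. fst (qs (r j) ! i) - fst (p ! i)) \<longlonglongrightarrow> 0"
        by (rule Lim_null_comparison[OF _ lim0]) (use cell_eq_dist(1)[OF eq r1(1)] in auto)
      moreover have "(\<lambda>j. snd (qs (r j) ! i) - snd (p ! i)) \<longlonglongrightarrow> 0"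
        by (rule Lim_null_comparison[OF _ lim0]) (use cell_eq_dist(2)[OF eq r1(1)] in auto)
      ultimately have "(\<lambda>j. (fst (qs (r j) ! i), snd (qs (r j) ! i))) \<longlonglongrightarrow> (fst (p ! i), snd (p ! i))"
        by (intro tendsto_Pair) (simp_all add: LIM_zero_iff)
      then show ?thesis by simp
    qed
    then have "C p" using C r1(2) len unfolding limit_closed_def
      by (elim allE[of _ "\<lambda>j. qs (r j)"] allE[of _ p]) auto
    then have "path_in C X" using qp[OF n0(1)] by (auto simp: path_in_def p_def)
    with False show False by simp
  qed
  then show ?thesis by eventually_elim (use False in simp)
qed

text \<open>Pointwise eventual agreement makes \<open>F\<close> the liminf of the
  \<open>E n\<close>, hence an event; the probabilities converge by dominated convergence of the
  indicators.\<close>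

lemma (in prob_space) events_prob_lim:
  assumes E: "\<And>n. E n \<in> events" and F: "F \<subseteq> space M"
    and ev: "\<And>\<omega>. \<omega> \<in> space M \<Longrightarrow> \<forall>\<^sub>F n in sequentially. \<omega> \<in> E n \<longleftrightarrow> \<omega> \<in> F"
  shows "F \<in> events" "(\<lambda>n. prob (E n)) \<longlonglongrightarrow> prob F"
proof -
  have "F = (\<Union>N. \<Inter>n\<in>{N..}. E n)"
  proof (rule set_eqI, rule iffI)
    fix \<omega> assume "\<omega> \<in> F"
    then show "\<omega> \<in> (\<Union>N. \<Inter>n\<in>{N..}. E n)"
      using ev[of \<omega>] F by (auto simp: eventually_sequentially)
  next
    fix \<omega> assume "\<omega> \<in> (\<Union>N. \<Inter>n\<in>{N..}. E n)"
    then obtain N where N: "\<And>n. n \<ge> N \<Longrightarrow> \<omega> \<in> E n" by auto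
    then have "\<omega> \<in> space M" using E[of N] sets.sets_into_space by blast
    then obtain N' where "\<And>n. n \<ge> N' \<Longrightarrow> \<omega> \<in> E n \<longleftrightarrow> \<omega> \<in> F"
      using ev by (auto simp: eventually_sequentially)
    with N[of "max N N'"] show "\<omega> \<in> F" by auto
  qed
  also have "\<dots> \<in> events" by (intro sets.countable_UN sets.countable_INT'') (use E in auto)
  finally show Fe: "F \<in> events" .
  have "(\<lambda>n. LINT \<omega>|M. indicator (E n) \<omega> :: real) \<longlonglongrightarrow> (LINT \<omega>|M. indicator F \<omega>)"
  proof (rule integral_dominated_convergence[where w = "\<lambda>_. 1"])
    show "AE \<omega> in M. (\<lambda>n. indicator (E n) \<omega> :: real) \<longlonglongrightarrow> indicator F \<omega>"
    proof (rule AE_I2)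
      fix \<omega> assume "\<omega> \<in> space M"
      from ev[OF this] have "\<forall>\<^sub>F n in sequentially. (indicator (E n) \<omega> :: real) = indicator F \<omega>"
        by eventually_elim (auto simp: indicator_def)
      then show "(\<lambda>n. indicator (E n) \<omega> :: real) \<longlonglongrightarrow> indicator F \<omega>"
        by (rule tendsto_eventually)
    qed
  qed (use E Fe in \<open>auto simp: indicator_def\<close>)
  then show "(\<lambda>n. prob (E n)) \<longlonglongrightarrow> prob F"
    using E Fe by (simp add: Int_absorb2 sets.sets_into_space)
qed

section \<open>Occupation of finitely many cells by a Poisson process\<close>

locale poisson_points = prob_space M for M :: "'w measure" +
  fixes S :: "(real \<times> real) set" and r :: real and \<Xi> :: "'w \<Rightarrow> (real \<times> real) set"
  assumes poisson: "homogeneous_poisson_process M S r \<Xi>"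
begin

lemma finite_points: "\<omega> \<in> space M \<Longrightarrow> bounded A \<Longrightarrow> finite (\<Xi> \<omega> \<inter> A)"
  and points_in_region: "\<omega> \<in> space M \<Longrightarrow> \<Xi> \<omega> \<subseteq> S"
  using poisson unfolding homogeneous_poisson_process_def by simp_all

lemma measurable_count:
  "A \<in> sets borel \<Longrightarrow> A \<subseteq> S \<Longrightarrow> bounded A \<Longrightarrow>
    (\<lambda>\<omega>. card (\<Xi> \<omega> \<inter> A)) \<in> measurable M (count_space UNIV)"
  using poisson unfolding homogeneous_poisson_process_def by blast

lemma void_event:
  assumes A: "A \<in> sets borel" "A \<subseteq> S" "bounded A"
  shows "{\<omega>\<in>space M. \<Xi> \<omega> \<inter> A = {}} \<in> events"
    "prob {\<omega>\<in>space M. \<Xi> \<omega> \<inter> A = {}} = exp (- (r * measure lborel A))"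
    "{\<omega>\<in>space M. \<Xi> \<omega> \<inter> A = {}} = {\<omega>\<in>space M. card (\<Xi> \<omega> \<inter> A) = 0}"
proof -
  \<comment> \<open>Local finiteness enters here: \<open>card\<close> of an infinite set is 0, so a
    zero count means absence of points only for a finite intersection.\<close>
  show eq: "{\<omega>\<in>space M. \<Xi> \<omega> \<inter> A = {}} = {\<omega>\<in>space M. card (\<Xi> \<omega> \<inter> A) = 0}"
    using finite_points[OF _ A(3)] by auto
  show "prob {\<omega>\<in>space M. \<Xi> \<omega> \<inter> A = {}} = exp (- (r * measure lborel A))"
  proof -
    have "\<forall>k. prob {\<omega>\<in>space M. card (\<Xi> \<omega> \<inter> A) = k} =
             exp (- (r * measure lborel A)) * (r * measure lborel A) ^ k / fact k"
      using poisson A unfolding homogeneous_poisson_process_def by blast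
    from spec[OF this, of 0] show ?thesis by (simp only: eq) simp
  qed
  have "(\<lambda>\<omega>. card (\<Xi> \<omega> \<inter> A)) -` {0} \<inter> space M \<in> events"
    using measurable_count[OF A] by (rule measurable_sets) simp
  also have "(\<lambda>\<omega>. card (\<Xi> \<omega> \<inter> A)) -` {0} \<inter> space M = {\<omega>\<in>space M. \<Xi> \<omega> \<inter> A = {}}"
    unfolding eq by auto
  finally show "{\<omega>\<in>space M. \<Xi> \<omega> \<inter> A = {}} \<in> events" .
qed

definition occupation_weight :: "(real \<times> real) set \<Rightarrow> bool \<Rightarrow> real" where
  "occupation_weight A u = (if u then 1 - exp (- (r * measure lborel A)) else exp (- (r * measure lborel A)))"

lemma occupation_event:
  assumes A: "A \<in> sets borel" "A \<subseteq> S" "bounded A"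
  shows "{\<omega>\<in>space M. \<Xi> \<omega> \<inter> A \<noteq> {} \<longleftrightarrow> u} \<in> events"
    "prob {\<omega>\<in>space M. \<Xi> \<omega> \<inter> A \<noteq> {} \<longleftrightarrow> u} = occupation_weight A u"
proof -
  have *: "{\<omega>\<in>space M. \<Xi> \<omega> \<inter> A \<noteq> {}} = space M - {\<omega>\<in>space M. \<Xi> \<omega> \<inter> A = {}}" by auto
  show "{\<omega>\<in>space M. \<Xi> \<omega> \<inter> A \<noteq> {} \<longleftrightarrow> u} \<in> events"
    using void_event(1)[OF A] by (cases u) (auto simp: *)
  show "prob {\<omega>\<in>space M. \<Xi> \<omega> \<inter> A \<noteq> {} \<longleftrightarrow> u} = occupation_weight A u"
    using void_event(1,2)[OF A] by (cases u) (auto simp: * occupation_weight_def prob_compl)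
qed

text \<open>Independence is given for families indexed by an initial segment of the naturals. A
  bijection brings an arbitrary finite index set into this form, and each occupation condition
  restricts a single count.\<close>

lemma occupation_pattern:
  assumes I: "finite I" and A: "\<And>c. c \<in> I \<Longrightarrow> A c \<in> sets borel \<and> A c \<subseteq> S \<and> bounded (A c)"
    and disj: "disjoint_family_on A I"
  shows "{\<omega>\<in>space M. \<forall>c\<in>I. \<Xi> \<omega> \<inter> A c \<noteq> {} \<longleftrightarrow> u c} \<in> events"
    "prob {\<omega>\<in>space M. \<forall>c\<in>I. \<Xi> \<omega> \<inter> A c \<noteq> {} \<longleftrightarrow> u c} = (\<Prod>c\<in>I. occupation_weight (A c) (u c))"
proof -
  show "{\<omega>\<in>space M. \<forall>c\<in>I. \<Xi> \<omega> \<inter> A c \<noteq> {} \<longleftrightarrow> u c} \<in> events"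
    by (rule sets.sets_Collect_finite_All[OF _ I]) (use A occupation_event(1) in blast)
  show "prob {\<omega>\<in>space M. \<forall>c\<in>I. \<Xi> \<omega> \<inter> A c \<noteq> {} \<longleftrightarrow> u c} = (\<Prod>c\<in>I. occupation_weight (A c) (u c))"
  proof (cases "I = {}")
    \<comment> \<open>The product formula for independent variables asks for a nonempty index set:
      an empty intersection would be the whole type instead of \<open>space M\<close>.\<close>
    case True
    then show ?thesis by (simp add: prob_space)
  next
    case False
    obtain f where f: "bij_betw f {..<card I} I"
      using ex_bij_betw_nat_finite[OF I] by (auto simp: atLeast0LessThan)
    define n where "n = card I"
    have fI: "f i \<in> I" if "i < n" for i using f that by (auto simp: bij_betw_def n_def)
    have inj: "inj_on f {..<n}" using f by (auto simp: bij_betw_def n_def)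
    have im: "f ` {..<n} = I" using f by (auto simp: bij_betw_def n_def)
    have "disjoint_family_on (A \<circ> f) {..<n}"
      using disj inj fI unfolding disjoint_family_on_def inj_on_def o_def by (metis lessThan_iff)
    moreover have "\<forall>i<n. (A \<circ> f) i \<in> sets borel \<and> (A \<circ> f) i \<subseteq> S \<and> bounded ((A \<circ> f) i)"
      using A fI by simp
    ultimately have "indep_vars (\<lambda>_. count_space UNIV) (\<lambda>i \<omega>. card (\<Xi> \<omega> \<inter> (A \<circ> f) i)) {..<n}"
      using poisson unfolding homogeneous_poisson_process_def by blast
    then have iv: "indep_vars (\<lambda>_. count_space UNIV) (\<lambda>i \<omega>. card (\<Xi> \<omega> \<inter> A (f i))) {..<n}"
      by (simp add: o_def)
    define Y where "Y i = (if u (f i) then - {0::nat} else {0})" for i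
    have ev: "(\<lambda>\<omega>. card (\<Xi> \<omega> \<inter> A (f i))) -` Y i \<inter> space M =
        {\<omega>\<in>space M. \<Xi> \<omega> \<inter> A (f i) \<noteq> {} \<longleftrightarrow> u (f i)}" if "i < n" for i
    proof -
      have "bounded (A (f i))" using A[OF fI[OF that]] by simp
      then show ?thesis using finite_points by (auto simp: Y_def)
    qed
    have "{..<n} \<noteq> {}" using im False by auto
    then have "prob (\<Inter>i\<in>{..<n}. (\<lambda>\<omega>. card (\<Xi> \<omega> \<inter> A (f i))) -` Y i \<inter> space M) =
        (\<Prod>i\<in>{..<n}. prob ((\<lambda>\<omega>. card (\<Xi> \<omega> \<inter> A (f i))) -` Y i \<inter> space M))"
      by (intro indep_varsD[OF iv]) auto
    also have "\<dots> = (\<Prod>i\<in>{..<n}. occupation_weight (A (f i)) (u (f i)))"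
    proof (rule prod.cong[OF refl])
      fix i assume i: "i \<in> {..<n}"
      then have Ai: "A (f i) \<in> sets borel" "A (f i) \<subseteq> S" "bounded (A (f i))"
        using A fI by auto
      show "prob ((\<lambda>\<omega>. card (\<Xi> \<omega> \<inter> A (f i))) -` Y i \<inter> space M) = occupation_weight (A (f i)) (u (f i))"
        using ev[of i] i occupation_event(2)[OF Ai] by auto
    qed
    also have "\<dots> = (\<Prod>c\<in>I. occupation_weight (A c) (u c))"
      using im prod.reindex[OF inj, of "\<lambda>c. occupation_weight (A c) (u c)"] by (simp add: o_def)
    also have "(\<Inter>i\<in>{..<n}. (\<lambda>\<omega>. card (\<Xi> \<omega> \<inter> A (f i))) -` Y i \<inter> space M) =
        (\<Inter>i\<in>{..<n}. {\<omega>\<in>space M. \<Xi> \<omega> \<inter> A (f i) \<noteq> {} \<longleftrightarrow> u (f i)})"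
      using ev by (intro INF_cong) auto
    also have "\<dots> = {\<omega>\<in>space M. \<forall>c\<in>I. \<Xi> \<omega> \<inter> A c \<noteq> {} \<longleftrightarrow> u c}"
      unfolding im[symmetric] using \<open>{..<n} \<noteq> {}\<close> by auto
    finally show ?thesis .
  qed
qed

end

section \<open>Law and independence of path events\<close>

definition measure_preserving :: "(real \<times> real \<Rightarrow> real \<times> real) \<Rightarrow> bool" where
  "measure_preserving \<Phi> \<longleftrightarrow> \<Phi> \<in> borel_measurable borel \<and> distr lborel borel \<Phi> = lborel"

lemma measure_preserving_id [simp]: "measure_preserving (\<lambda>x. x)"
  unfolding measure_preserving_def using distr_id2[of borel lborel] by (auto simp: id_def)

lemma measure_preserving_vimage:
  assumes "measure_preserving \<Phi>" "A \<in> sets borel"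
  shows "\<Phi> -` A \<in> sets borel" "measure lborel (\<Phi> -` A) = measure lborel A"
proof -
  have m: "\<Phi> \<in> borel_measurable borel" using assms by (simp add: measure_preserving_def)
  show "\<Phi> -` A \<in> sets borel" using measurable_sets[OF m assms(2)] by simp
  have "measure lborel A = measure (distr lborel borel \<Phi>) A"
    using assms by (simp add: measure_preserving_def)
  also have "\<dots> = measure lborel (\<Phi> -` A)"
    using m assms(2) by (subst measure_distr) auto
  finally show "measure lborel (\<Phi> -` A) = measure lborel A" ..
qed

lemma measure_preserving_comp:
  assumes "measure_preserving \<Phi>" "measure_preserving \<Psi>"
  shows "measure_preserving (\<lambda>x. \<Psi> (\<Phi> x))"
proof -
  have m: "\<Phi> \<in> borel_measurable borel" "\<Psi> \<in> borel_measurable borel"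
    using assms by (auto simp: measure_preserving_def)
  have "distr lborel borel (\<Psi> \<circ> \<Phi>) = distr (distr lborel borel \<Phi>) borel \<Psi>"
    using m by (subst distr_distr) auto
  also have "\<dots> = lborel" using assms by (simp add: measure_preserving_def)
  finally show ?thesis using m by (simp add: measure_preserving_def o_def)
qed

lemma measurable_cell: "cell n -` {c} \<in> sets borel"
proof -
  have [measurable]: "fst \<in> borel_measurable (borel :: (real \<times> real) measure)"
    "snd \<in> borel_measurable (borel :: (real \<times> real) measure)"
    by (intro borel_measurable_continuous_onI continuous_intros)+
  have "cell n -` {c} = {z. \<lfloor>real n * fst z\<rfloor> = fst c \<and> \<lfloor>real n * snd z\<rfloor> = snd c}"
    by (auto simp: cell_def)
  also have "\<dots> \<in> sets borel" by measurable
  finally show ?thesis .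
qed

lemma finite_cells:
  assumes "bounded D"
  shows "finite (cell n ` D)"
proof -
  obtain B where B: "\<And>z. z \<in> D \<Longrightarrow> norm z \<le> B" using assms by (auto simp: bounded_iff)
  have "cell n ` D \<subseteq> {\<lfloor>- (real n * B)\<rfloor>..\<lfloor>real n * B\<rfloor>} \<times> {\<lfloor>- (real n * B)\<rfloor>..\<lfloor>real n * B\<rfloor>}"
  proof
    fix c assume "c \<in> cell n ` D"
    then obtain z where z: "z \<in> D" "c = cell n z" by auto
    have "\<bar>fst z\<bar> \<le> B" "\<bar>snd z\<bar> \<le> B"
      using B[OF z(1)] norm_fst_le[of "fst z" "snd z"] norm_snd_le[of "snd z" "fst z"] by auto
    then have "real n * \<bar>fst z\<bar> \<le> real n * B" "real n * \<bar>snd z\<bar> \<le> real n * B"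
      by (auto intro: mult_left_mono)
    then have "\<bar>real n * fst z\<bar> \<le> real n * B" "\<bar>real n * snd z\<bar> \<le> real n * B"
      by (auto simp: abs_mult)
    then show "c \<in> {\<lfloor>- (real n * B)\<rfloor>..\<lfloor>real n * B\<rfloor>} \<times> {\<lfloor>- (real n * B)\<rfloor>..\<lfloor>real n * B\<rfloor>}"
      unfolding z(2) cell_def by (auto intro!: floor_mono)
  qed
  then show ?thesis by (rule finite_subset) auto
qed

context poisson_points
begin

text \<open>The probability that, among the cells meeting \<open>D\<close>, exactly those in
  \<open>J\<close> contain a point. It refers to \<open>D\<close> and not to any map into
  \<open>D\<close>, which is what makes path laws invariant.\<close>

definition occupancy :: "nat \<Rightarrow> (real \<times> real) set \<Rightarrow> (int \<times> int) set \<Rightarrow> real" where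
  "occupancy n D J = (\<Prod>c\<in>cell n ` D. occupation_weight (D \<inter> cell n -` {c}) (c \<in> J))"

text \<open>Points are observed in the preimage of \<open>D\<close>, which has to lie where the
  process lives, and are then compared through their images in \<open>D\<close>. Boundedness of the
  preimage gives finitely many points, boundedness of \<open>D\<close> finitely many cells.\<close>

definition admissible :: "(real \<times> real \<Rightarrow> real \<times> real) \<Rightarrow> (real \<times> real) set \<Rightarrow> bool" where
  "admissible \<Phi> D \<longleftrightarrow> measure_preserving \<Phi> \<and> D \<in> sets borel \<and> bounded D \<and>
     \<Phi> -` D \<subseteq> S \<and> bounded (\<Phi> -` D)"

lemma cells_eq_iff:
  assumes "J \<subseteq> cell n ` D"
  shows "cell n ` \<Phi> ` (X \<inter> \<Phi> -` D) = J \<longleftrightarrow>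
    (\<forall>c\<in>cell n ` D. X \<inter> \<Phi> -` (D \<inter> cell n -` {c}) \<noteq> {} \<longleftrightarrow> c \<in> J)"
proof -
  have *: "X \<inter> \<Phi> -` (D \<inter> cell n -` {c}) \<noteq> {} \<longleftrightarrow> c \<in> cell n ` \<Phi> ` (X \<inter> \<Phi> -` D)" for c
    by blast
  have "cell n ` \<Phi> ` (X \<inter> \<Phi> -` D) \<subseteq> cell n ` D" by auto
  moreover have "L = J' \<longleftrightarrow> (\<forall>c\<in>K. c \<in> L \<longleftrightarrow> c \<in> J')" if "L \<subseteq> K" "J' \<subseteq> K" for L J' K :: "(int \<times> int) set"
    using that by blast
  ultimately show ?thesis unfolding * using assms by presburger
qed

lemma piece:
  assumes "admissible \<Phi> D"
  shows "\<Phi> -` (D \<inter> cell n -` {c}) \<in> sets borel \<and> \<Phi> -` (D \<inter> cell n -` {c}) \<subseteq> S \<and>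
      bounded (\<Phi> -` (D \<inter> cell n -` {c}))"
    "occupation_weight (\<Phi> -` (D \<inter> cell n -` {c})) u = occupation_weight (D \<inter> cell n -` {c}) u"
proof -
  have D: "D \<inter> cell n -` {c} \<in> sets borel"
    using assms measurable_cell unfolding admissible_def by (intro sets.Int) auto
  show "occupation_weight (\<Phi> -` (D \<inter> cell n -` {c})) u = occupation_weight (D \<inter> cell n -` {c}) u"
    using measure_preserving_vimage(2)[OF _ D] assms
    by (simp add: occupation_weight_def admissible_def)
  have "\<Phi> -` (D \<inter> cell n -` {c}) \<subseteq> \<Phi> -` D" by auto
  then show "\<Phi> -` (D \<inter> cell n -` {c}) \<in> sets borel \<and> \<Phi> -` (D \<inter> cell n -` {c}) \<subseteq> S \<and>
      bounded (\<Phi> -` (D \<inter> cell n -` {c}))"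
    using measure_preserving_vimage(1)[OF _ D] assms bounded_subset
    unfolding admissible_def by blast
qed

lemma cells_event:
  assumes a: "admissible \<Phi> D" and J: "J \<subseteq> cell n ` D"
  shows "{\<omega>\<in>space M. cell n ` \<Phi> ` (\<Xi> \<omega> \<inter> \<Phi> -` D) = J} \<in> events"
    "prob {\<omega>\<in>space M. cell n ` \<Phi> ` (\<Xi> \<omega> \<inter> \<Phi> -` D) = J} = occupancy n D J"
proof -
  have fin: "finite (cell n ` D)" using a finite_cells by (auto simp: admissible_def)
  have disj: "disjoint_family_on (\<lambda>c. \<Phi> -` (D \<inter> cell n -` {c})) (cell n ` D)"
    by (auto simp: disjoint_family_on_def)
  note pat = occupation_pattern[OF fin piece(1)[OF a, where n=n] disj, of "\<lambda>c. c \<in> J"]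
  show "{\<omega>\<in>space M. cell n ` \<Phi> ` (\<Xi> \<omega> \<inter> \<Phi> -` D) = J} \<in> events"
    unfolding cells_eq_iff[OF J] by (rule pat(1))
  show "prob {\<omega>\<in>space M. cell n ` \<Phi> ` (\<Xi> \<omega> \<inter> \<Phi> -` D) = J} = occupancy n D J"
    unfolding cells_eq_iff[OF J] pat(2) occupancy_def by (simp only: piece(2)[OF a])
qed

lemma cells_event_disjoint:
  assumes a: "admissible (\<lambda>x. x) D" "admissible (\<lambda>x. x) D'" and d: "D \<inter> D' = {}"
    and J: "J \<subseteq> cell n ` D" "J' \<subseteq> cell n ` D'"
  shows "prob {\<omega>\<in>space M. cell n ` (\<Xi> \<omega> \<inter> D) = J \<and> cell n ` (\<Xi> \<omega> \<inter> D') = J'} =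
    occupancy n D J * occupancy n D' J'"
proof -
  \<comment> \<open>A cell can meet both \<open>D\<close> and \<open>D'\<close>, so the two families
    of cells are indexed by a disjoint sum instead of a union.\<close>
  let ?I = "cell n ` D <+> cell n ` D'"
  define A where "A = case_sum (\<lambda>c. D \<inter> cell n -` {c}) (\<lambda>c. D' \<inter> cell n -` {c})"
  define u where "u = case_sum (\<lambda>c. c \<in> J) (\<lambda>c. c \<in> J')"
  have fin: "finite (cell n ` D)" "finite (cell n ` D')"
    using a finite_cells by (auto simp: admissible_def)
  have disj: "disjoint_family_on A ?I"
    unfolding disjoint_family_on_def
  proof (intro ballI impI)
    fix c c' assume "c \<in> ?I" "c' \<in> ?I" "c \<noteq> c'"
    then show "A c \<inter> A c' = {}" using d by (cases c; cases c'; simp only: A_def sum.case; blast)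
  qed
  have pA: "A c \<in> sets borel \<and> A c \<subseteq> S \<and> bounded (A c)" if "c \<in> ?I" for c
    using piece(1)[OF a(1)] piece(1)[OF a(2)] by (cases c) (simp_all add: A_def)
  have "cell n ` (X \<inter> D) = J \<and> cell n ` (X \<inter> D') = J' \<longleftrightarrow>
      (\<forall>c\<in>?I. X \<inter> A c \<noteq> {} \<longleftrightarrow> u c)" for X
    using cells_eq_iff[OF J(1), of "\<lambda>x. x" X] cells_eq_iff[OF J(2), of "\<lambda>x. x" X]
    by (simp add: A_def u_def Plus_def ball_Un)
  then have "prob {\<omega>\<in>space M. cell n ` (\<Xi> \<omega> \<inter> D) = J \<and> cell n ` (\<Xi> \<omega> \<inter> D') = J'} =
      prob {\<omega>\<in>space M. \<forall>c\<in>?I. \<Xi> \<omega> \<inter> A c \<noteq> {} \<longleftrightarrow> u c}" by simp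
  also have "\<dots> = (\<Prod>c\<in>?I. occupation_weight (A c) (u c))"
    using fin by (intro occupation_pattern(2) pA disj) auto
  also have "\<dots> = occupancy n D J * occupancy n D' J'"
    using fin by (simp add: prod.Plus occupancy_def A_def u_def)
  finally show ?thesis .
qed

text \<open>The set of occupied cells takes finitely many values \<open>J\<close>, so the event is a
  finite disjoint union. The resulting sum does not mention \<Phi>.\<close>

lemma coarse_event:
  assumes a: "admissible \<Phi> D"
  shows "{\<omega>\<in>space M. coarse_path_in n C (cell n ` \<Phi> ` (\<Xi> \<omega> \<inter> \<Phi> -` D))} \<in> events"
    "prob {\<omega>\<in>space M. coarse_path_in n C (cell n ` \<Phi> ` (\<Xi> \<omega> \<inter> \<Phi> -` D))} =
      (\<Sum>J | J \<subseteq> cell n ` D \<and> coarse_path_in n C J. occupancy n D J)"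
proof -
  let ?\<J> = "{J. J \<subseteq> cell n ` D \<and> coarse_path_in n C J}"
  let ?E = "\<lambda>J. {\<omega>\<in>space M. cell n ` \<Phi> ` (\<Xi> \<omega> \<inter> \<Phi> -` D) = J}"
  have fin: "finite ?\<J>" using a finite_cells[of D n] by (auto simp: admissible_def)
  have eq: "{\<omega>\<in>space M. coarse_path_in n C (cell n ` \<Phi> ` (\<Xi> \<omega> \<inter> \<Phi> -` D))} = (\<Union>J\<in>?\<J>. ?E J)"
    by auto
  show "{\<omega>\<in>space M. coarse_path_in n C (cell n ` \<Phi> ` (\<Xi> \<omega> \<inter> \<Phi> -` D))} \<in> events"
    unfolding eq using fin cells_event(1)[OF a] by (intro sets.finite_UN) auto
  have "disjoint_family_on ?E ?\<J>" unfolding disjoint_family_on_def by blast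
  then have "prob (\<Union>J\<in>?\<J>. ?E J) = (\<Sum>J\<in>?\<J>. prob (?E J))"
    using fin cells_event(1)[OF a] by (intro finite_measure_finite_Union) blast+
  also have "\<dots> = (\<Sum>J\<in>?\<J>. occupancy n D J)"
    using cells_event(2)[OF a] by (intro sum.cong) auto
  finally show "prob {\<omega>\<in>space M. coarse_path_in n C (cell n ` \<Phi> ` (\<Xi> \<omega> \<inter> \<Phi> -` D))} =
      (\<Sum>J\<in>?\<J>. occupancy n D J)" by (simp only: eq)
qed

lemma coarse_event_disjoint:
  assumes a: "admissible (\<lambda>x. x) D" "admissible (\<lambda>x. x) D'" and d: "D \<inter> D' = {}"
  shows "prob ({\<omega>\<in>space M. coarse_path_in n C (cell n ` (\<Xi> \<omega> \<inter> D))} \<inter>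
      {\<omega>\<in>space M. coarse_path_in n C' (cell n ` (\<Xi> \<omega> \<inter> D'))}) =
    prob {\<omega>\<in>space M. coarse_path_in n C (cell n ` (\<Xi> \<omega> \<inter> D))} *
    prob {\<omega>\<in>space M. coarse_path_in n C' (cell n ` (\<Xi> \<omega> \<inter> D'))}" (is "prob ?F = _")
proof -
  let ?J = "{J. J \<subseteq> cell n ` D \<and> coarse_path_in n C J}"
  let ?J' = "{J. J \<subseteq> cell n ` D' \<and> coarse_path_in n C' J}"
  let ?E = "\<lambda>(J, J'). {\<omega>\<in>space M. cell n ` (\<Xi> \<omega> \<inter> D) = J \<and> cell n ` (\<Xi> \<omega> \<inter> D') = J'}"
  have fin: "finite (?J \<times> ?J')"
    using a finite_cells[of D n] finite_cells[of D' n] by (auto simp: admissible_def)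
  have eq: "?F = (\<Union>x\<in>?J \<times> ?J'. ?E x)" by auto
  have ev: "?E x \<in> events" if "x \<in> ?J \<times> ?J'" for x
  proof -
    have "?E x = {\<omega>\<in>space M. cell n ` (\<Xi> \<omega> \<inter> D) = fst x} \<inter> {\<omega>\<in>space M. cell n ` (\<Xi> \<omega> \<inter> D') = snd x}"
      by (auto simp: split_beta)
    then show ?thesis
      using cells_event(1)[OF a(1), of "fst x" n] cells_event(1)[OF a(2), of "snd x" n] that by auto
  qed
  have "prob (\<Union>x\<in>?J \<times> ?J'. ?E x) = (\<Sum>x\<in>?J \<times> ?J'. prob (?E x))"
    using fin ev by (intro finite_measure_finite_Union) (auto simp: disjoint_family_on_def)
  also have "\<dots> = (\<Sum>(J, J')\<in>?J \<times> ?J'. occupancy n D J * occupancy n D' J')"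
    using cells_event_disjoint[OF a d] by (intro sum.cong) auto
  also have "\<dots> = (\<Sum>J\<in>?J. occupancy n D J) * (\<Sum>J\<in>?J'. occupancy n D' J)"
    by (simp add: sum_product sum.cartesian_product)
  finally show ?thesis
    using coarse_event(2)[OF a(1), of n C] coarse_event(2)[OF a(2), of n C'] by (simp add: eq)
qed

lemma path_event:
  assumes a: "admissible \<Phi> D" and C: "limit_closed C"
  shows "{\<omega>\<in>space M. path_in C (\<Phi> ` (\<Xi> \<omega> \<inter> \<Phi> -` D))} \<in> events"
    "(\<lambda>n. prob {\<omega>\<in>space M. coarse_path_in n C (cell n ` \<Phi> ` (\<Xi> \<omega> \<inter> \<Phi> -` D))})
      \<longlonglongrightarrow> prob {\<omega>\<in>space M. path_in C (\<Phi> ` (\<Xi> \<omega> \<inter> \<Phi> -` D))}"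
proof -
  have ev: "\<forall>\<^sub>F n in sequentially.
      \<omega> \<in> {\<omega>\<in>space M. coarse_path_in n C (cell n ` \<Phi> ` (\<Xi> \<omega> \<inter> \<Phi> -` D))} \<longleftrightarrow>
      \<omega> \<in> {\<omega>\<in>space M. path_in C (\<Phi> ` (\<Xi> \<omega> \<inter> \<Phi> -` D))}" if "\<omega> \<in> space M" for \<omega>
  proof -
    have "finite (\<Phi> ` (\<Xi> \<omega> \<inter> \<Phi> -` D))"
      using finite_points[OF that] a by (auto simp: admissible_def)
    from eventually_coarse_path_in[OF this C] show ?thesis
      by eventually_elim (use that in simp)
  qed
  note * = events_prob_lim[OF coarse_event(1)[OF a] _ ev]
  show "{\<omega>\<in>space M. path_in C (\<Phi> ` (\<Xi> \<omega> \<inter> \<Phi> -` D))} \<in> events" by (rule *(1)) auto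
  show "(\<lambda>n. prob {\<omega>\<in>space M. coarse_path_in n C (cell n ` \<Phi> ` (\<Xi> \<omega> \<inter> \<Phi> -` D))})
      \<longlonglongrightarrow> prob {\<omega>\<in>space M. path_in C (\<Phi> ` (\<Xi> \<omega> \<inter> \<Phi> -` D))}" by (rule *(2)) auto
qed

text \<open>At every resolution the coarse probabilities for \<Phi> and for the identity are the
  same number, so their limits agree. That \<open>D\<close> lies in \<open>S\<close> makes the
  identity admissible.\<close>

lemma path_event_law:
  assumes a: "admissible \<Phi> D" and D: "D \<subseteq> S" and C: "limit_closed C"
  shows "prob {\<omega>\<in>space M. path_in C (\<Phi> ` (\<Xi> \<omega> \<inter> \<Phi> -` D))} =
    prob {\<omega>\<in>space M. path_in C (\<Xi> \<omega> \<inter> D)}"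
proof -
  have a': "admissible (\<lambda>x. x) D" using a D by (simp add: admissible_def)
  have "(\<lambda>n. prob {\<omega>\<in>space M. coarse_path_in n C (cell n ` \<Phi> ` (\<Xi> \<omega> \<inter> \<Phi> -` D))})
      \<longlonglongrightarrow> prob {\<omega>\<in>space M. path_in C (\<Xi> \<omega> \<inter> D)}"
    using path_event(2)[OF a' C] unfolding coarse_event(2)[OF a] coarse_event(2)[OF a'] by simp
  then show ?thesis using path_event(2)[OF a C] LIMSEQ_unique by blast
qed

text \<open>The product formula holds for coarse events at every resolution, and both of its sides
  converge.\<close>

lemma path_event_indep:
  assumes a: "admissible (\<lambda>x. x) D" "admissible (\<lambda>x. x) D'" and d: "D \<inter> D' = {}"
    and C: "limit_closed C" "limit_closed C'"
  shows "prob ({\<omega>\<in>space M. path_in C (\<Xi> \<omega> \<inter> D)} \<inter> {\<omega>\<in>space M. path_in C' (\<Xi> \<omega> \<inter> D')}) =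
    prob {\<omega>\<in>space M. path_in C (\<Xi> \<omega> \<inter> D)} * prob {\<omega>\<in>space M. path_in C' (\<Xi> \<omega> \<inter> D')}"
proof -
  let ?E = "\<lambda>n. {\<omega>\<in>space M. coarse_path_in n C (cell n ` (\<Xi> \<omega> \<inter> D))}"
  let ?E' = "\<lambda>n. {\<omega>\<in>space M. coarse_path_in n C' (cell n ` (\<Xi> \<omega> \<inter> D'))}"
  let ?F = "{\<omega>\<in>space M. path_in C (\<Xi> \<omega> \<inter> D)}"
  let ?F' = "{\<omega>\<in>space M. path_in C' (\<Xi> \<omega> \<inter> D')}"
  have E: "?E n \<in> events" "?E' n \<in> events" for n
    using coarse_event(1)[OF a(1), of n C] coarse_event(1)[OF a(2), of n C'] by simp_all
  have "\<forall>\<^sub>F n in sequentially. \<omega> \<in> ?E n \<inter> ?E' n \<longleftrightarrow> \<omega> \<in> ?F \<inter> ?F'" if "\<omega> \<in> space M" for \<omega>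
  proof -
    have "finite (\<Xi> \<omega> \<inter> D)" "finite (\<Xi> \<omega> \<inter> D')"
      using finite_points[OF that] a by (auto simp: admissible_def)
    from eventually_coarse_path_in[OF this(1) C(1)] eventually_coarse_path_in[OF this(2) C(2)]
    show ?thesis by eventually_elim (use that in simp)
  qed
  then have "(\<lambda>n. prob (?E n \<inter> ?E' n)) \<longlonglongrightarrow> prob (?F \<inter> ?F')"
    using E by (intro events_prob_lim(2)) blast+
  moreover have "(\<lambda>n. prob (?E n \<inter> ?E' n)) \<longlonglongrightarrow> prob ?F * prob ?F'"
    unfolding coarse_event_disjoint[OF a d]
    using tendsto_mult[OF path_event(2)[OF a(1) C(1)] path_event(2)[OF a(2) C(2)]] by simp
  ultimately show ?thesis using LIMSEQ_unique by blast
qed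

end

section \<open>Longest chains and their first moment\<close>

abbreviation chain :: "('a \<Rightarrow> 'a \<Rightarrow> bool) \<Rightarrow> nat \<Rightarrow> 'a list \<Rightarrow> bool" where
  "chain R k ps \<equiv> length ps = k \<and> sorted_wrt R ps"

definition has_chain :: "('a \<Rightarrow> 'a \<Rightarrow> bool) \<Rightarrow> nat \<Rightarrow> 'a set \<Rightarrow> bool" where
  "has_chain R k X \<longleftrightarrow> path_in (chain R k) X"

definition longest :: "('a \<Rightarrow> 'a \<Rightarrow> bool) \<Rightarrow> 'a set \<Rightarrow> nat" where
  "longest R X = Max {k. has_chain R k X}"

definition comp_le :: "real \<times> real \<Rightarrow> real \<times> real \<Rightarrow> bool" where
  "comp_le p q \<longleftrightarrow> fst p \<le> fst q \<and> snd p \<le> snd q"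

definition closed_rel :: "('a::topological_space \<Rightarrow> 'a \<Rightarrow> bool) \<Rightarrow> bool" where
  "closed_rel R \<longleftrightarrow> (\<forall>u v p q. (\<forall>j::nat. R (u j) (v j)) \<and> u \<longlonglongrightarrow> p \<and> v \<longlonglongrightarrow> q \<longrightarrow> R p q)"

lemma has_chain_mono:
  assumes "has_chain R k X" "X \<subseteq> Y" "l \<le> k"
  shows "has_chain R l Y"
proof -
  obtain ps where ps: "distinct ps" "set ps \<subseteq> X" "chain R k ps"
    using assms(1) by (auto simp: has_chain_def path_in_def)
  show ?thesis unfolding has_chain_def path_in_def
    by (rule exI[of _ "take l ps"]) (use ps assms(2,3) set_take_subset[of l ps] in \<open>auto intro: sorted_wrt_take\<close>)
qed

lemma has_chain_0 [simp]: "has_chain R 0 X"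
  by (auto simp: has_chain_def path_in_def)

lemma has_chain_le_card:
  assumes "has_chain R k X" "finite X"
  shows "k \<le> card X"
proof -
  obtain ps where "distinct ps" "set ps \<subseteq> X" "length ps = k"
    using assms(1) by (auto simp: has_chain_def path_in_def)
  then show ?thesis using card_mono[OF assms(2), of "set ps"] by (simp add: distinct_card)
qed

lemma has_chain_iff:
  assumes "finite X"
  shows "has_chain R k X \<longleftrightarrow> k \<le> longest R X"
proof -
  have fin: "finite {k. has_chain R k X}"
    by (rule finite_subset[of _ "{..card X}"]) (use has_chain_le_card[OF _ assms, of R] in simp_all, blast)
  moreover have ne: "{k. has_chain R k X} \<noteq> {}" using has_chain_0 by blast
  ultimately have "has_chain R (longest R X) X"
    unfolding longest_def using Max_in[OF fin] by simp
  then have "has_chain R k X" if "k \<le> longest R X" using has_chain_mono that by blast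
  moreover have "k \<le> longest R X" if "has_chain R k X"
    unfolding longest_def using that by (intro Max_ge[OF fin]) simp
  ultimately show ?thesis by blast
qed

lemma has_chain_append:
  assumes "has_chain R k X" "has_chain R l Y" "X \<inter> Y = {}" "\<And>x y. x \<in> X \<Longrightarrow> y \<in> Y \<Longrightarrow> R x y"
  shows "has_chain R (k + l) (X \<union> Y)"
proof -
  obtain ps qs where "distinct ps" "set ps \<subseteq> X" "chain R k ps" "distinct qs" "set qs \<subseteq> Y" "chain R l qs"
    using assms(1,2) by (auto simp: has_chain_def path_in_def)
  then show ?thesis unfolding has_chain_def path_in_def
    by (intro exI[of _ "ps @ qs"]) (use assms(3,4) in \<open>auto simp: sorted_wrt_append subset_iff\<close>)
qed

lemma has_chain_image:
  assumes "inj_on f X" "\<And>x y. x \<in> X \<Longrightarrow> y \<in> X \<Longrightarrow> R x y \<longleftrightarrow> R' (f x) (f y)"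
  shows "has_chain R' k (f ` X) \<longleftrightarrow> has_chain R k X"
proof
  assume "has_chain R k X"
  then obtain ps where ps: "distinct ps" "set ps \<subseteq> X" "chain R k ps"
    by (auto simp: has_chain_def path_in_def)
  have "sorted_wrt (\<lambda>x y. R' (f x) (f y)) ps" 
    by (rule sorted_wrt_mono_rel[of ps R, rotated]) (use ps assms(2) in auto)
  then show "has_chain R' k (f ` X)" unfolding has_chain_def path_in_def
    using ps inj_on_subset[OF assms(1) ps(2)]
    by (intro exI[of _ "map f ps"]) (auto simp: sorted_wrt_map distinct_map)
next
  assume "has_chain R' k (f ` X)"
  then obtain qs where qs: "distinct qs" "set qs \<subseteq> f ` X" "chain R' k qs"
    by (auto simp: has_chain_def path_in_def)
  define ps where "ps = map (inv_into X f) qs"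
  have X: "set ps \<subseteq> X" using qs(2) by (auto simp: ps_def intro: inv_into_into)
  have q: "qs = map f ps" using qs(2) by (auto simp: ps_def f_inv_into_f intro!: map_idI[symmetric])
  have "sorted_wrt (\<lambda>x y. R' (f x) (f y)) ps" using qs(3) unfolding q by (simp add: sorted_wrt_map)
  then have "sorted_wrt R ps" 
    by (rule sorted_wrt_mono_rel[of ps "\<lambda>x y. R' (f x) (f y)" R, rotated]) (use X assms(2) in auto)
  then show "has_chain R k X" unfolding has_chain_def path_in_def
    using X qs q by (intro exI[of _ ps]) (auto simp: distinct_map)
qed

lemma limit_closed_chain:
  assumes "closed_rel R"
  shows "limit_closed (chain R k)"
  unfolding limit_closed_def
proof (intro allI impI, elim conjE, intro conjI)
  fix q :: "nat \<Rightarrow> 'a list" and p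
  assume 1: "\<forall>j. (length (q j) = k \<and> sorted_wrt R (q j)) \<and> length (q j) = length p"
    and 2: "\<forall>i<length p. (\<lambda>j. q j ! i) \<longlonglongrightarrow> p ! i"
  show "length p = k" using 1 by metis
  show "sorted_wrt R p" unfolding sorted_wrt_iff_nth_less
  proof (intro allI impI)
    fix i j assume ij: "i < j" "j < length p"
    have "\<forall>m. R (q m ! i) (q m ! j)" using 1 ij by (metis sorted_wrt_nth_less)
    then show "R (p ! i) (p ! j)"
      using assms 2 ij unfolding closed_rel_def
      by (elim allE[of _ "\<lambda>m. q m ! i"] allE[of _ "\<lambda>m. q m ! j"] allE[of _ "p ! i"] allE[of _ "p ! j"]) auto
  qed
qed

lemma closed_rel_comp_le: "closed_rel comp_le"
  unfolding closed_rel_def comp_le_def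
proof (intro allI impI, elim conjE, intro conjI)
  fix u v :: "nat \<Rightarrow> real \<times> real" and p q
  assume *: "\<forall>j. fst (u j) \<le> fst (v j) \<and> snd (u j) \<le> snd (v j)" "u \<longlonglongrightarrow> p" "v \<longlonglongrightarrow> q"
  show "fst p \<le> fst q" using LIMSEQ_le[OF tendsto_fst[OF *(2)] tendsto_fst[OF *(3)]] *(1) by blast
  show "snd p \<le> snd q" using LIMSEQ_le[OF tendsto_snd[OF *(2)] tendsto_snd[OF *(3)]] *(1) by blast
qed

text \<open>Adding its index to each entry turns a weakly increasing list into a strictly increasing
  one with entries below \<open>m + k\<close>, that is, into a \<open>k\<close>-element subset of a
  set of \<open>m + k\<close> elements.\<close>

lemma card_sorted_lists:
  fixes m k :: nat
  defines "W \<equiv> {xs :: int list. length xs = k \<and> sorted xs \<and> set xs \<subseteq> {0..<int m}}"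
  shows "finite W" "card W \<le> (m + k) choose k"
proof -
  show fin: "finite W"
    using finite_lists_length_eq[of "{0..<int m}" k] by (rule rev_finite_subset) (auto simp: W_def)
  define f where "f xs = map (\<lambda>i. xs ! i + int i) [0..<k]" for xs :: "int list"
  have srt: "sorted_wrt (<) (f xs)" if "xs \<in> W" for xs
    unfolding sorted_wrt_iff_nth_less
  proof (intro allI impI)
    fix i j assume ij: "i < j" "j < length (f xs)"
    then have "xs ! i \<le> xs ! j" using that sorted_nth_mono[of xs i j] by (simp add: W_def f_def)
    then show "f xs ! i < f xs ! j" using ij by (simp add: f_def)
  qed
  have "inj_on (\<lambda>xs. set (f xs)) W"
  proof (rule inj_onI)
    fix xs ys assume xy: "xs \<in> W" "ys \<in> W" "set (f xs) = set (f ys)"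
    then have "f xs = f ys"
      using srt[of xs] srt[of ys] sorted_distinct_set_unique[of "f xs" "f ys"]
      by (simp add: strict_sorted_iff)
    then have "\<forall>i<k. xs ! i = ys ! i"
      unfolding f_def by (auto simp: map_eq_conv)
    then show "xs = ys" using xy by (intro nth_equalityI) (auto simp: W_def)
  qed
  moreover have "(\<lambda>xs. set (f xs)) ` W \<subseteq> {A. A \<subseteq> {0..<int (m + k)} \<and> card A = k}"
  proof safe
    fix xs assume xs: "xs \<in> W"
    show "card (set (f xs)) = k"
      using srt[OF xs] distinct_card[of "f xs"] by (simp add: strict_sorted_iff f_def)
    fix x assume "x \<in> set (f xs)"
    then obtain i where i: "i < k" "x = xs ! i + int i" by (auto simp: f_def)
    have "xs ! i \<in> set xs" "set xs \<subseteq> {0..<int m}" using xs i by (auto simp: W_def)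
    then have "xs ! i \<in> {0..<int m}" by blast
    then show "x \<in> {0..<int (m + k)}" using i by auto
  qed
  moreover have "finite {A. A \<subseteq> {0..<int (m + k)} \<and> card A = k}"
    by (rule finite_subset[of _ "Pow {0..<int (m + k)}"]) auto
  ultimately have "card W \<le> card {A. A \<subseteq> {0..<int (m + k)} \<and> card A = k}"
    by (meson card_inj_on_le)
  also have "\<dots> = (m + k) choose k"
    using n_subsets[of "{0..<int (m + k)}" k] by (simp add: nat_int_add)
  finally show "card W \<le> (m + k) choose k" .
qed

section \<open>First-moment bounds for increasing chains in a square\<close>

locale quadrant_poisson = poisson_points M quadrant 1 \<Xi> for M :: "'w measure" and \<Xi>
begin

definition square :: "real \<Rightarrow> (real \<times> real) set" where
  "square s = {0..<s} \<times> {0..<s}"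

definition chain_prob :: "real \<Rightarrow> nat \<Rightarrow> real" where
  "chain_prob s k = prob {\<omega>\<in>space M. has_chain comp_le k (\<Xi> \<omega> \<inter> square s)}"

lemma rectangle_admissible:
  assumes "0 \<le> a" "0 \<le> c"
  shows "admissible (\<lambda>x. x) ({a..<b} \<times> {c..<d})"
proof -
  have "{a..<b} \<times> {c..<d} \<in> sets borel"
    unfolding borel_prod[symmetric] by (intro pair_measureI) auto
  moreover have "bounded ({a..<b} \<times> {c..<d})"
    by (intro bounded_Times) (auto intro: bounded_subset[OF bounded_closed_interval])
  moreover have "{a..<b} \<times> {c..<d} \<subseteq> quadrant" using assms by (auto simp: quadrant_def)
  ultimately show ?thesis by (simp add: admissible_def)
qed

lemma square_admissible: "admissible (\<lambda>x. x) (square s)"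
  unfolding square_def by (rule rectangle_admissible) auto

lemma chain_event: 
  assumes "closed_rel R" "admissible (\<lambda>x. x) D"
  shows "{\<omega>\<in>space M. has_chain R k (\<Xi> \<omega> \<inter> D)} \<in> events"
  using path_event(1)[OF assms(2) limit_closed_chain[OF assms(1)], of k] by (simp add: has_chain_def)

lemma piece_measure:
  assumes "n > 0"
  shows "measure lborel (square s \<inter> cell n -` {c}) \<le> (1 / real n)\<^sup>2"
proof -
  let ?l = "(fst c / n, snd c / n)" and ?u = "((fst c + 1) / n, (snd c + 1) / n)"
  have "square s \<inter> cell n -` {c} \<subseteq> cbox ?l ?u"
  proof
    fix z assume "z \<in> square s \<inter> cell n -` {c}"
    then have "c = cell n z" by auto
    then have "fst c \<le> n * fst z" "n * fst z \<le> fst c + 1" "snd c \<le> n * snd z" "n * snd z \<le> snd c + 1"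
      by (auto simp: cell_def)
    then show "z \<in> cbox ?l ?u"
      using assms by (cases z) (auto simp: cbox_Pair_eq field_simps)
  qed
  then have "measure lborel (square s \<inter> cell n -` {c}) \<le> measure lborel (cbox ?l ?u)"
    by (intro measure_mono_fmeasurable fmeasurableI)
      (use square_admissible[of s] measurable_cell[of n c] in \<open>auto simp: admissible_def emeasure_lborel_cbox_eq intro!: sets.Int\<close>)
  also have "\<dots> = (1 / real n)\<^sup>2"
    using assms by (simp add: measure_lborel_cbox_eq Basis_prod_def prod.union_disjoint
        power2_eq_square field_simps)
  finally show ?thesis .
qed

text \<open>Union bound over lists of cells. Both coordinate lists of a coarse chain are weakly
  increasing, which leaves at most the square of a binomial coefficient of choices; \<open>k\<close>
  prescribed distinct cells are all occupied with probability at most the \<open>k\<close>-th power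
  of the cell area.\<close>

lemma coarse_chain_prob:
  assumes n: "n > 0" and s: "s \<ge> 0"
  shows "prob {\<omega>\<in>space M. coarse_path_in n (chain comp_le k) (cell n ` (\<Xi> \<omega> \<inter> square s))} \<le>
    (((real n * s + 1 + real k) / real n) ^ k / fact k)\<^sup>2" (is "prob ?E \<le> _")
proof -
  \<comment> \<open>Cell indices in the square run from 0 up to at most the floor of
    \<open>n * s\<close>, hence the extra 1.\<close>
  define m where "m = nat \<lfloor>real n * s\<rfloor> + 1"
  define V where "V = {xs :: int list. length xs = k \<and> sorted xs \<and> set xs \<subseteq> {0..<int m}}"
  define W where "W = {cs :: (int \<times> int) list. distinct cs \<and> map fst cs \<in> V \<and> map snd cs \<in> V}"
  define F where "F cs = {\<omega>\<in>space M. \<forall>c\<in>set cs. \<Xi> \<omega> \<inter> (square s \<inter> cell n -` {c}) \<noteq> {} \<longleftrightarrow> True}"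
    for cs :: "(int \<times> int) list"
  have inj: "inj_on (\<lambda>cs. (map fst cs, map snd cs)) W"
    by (rule inj_onI) (metis prod.inject zip_map_fst_snd)
  have im: "(\<lambda>cs. (map fst cs, map snd cs)) ` W \<subseteq> V \<times> V" by (auto simp: W_def)
  have finV: "finite V" and cardV: "card V \<le> (m + k) choose k"
    using card_sorted_lists[of k m] by (simp_all add: V_def)
  have finW: "finite W" using inj im finV by (meson finite_SigmaI inj_on_finite)
  have "card W \<le> card (V \<times> V)" using inj im finV by (intro card_inj_on_le) auto
  then have cardW: "card W \<le> ((m + k) choose k)\<^sup>2"
    using mult_mono[OF cardV cardV] by (simp add: power2_eq_square card_cartesian_product)
  have sub: "?E \<subseteq> (\<Union>cs\<in>W. F cs)"
  proof
    fix \<omega> assume \<omega>: "\<omega> \<in> ?E"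
    then obtain qs where qs: "distinct (map (cell n) qs)" "cell n ` set qs \<subseteq> cell n ` (\<Xi> \<omega> \<inter> square s)"
      "chain comp_le k qs" by (auto simp: coarse_path_in_def)
    have c: "c \<in> {0..<int m} \<times> {0..<int m}" if c: "c \<in> set (map (cell n) qs)" for c
    proof -
      have "c \<in> cell n ` (\<Xi> \<omega> \<inter> square s)" using c qs(2) by auto
      then obtain z where z: "z \<in> square s" "c = cell n z" by auto
      have "0 \<le> real n * fst z" "real n * fst z \<le> real n * s" "0 \<le> real n * snd z" "real n * snd z \<le> real n * s"
        using z(1) by (auto simp: square_def intro: mult_left_mono)
      then have "0 \<le> \<lfloor>real n * fst z\<rfloor>" "\<lfloor>real n * fst z\<rfloor> \<le> \<lfloor>real n * s\<rfloor>"
         "0 \<le> \<lfloor>real n * snd z\<rfloor>" "\<lfloor>real n * snd z\<rfloor> \<le> \<lfloor>real n * s\<rfloor>"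
        by (auto intro: floor_mono)
      then show ?thesis using z(2) s by (auto simp: cell_def m_def)
    qed
    have mono: "sorted_wrt (\<lambda>p q. \<lfloor>real n * fst p\<rfloor> \<le> \<lfloor>real n * fst q\<rfloor>) qs"
      "sorted_wrt (\<lambda>p q. \<lfloor>real n * snd p\<rfloor> \<le> \<lfloor>real n * snd q\<rfloor>) qs"
      using qs(3) by (auto intro!: sorted_wrt_mono_rel[of qs comp_le] floor_mono mult_left_mono simp: comp_le_def)
    have "sorted (map fst (map (cell n) qs))" "sorted (map snd (map (cell n) qs))"
      using mono by (simp_all add: sorted_wrt_map cell_def)
    moreover have "set (map fst (map (cell n) qs)) \<subseteq> {0..<int m}" "set (map snd (map (cell n) qs)) \<subseteq> {0..<int m}"
    proof -
      have *: "fst ` A \<subseteq> B" "snd ` A \<subseteq> B" if "A \<subseteq> B \<times> B" for A and B :: "int set"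
        using that by auto
      have "set (map (cell n) qs) \<subseteq> {0..<int m} \<times> {0..<int m}" using c by blast
      from *[OF this] show "set (map fst (map (cell n) qs)) \<subseteq> {0..<int m}"
        "set (map snd (map (cell n) qs)) \<subseteq> {0..<int m}"
        by (simp_all only: set_map)
    qed
    ultimately have "map (cell n) qs \<in> W"
      using qs(1,3) by (simp add: W_def V_def image_image)
    moreover have "\<omega> \<in> F (map (cell n) qs)"
      using \<omega> qs(2) unfolding F_def by fastforce
    ultimately show "\<omega> \<in> (\<Union>cs\<in>W. F cs)" by blast
  qed
  have F: "F cs \<in> events" "prob (F cs) \<le> ((1 / real n)\<^sup>2) ^ k" if cs: "cs \<in> W" for cs
  proof -
    have a: "\<And>c. c \<in> set cs \<Longrightarrow> square s \<inter> cell n -` {c} \<in> sets borel \<and>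
        square s \<inter> cell n -` {c} \<subseteq> quadrant \<and> bounded (square s \<inter> cell n -` {c})"
      using piece(1)[OF square_admissible, of s n] by simp
    have d: "disjoint_family_on (\<lambda>c. square s \<inter> cell n -` {c}) (set cs)"
      by (auto simp: disjoint_family_on_def)
    note pat = occupation_pattern[OF finite_set[of cs] a d, of "\<lambda>_. True"]
    show "F cs \<in> events" unfolding F_def using pat(1) by simp
    have "prob (F cs) = (\<Prod>c\<in>set cs. occupation_weight (square s \<inter> cell n -` {c}) True)"
      unfolding F_def using pat(2) by simp
    also have "\<dots> \<le> (\<Prod>c\<in>set cs. (1 / real n)\<^sup>2)"
    proof (rule prod_mono, rule conjI)
      fix c
      have "1 - exp (- x) \<le> x" for x :: real using exp_ge_add_one_self[of "-x"] by simp
      from this[of "measure lborel (square s \<inter> cell n -` {c})"]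
      show "occupation_weight (square s \<inter> cell n -` {c}) True \<le> (1 / real n)\<^sup>2"
        using piece_measure[OF n, of s c] by (simp add: occupation_weight_def)
      show "0 \<le> occupation_weight (square s \<inter> cell n -` {c}) True"
        by (simp add: occupation_weight_def)
    qed
    also have "\<dots> = ((1 / real n)\<^sup>2) ^ k"
      using cs distinct_card[of cs] by (auto simp: W_def V_def)
    finally show "prob (F cs) \<le> ((1 / real n)\<^sup>2) ^ k" .
  qed
  have "prob ?E \<le> prob (\<Union>cs\<in>W. F cs)"
    using sub finW F(1) by (intro finite_measure_mono) auto
  also have "\<dots> \<le> (\<Sum>cs\<in>W. prob (F cs))"
    using finW F(1) by (intro finite_measure_subadditive_finite) auto
  also have "\<dots> \<le> (\<Sum>cs\<in>W. ((1 / real n)\<^sup>2) ^ k)" by (intro sum_mono F)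
  also have "\<dots> = real (card W) * ((1 / real n)\<^sup>2) ^ k" by simp
  also have "\<dots> \<le> (real ((m + k) choose k))\<^sup>2 * ((1 / real n)\<^sup>2) ^ k"
    using cardW by (intro mult_right_mono) (auto simp flip: of_nat_power)
  also have "\<dots> \<le> ((real n * s + 1 + real k) ^ k / fact k)\<^sup>2 * ((1 / real n)\<^sup>2) ^ k"
  proof (intro mult_right_mono power_mono)
    have "real ((m + k) choose k) * fact k \<le> real (m + k) ^ k"
      using binomial_fact_pow[of "m + k" k] by (metis of_nat_fact of_nat_le_iff of_nat_mult of_nat_power)
    also have "\<dots> \<le> (real n * s + 1 + real k) ^ k"
    proof (rule power_mono)
      have "real (nat \<lfloor>real n * s\<rfloor>) \<le> real n * s"
        using s by (simp add: of_nat_nat)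
      then show "real (m + k) \<le> real n * s + 1 + real k" by (simp add: m_def)
    qed simp
    finally show "real ((m + k) choose k) \<le> (real n * s + 1 + real k) ^ k / fact k"
      by (simp add: field_simps)
  qed auto
  also have "\<dots> = (((real n * s + 1 + real k) / real n) ^ k / fact k)\<^sup>2"
  proof -
    have "((1 / real n)\<^sup>2) ^ k = ((1 / real n) ^ k)\<^sup>2" by (metis power_mult mult.commute)
    then show ?thesis by (simp add: power_divide power_mult_distrib mult.commute)
  qed
  finally show ?thesis .
qed

text \<open>At infinite resolution the union bound becomes the expected number of
  \<open>k\<close>-point chains: on average there are \<open>s^(2 * k) / fact k\<close> sets of
  \<open>k\<close> points, each of them increasing with probability
  \<open>1 / fact k\<close>.\<close>

lemma chain_prob_le:
  assumes s: "s \<ge> 0"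
  shows "chain_prob s k \<le> (s ^ k / fact k)\<^sup>2"
proof (rule LIMSEQ_le)
  show "(\<lambda>n. prob {\<omega>\<in>space M. coarse_path_in n (chain comp_le k) (cell n ` (\<Xi> \<omega> \<inter> square s))})
      \<longlonglongrightarrow> chain_prob s k"
    using path_event(2)[OF square_admissible limit_closed_chain[OF closed_rel_comp_le]]
    by (simp add: chain_prob_def has_chain_def)
  have "(\<lambda>n. (real n * s + 1 + real k) / real n) \<longlonglongrightarrow> s"
  proof -
    have "(\<lambda>n. s + (1 + real k) * (1 / real n)) \<longlonglongrightarrow> s + (1 + real k) * 0"
      by (intro tendsto_intros lim_1_over_n)
    moreover have "\<forall>\<^sub>F n in sequentially. s + (1 + real k) * (1 / real n) = (real n * s + 1 + real k) / real n"
      using eventually_gt_at_top[of 0] by eventually_elim (simp add: field_simps)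
    ultimately show ?thesis by (simp add: Lim_transform_eventually)
  qed
  then show "(\<lambda>n. (((real n * s + 1 + real k) / real n) ^ k / fact k)\<^sup>2) \<longlonglongrightarrow> (s ^ k / fact k)\<^sup>2"
    by (intro tendsto_intros) auto
  show "\<exists>N. \<forall>n\<ge>N. prob {\<omega>\<in>space M. coarse_path_in n (chain comp_le k) (cell n ` (\<Xi> \<omega> \<inter> square s))}
      \<le> (((real n * s + 1 + real k) / real n) ^ k / fact k)\<^sup>2"
    using coarse_chain_prob[OF _ s] by (intro exI[of _ 1]) auto
qed

text \<open>Means grow at most linearly in the side, so the supremum that defines the growth
  constant is finite. Probabilities of lengths up to about \<open>8 * s\<close> are bounded by 1;
  beyond that the factorials win.\<close>

lemma chain_prob_sum_le:
  assumes s: "s \<ge> 1"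
  shows "(\<Sum>k=1..K. chain_prob s k) \<le> 10 * s"
proof -
  \<comment> \<open>The threshold comes from \<open>(4 * s)^k / fact k \<le> exp (4 * s)\<close>:
    dividing by \<open>4^k\<close> and squaring gives \<open>exp (8 * s) / 16^k\<close>, which is at
    most \<open>(exp 1 / 16)^k\<close> once \<open>k \<ge> 8 * s\<close>.\<close>
  define k0 where "k0 = nat \<lceil>8 * s\<rceil>"
  have "chain_prob s k \<le> (if k \<le> k0 then 1 else 0) + (1 / 2) ^ k" for k
  proof (cases "k \<le> k0")
    case True
    then show ?thesis using prob_le_1 by (simp add: chain_prob_def add_increasing2)
  next
    case False
    then have k: "8 * s \<le> real k" by (auto simp: k0_def) linarith
    have "(4 * s) ^ k / fact k \<le> exp (4 * s)"
    proof -
      have "(\<Sum>i\<in>{k}. (4 * s) ^ i /\<^sub>R fact i) \<le> exp (4 * s)"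
        unfolding exp_def using s by (intro sum_le_suminf summable_exp_generic) auto
      then show ?thesis by (simp add: divide_inverse_commute)
    qed
    then have "s ^ k / fact k \<le> exp (4 * s) / 4 ^ k" by (simp add: power_mult_distrib field_simps)
    then have "(s ^ k / fact k)\<^sup>2 \<le> (exp (4 * s) / 4 ^ k)\<^sup>2" using s by (intro power_mono) auto
    also have "\<dots> = exp (8 * s) / 16 ^ k"
    proof -
      have "(4 ^ k)\<^sup>2 = (16::real) ^ k" by (simp add: power2_eq_square flip: power_mult_distrib)
      moreover have "(exp (4 * s))\<^sup>2 = exp (8 * s)" by (simp add: exp_double[symmetric])
      ultimately show ?thesis by (simp add: power_divide)
    qed
    also have "\<dots> \<le> exp (real k) / 16 ^ k" using k by (intro divide_right_mono) auto
    also have "\<dots> = (exp 1 / 16) ^ k" by (simp add: power_divide flip: exp_of_nat_mult)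
    also have "\<dots> \<le> (1 / 2) ^ k"
    proof (rule power_mono)
      show "exp (1::real) / 16 \<le> 1 / 2" using exp_le by linarith
    qed simp
    finally show ?thesis using chain_prob_le[of s k] s False by simp
  qed
  then have "(\<Sum>k=1..K. chain_prob s k) \<le> (\<Sum>k=1..K. (if k \<le> k0 then 1 else 0) + (1 / 2) ^ k)"
    by (rule sum_mono)
  also have "\<dots> = (\<Sum>k=1..K. (if k \<le> k0 then 1 else 0)) + (\<Sum>k=1..K. (1 / 2) ^ k)"
    by (simp add: sum.distrib)
  also have "(\<Sum>k=1..K. (if k \<le> k0 then 1 else 0 :: real)) \<le> (\<Sum>k=1..k0. 1)"
  proof -
    have "(\<Sum>k=1..K. (if k \<le> k0 then 1 else 0 :: real)) = (\<Sum>k\<in>{1..K} \<inter> {k. k \<le> k0}. 1)"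
      by (subst sum.inter_restrict) auto
    also have "\<dots> \<le> (\<Sum>k=1..k0. 1)" by (intro sum_mono2) auto
    finally show ?thesis .
  qed
  also have "(\<Sum>k=1..K. (1 / 2) ^ k) \<le> (1::real)"
  proof -
    have "(\<Sum>k=1..K. (1 / 2) ^ k) \<le> (\<Sum>k. (1 / 2 :: real) ^ Suc k)"
    proof -
      have "(\<Sum>k=1..K. (1 / 2 :: real) ^ k) = (\<Sum>k<K. (1 / 2) ^ Suc k)"
        by (rule sum.reindex_bij_witness[of _ Suc "\<lambda>k. k - 1"]) auto
      also have "\<dots> \<le> (\<Sum>k. (1 / 2 :: real) ^ Suc k)"
        by (intro sum_le_suminf) auto
      finally show ?thesis .
    qed
    also have "\<dots> = 1" using power_half_series by (simp add: sums_iff)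
    finally show ?thesis .
  qed
  \<comment> \<open>Rounding up \<open>8 * s\<close> and the geometric series cost at most 1 each,
    together at most \<open>2 * s\<close> because \<open>s \<ge> 1\<close>.\<close>
  also have "(\<Sum>k=1..k0. 1) + 1 \<le> 10 * s"
    using s by (simp add: k0_def) linarith
  finally show ?thesis by simp
qed

end

section \<open>The growth constant\<close>

text \<open>Tail-sum formula. It turns the expectation of a truncated length into a sum of chain
  probabilities.\<close>

lemma min_longest_eq_sum:
  assumes "finite X"
  shows "min (longest R X) K = (\<Sum>k=1..K. of_bool (has_chain R k X))"
proof -
  have "(\<Sum>k=1..K. of_bool (has_chain R k X)) = card {k\<in>{1..K}. k \<le> longest R X}"
    by (simp add: has_chain_iff[OF assms] sum.If_cases of_bool_def Int_def)
  also have "{k\<in>{1..K}. k \<le> longest R X} = {1..min (longest R X) K}" by auto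
  finally show ?thesis by simp
qed

lemma ceiling_le_longest_iff:
  assumes "finite X"
  shows "has_chain R (nat \<lceil>x\<rceil>) X \<longleftrightarrow> x \<le> real (longest R X)"
  by (simp add: has_chain_iff[OF assms] nat_ceiling_le_eq)

lemma measure_preserving_translation: "measure_preserving (\<lambda>x. x - v)"
  using lborel_distr_plus[of "- v"] by (simp add: measure_preserving_def add.commute[of "- v"] cong: distr_cong)

context quadrant_poisson
begin

text \<open>Chains for \<open>R\<close> in the window are componentwise chains of the image points,
  so the invariance of path laws under \<Phi> applies to them.\<close>

lemma chain_prob_transfer:
  assumes "admissible \<Phi> D" "D \<subseteq> quadrant" "inj \<Phi>" "\<And>x y. R x y \<longleftrightarrow> comp_le (\<Phi> x) (\<Phi> y)"
  shows "{\<omega>\<in>space M. has_chain R k (\<Xi> \<omega> \<inter> \<Phi> -` D)} \<in> events"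
    "prob {\<omega>\<in>space M. has_chain R k (\<Xi> \<omega> \<inter> \<Phi> -` D)} = prob {\<omega>\<in>space M. has_chain comp_le k (\<Xi> \<omega> \<inter> D)}"
proof -
  have eq: "has_chain comp_le k (\<Phi> ` (\<Xi> \<omega> \<inter> \<Phi> -` D)) \<longleftrightarrow> has_chain R k (\<Xi> \<omega> \<inter> \<Phi> -` D)" for \<omega>
    using assms(3,4) by (intro has_chain_image) (auto intro: inj_on_subset)
  note C = limit_closed_chain[OF closed_rel_comp_le, of k]
  show "{\<omega>\<in>space M. has_chain R k (\<Xi> \<omega> \<inter> \<Phi> -` D)} \<in> events"
    unfolding eq[symmetric] unfolding has_chain_def by (rule path_event(1)[OF assms(1) C])
  show "prob {\<omega>\<in>space M. has_chain R k (\<Xi> \<omega> \<inter> \<Phi> -` D)} = prob {\<omega>\<in>space M. has_chain comp_le k (\<Xi> \<omega> \<inter> D)}"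
    unfolding eq[symmetric] unfolding has_chain_def by (rule path_event_law[OF assms(1,2) C])
qed

lemma finite_square [simp]: "\<omega> \<in> space M \<Longrightarrow> finite (\<Xi> \<omega> \<inter> square s)"
  using square_admissible[of s] finite_points by (simp add: admissible_def)

lemma chain_prob_mono:
  assumes "s \<le> t" "l \<le> k"
  shows "chain_prob s k \<le> chain_prob t l"
proof -
  have "square s \<subseteq> square t" using assms by (auto simp: square_def)
  then show ?thesis unfolding chain_prob_def
    using chain_event[OF closed_rel_comp_le square_admissible, of l t] has_chain_mono[OF _ _ assms(2)]
    by (intro finite_measure_mono) blast+
qed

text \<open>By the tail-sum formula, the expected length of a longest chain in the square, cut off
  at \<open>K\<close>.\<close>

definition mean_trunc :: "real \<Rightarrow> nat \<Rightarrow> real" where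
  "mean_trunc s K = (\<Sum>k=1..K. chain_prob s k)"

text \<open>The constant of Hammersley's process, as a supremum over side and truncation level at
  once. Sides start at 1, where the linear bound on the means is available.\<close>

definition growth :: real where
  "growth = Sup {mean_trunc s K / s | s K. s \<ge> 1}"

lemma mean_trunc_le_growth: "s \<ge> 1 \<Longrightarrow> mean_trunc s K / s \<le> growth"
proof -
  have "bdd_above {mean_trunc s K / s | s K. s \<ge> 1}"
    using chain_prob_sum_le by (intro bdd_aboveI[of _ 10]) (auto simp: mean_trunc_def field_simps)
  then show "s \<ge> 1 \<Longrightarrow> mean_trunc s K / s \<le> growth"
    unfolding growth_def by (intro cSup_upper) auto
qed

text \<open>The unit square is occupied with positive probability. Positivity later allows an error
  margin to be a fraction of \<open>growth\<close>.\<close>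

lemma growth_pos: "growth > 0"
proof -
  have "chain_prob 1 1 = prob (space M - {\<omega>\<in>space M. \<Xi> \<omega> \<inter> square 1 = {}})"
  proof -
    have "has_chain comp_le 1 X \<longleftrightarrow> X \<noteq> {}" for X
    proof
      assume "X \<noteq> {}"
      then obtain x where "x \<in> X" by auto
      then show "has_chain comp_le 1 X" unfolding has_chain_def path_in_def
        by (intro exI[of _ "[x]"]) auto
    next
      assume "has_chain comp_le 1 X"
      then obtain ps where "length ps = 1" "set ps \<subseteq> X" by (auto simp: has_chain_def path_in_def)
      then show "X \<noteq> {}" by (cases ps) auto
    qed
    then show ?thesis unfolding chain_prob_def by (intro arg_cong[where f=prob]) auto
  qed
  also have "\<dots> = 1 - exp (- measure lborel (square 1))"
    using square_admissible[of 1] void_event[of "square 1"]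
    by (simp add: admissible_def prob_compl)
  finally have c: "chain_prob 1 1 = 1 - exp (- measure lborel (square 1))" .
  have "measure lborel (cbox (0, 0) (1 / 2, 1 / 2) :: (real \<times> real) set) \<le> measure lborel (square 1)"
  proof (rule measure_mono_fmeasurable)
    show "cbox (0, 0) (1 / 2, 1 / 2) \<subseteq> square 1" by (auto simp: square_def cbox_Pair_eq)
    have "square 1 \<subseteq> cbox (0, 0) (1, 1)" by (auto simp: square_def cbox_Pair_eq)
    then show "square 1 \<in> fmeasurable lborel"
      using square_admissible[of 1]
      by (intro fmeasurableI2[OF fmeasurable_cbox]) (simp_all add: admissible_def)
  qed auto
  moreover have "measure lborel (cbox (0, 0) (1 / 2, 1 / 2) :: (real \<times> real) set) = 1 / 4"
    by (simp add: measure_lborel_cbox_eq Basis_prod_def prod.union_disjoint)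
  ultimately have "chain_prob 1 1 > 0" unfolding c by simp
  then show ?thesis using mean_trunc_le_growth[of 1 1] by (simp add: mean_trunc_def)
qed

section \<open>Independent diagonal squares and Chebyshev's inequality\<close>

definition diag_square :: "real \<Rightarrow> nat \<Rightarrow> (real \<times> real) set" where
  "diag_square s i = {real i * s..<(real i + 1) * s} \<times> {real i * s..<(real i + 1) * s}"

definition diag_event :: "real \<Rightarrow> nat \<Rightarrow> nat \<Rightarrow> 'w set" where
  "diag_event s i k = {\<omega>\<in>space M. has_chain comp_le k (\<Xi> \<omega> \<inter> diag_square s i)}"

definition diag_count :: "real \<Rightarrow> nat \<Rightarrow> nat \<Rightarrow> 'w \<Rightarrow> real" where
  "diag_count s K i \<omega> = (\<Sum>k=1..K. indicator (diag_event s i k) \<omega>)"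

context
  fixes s :: real
  assumes s: "s > 0"
begin

lemma diag_admissible: "admissible (\<lambda>x. x) (diag_square s i)"
  unfolding diag_square_def using s by (intro rectangle_admissible) auto

lemma diag_event [measurable]: "diag_event s i k \<in> events"
  unfolding diag_event_def by (rule chain_event[OF closed_rel_comp_le diag_admissible])

lemma diag_event_prob: "prob (diag_event s i k) = chain_prob s k"
proof -
  let ?v = "(real i * s, real i * s)"
  have eq: "(\<lambda>x. x - ?v) -` square s = diag_square s i"
    by (auto simp: square_def diag_square_def algebra_simps)
  have sq: "square s \<in> sets borel" "bounded (square s)" "square s \<subseteq> quadrant"
    using square_admissible[of s] by (auto simp: admissible_def)
  have dq: "bounded (diag_square s i)" "diag_square s i \<subseteq> quadrant"
    using diag_admissible[of i] by (auto simp: admissible_def)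
  have "admissible (\<lambda>x. x - ?v) (square s)"
    unfolding admissible_def eq using measure_preserving_translation[of ?v] sq dq by simp
  from chain_prob_transfer(2)[OF this sq(3), of comp_le k] show ?thesis
    unfolding eq diag_event_def chain_prob_def by (auto simp: comp_le_def inj_on_def)
qed

lemma diag_event_indep:
  assumes "i \<noteq> j"
  shows "prob (diag_event s i k \<inter> diag_event s j l) = chain_prob s k * chain_prob s l"
proof -
  have "diag_square s i \<inter> diag_square s j = {}"
  proof -
    have *: "diag_square s i \<inter> diag_square s j = {}" if "i < j" for i j
    proof -
      have le: "(real i + 1) * s \<le> real j * s" using that s by (intro mult_right_mono) auto
      show ?thesis
      proof (rule ccontr)
        assume "diag_square s i \<inter> diag_square s j \<noteq> {}"
        then obtain x where "fst x < (real i + 1) * s" "real j * s \<le> fst x"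
          by (auto simp: diag_square_def)
        with le show False by linarith
      qed
    qed
    show ?thesis using *[of i j] *[of j i] assms by (cases i j rule: linorder_cases) auto
  qed
  from path_event_indep[OF diag_admissible diag_admissible this
      limit_closed_chain[OF closed_rel_comp_le] limit_closed_chain[OF closed_rel_comp_le], of k l]
  show ?thesis
    unfolding diag_event_prob[of i k, symmetric] diag_event_prob[of j l, symmetric]
    by (simp add: diag_event_def has_chain_def)
qed

lemma diag_count_bounds: "0 \<le> diag_count s K i \<omega>" "diag_count s K i \<omega> \<le> real K"
proof -
  show "0 \<le> diag_count s K i \<omega>" by (simp add: diag_count_def sum_nonneg)
  have "diag_count s K i \<omega> \<le> (\<Sum>k=1..K. 1)"
    unfolding diag_count_def by (intro sum_mono) (simp add: indicator_def)
  then show "diag_count s K i \<omega> \<le> real K" by simp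
qed

lemma diag_count_measurable [measurable]: "diag_count s K i \<in> borel_measurable M"
  unfolding diag_count_def by measurable

lemma diag_count_integrable: "integrable M (diag_count s K i)"
  using diag_count_bounds by (intro integrable_const_bound[where B = "real K"]) auto

lemma diag_count_expectation: "expectation (diag_count s K i) = mean_trunc s K"
proof -
  have "integrable M (indicator (diag_event s i k) :: _ \<Rightarrow> real)" for k
    by (rule integrable_real_indicator[OF diag_event]) (simp add: emeasure_eq_measure)
  then show ?thesis
    by (simp add: diag_count_def[abs_def] diag_event_prob mean_trunc_def diag_event)
qed

lemma diag_count_product:
  "integrable M (\<lambda>\<omega>. diag_count s K i \<omega> * diag_count s K j \<omega>)"
  "i \<noteq> j \<Longrightarrow> expectation (\<lambda>\<omega>. diag_count s K i \<omega> * diag_count s K j \<omega>) = (mean_trunc s K)\<^sup>2"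
proof -
  have "\<bar>diag_count s K i \<omega> * diag_count s K j \<omega>\<bar> \<le> real K * real K" for \<omega>
    unfolding abs_mult using diag_count_bounds by (intro mult_mono) auto
  then show "integrable M (\<lambda>\<omega>. diag_count s K i \<omega> * diag_count s K j \<omega>)"
    by (intro integrable_const_bound[where B = "real K * real K"]) auto
  assume ij: "i \<noteq> j"
  have "diag_count s K i \<omega> * diag_count s K j \<omega> =
      (\<Sum>k=1..K. \<Sum>l=1..K. indicator (diag_event s i k \<inter> diag_event s j l) \<omega>)" for \<omega>
    by (simp add: diag_count_def sum_product indicator_inter_arith)
  then have "expectation (\<lambda>\<omega>. diag_count s K i \<omega> * diag_count s K j \<omega>) =
      expectation (\<lambda>\<omega>. \<Sum>k=1..K. \<Sum>l=1..K. indicator (diag_event s i k \<inter> diag_event s j l) \<omega>)"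
    by simp
  also have "\<dots> = (\<Sum>k=1..K. \<Sum>l=1..K. prob (diag_event s i k \<inter> diag_event s j l))"
  proof -
    have "integrable M (indicator (diag_event s i k \<inter> diag_event s j l) :: _ \<Rightarrow> real)" for k l
      by (rule integrable_real_indicator) (simp_all add: emeasure_eq_measure diag_event)
    then show ?thesis by (simp add: diag_event)
  qed
  also have "\<dots> = (mean_trunc s K)\<^sup>2"
    by (simp add: diag_event_indep[OF ij] mean_trunc_def power2_eq_square sum_product)
  finally show "expectation (\<lambda>\<omega>. diag_count s K i \<omega> * diag_count s K j \<omega>) = (mean_trunc s K)\<^sup>2" .
qed

text \<open>Pairwise independence removes the off-diagonal covariances, and truncation bounds each
  variance by \<open>K^2\<close>; Chebyshev's inequality does the rest.\<close>

lemma diag_count_sum_tail: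
  assumes "\<epsilon> > 0" "n > 0"
  shows "prob {\<omega>\<in>space M. (\<Sum>i<n. diag_count s K i \<omega>) \<le> real n * (mean_trunc s K - \<epsilon>)} \<le>
    (real K)\<^sup>2 / (real n * \<epsilon>\<^sup>2)"
proof -
  define \<mu> where "\<mu> = mean_trunc s K"
  define Z where "Z i \<omega> = diag_count s K i \<omega> - \<mu>" for i \<omega>
  let ?f = "\<lambda>\<omega>. \<Sum>i<n. diag_count s K i \<omega>"
  have mu: "0 \<le> \<mu>" "\<mu> \<le> real K"
  proof -
    show "0 \<le> \<mu>" by (auto simp: \<mu>_def mean_trunc_def chain_prob_def intro: sum_nonneg)
    have "\<mu> \<le> (\<Sum>k=1..K. 1)"
      unfolding \<mu>_def mean_trunc_def chain_prob_def by (intro sum_mono) simp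
    then show "\<mu> \<le> real K" by simp
  qed
  have intZ: "integrable M (\<lambda>\<omega>. Z i \<omega> * Z j \<omega>)" for i j
    unfolding Z_def by (simp add: left_diff_distrib right_diff_distrib diag_count_product(1) diag_count_integrable)
  have Zij: "expectation (\<lambda>\<omega>. Z i \<omega> * Z j \<omega>) \<le> (if i = j then (real K)\<^sup>2 else 0)" for i j
  proof (cases "i = j")
    case True
    have "Z i \<omega> * Z i \<omega> \<le> (real K)\<^sup>2" for \<omega>
    proof -
      have "\<bar>Z i \<omega>\<bar> \<le> real K"
        using diag_count_bounds[of K i \<omega>] mu by (auto simp: Z_def)
      then have "\<bar>Z i \<omega>\<bar>\<^sup>2 \<le> (real K)\<^sup>2" by (intro power_mono) auto
      then show ?thesis by (simp add: power2_eq_square)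
    qed
    then have "expectation (\<lambda>\<omega>. Z i \<omega> * Z i \<omega>) \<le> expectation (\<lambda>\<omega>. (real K)\<^sup>2)"
      by (intro integral_mono intZ) auto
    then show ?thesis using True by (simp add: prob_space)
  next
    case False
    have "Z i \<omega> * Z j \<omega> = diag_count s K i \<omega> * diag_count s K j \<omega> - \<mu> * diag_count s K i \<omega> -
        \<mu> * diag_count s K j \<omega> + \<mu>\<^sup>2" for \<omega>
      by (simp add: Z_def algebra_simps power2_eq_square)
    then have "expectation (\<lambda>\<omega>. Z i \<omega> * Z j \<omega>) = \<mu>\<^sup>2 - \<mu> * \<mu> - \<mu> * \<mu> + \<mu>\<^sup>2"
      using False by (simp add: diag_count_product diag_count_integrable diag_count_expectation
          flip: \<mu>_def) (simp add: prob_space)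
    then show ?thesis using False by (simp add: power2_eq_square)
  qed
  have fsum: "(?f \<omega> - real n * \<mu>)\<^sup>2 = (\<Sum>i<n. \<Sum>j<n. Z i \<omega> * Z j \<omega>)" for \<omega>
    by (simp add: Z_def sum_subtractf power2_eq_square flip: sum_product)
  have Ef: "expectation ?f = real n * \<mu>"
    by (simp add: diag_count_integrable diag_count_expectation \<mu>_def)
  have "variance ?f = (\<Sum>i<n. \<Sum>j<n. expectation (\<lambda>\<omega>. Z i \<omega> * Z j \<omega>))"
    unfolding Ef fsum by (simp add: intZ)
  also have "\<dots> \<le> (\<Sum>i<n. \<Sum>j<n. if i = j then (real K)\<^sup>2 else 0)"
    by (intro sum_mono Zij)
  also have "\<dots> = real n * (real K)\<^sup>2" by (simp add: sum.delta)
  finally have var: "variance ?f \<le> real n * (real K)\<^sup>2" .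
  have "(?f \<omega>)\<^sup>2 = (\<Sum>i<n. \<Sum>j<n. diag_count s K i \<omega> * diag_count s K j \<omega>)" for \<omega>
    by (simp add: power2_eq_square sum_product)
  then have int2: "integrable M (\<lambda>\<omega>. (?f \<omega>)\<^sup>2)"
    by (simp add: diag_count_product(1))
  have "prob {\<omega>\<in>space M. ?f \<omega> \<le> real n * (\<mu> - \<epsilon>)} \<le>
      prob {\<omega>\<in>space M. real n * \<epsilon> \<le> \<bar>?f \<omega> - expectation ?f\<bar>}"
    unfolding Ef by (intro finite_measure_mono) (auto simp: algebra_simps)
  also have "\<dots> \<le> variance ?f / (real n * \<epsilon>)\<^sup>2"
    using assms int2 by (intro Chebyshev_inequality) auto
  also have "\<dots> \<le> (real n * (real K)\<^sup>2) / (real n * \<epsilon>)\<^sup>2"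
    by (intro divide_right_mono var) auto
  also have "\<dots> = (real K)\<^sup>2 / (real n * \<epsilon>\<^sup>2)"
    using assms by (simp add: power2_eq_square)
  finally show ?thesis by (simp add: \<mu>_def)
qed

text \<open>Every point of a diagonal square precedes every point of a later one in both
  coordinates, so the longest chains of successive squares concatenate.\<close>

lemma diag_counts_chain:
  assumes \<omega>: "\<omega> \<in> space M"
  shows "(\<Sum>i<n. diag_count s K i \<omega>) \<le> real (longest comp_le (\<Xi> \<omega> \<inter> square (real n * s)))"
proof -
  define m where "m i = min (longest comp_le (\<Xi> \<omega> \<inter> diag_square s i)) K" for i
  have fin: "finite (\<Xi> \<omega> \<inter> diag_square s i)" for i
    using diag_admissible[of i] finite_points[OF \<omega>] by (simp add: admissible_def)
  have count: "diag_count s K i \<omega> = real (m i)" for i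
    unfolding m_def min_longest_eq_sum[OF fin] diag_count_def of_nat_sum
    by (rule sum.cong) (use \<omega> in \<open>auto simp: diag_event_def\<close>)
  have "has_chain comp_le (\<Sum>i<n. m i) (\<Xi> \<omega> \<inter> square (real n * s))"
  proof (induction n)
    case (Suc n)
    have "has_chain comp_le (m n) (\<Xi> \<omega> \<inter> diag_square s n)"
      by (simp add: has_chain_iff[OF fin] m_def)
    then have "has_chain comp_le ((\<Sum>i<n. m i) + m n)
        ((\<Xi> \<omega> \<inter> square (real n * s)) \<union> (\<Xi> \<omega> \<inter> diag_square s n))"
      by (intro has_chain_append Suc) (auto simp: square_def diag_square_def comp_le_def)
    moreover have "square (real n * s) \<union> diag_square s n \<subseteq> square (real (Suc n) * s)"
    proof -
      have "0 \<le> real n * s" "real n * s \<le> real (Suc n) * s" using s by (auto intro: mult_right_mono)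
      then show ?thesis by (auto simp: square_def diag_square_def add.commute)
    qed
    ultimately show ?case using has_chain_mono[where l="\<Sum>i<Suc n. m i"] by (simp add: Int_Un_distrib) blast
  qed simp
  then show ?thesis
    by (simp add: has_chain_iff[OF finite_square[OF \<omega>]] count flip: of_nat_sum)
qed

lemma chain_prob_lower:
  assumes "\<epsilon> > 0" "n > 0" "real n * s \<le> t" "x \<le> real n * (mean_trunc s K - \<epsilon>)"
  shows "1 - (real K)\<^sup>2 / (real n * \<epsilon>\<^sup>2) \<le> chain_prob t (nat \<lceil>x\<rceil>)"
proof -
  let ?A = "{\<omega>\<in>space M. (\<Sum>i<n. diag_count s K i \<omega>) \<le> real n * (mean_trunc s K - \<epsilon>)}"
  have "1 - (real K)\<^sup>2 / (real n * \<epsilon>\<^sup>2) \<le> 1 - prob ?A"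
    using diag_count_sum_tail[OF assms(1,2), of K] by simp
  also have "\<dots> = prob (space M - ?A)" by (subst prob_compl) auto
  also have "\<dots> \<le> chain_prob (real n * s) (nat \<lceil>x\<rceil>)"
    unfolding chain_prob_def
  proof (intro finite_measure_mono subsetI chain_event closed_rel_comp_le square_admissible)
    fix \<omega> assume "\<omega> \<in> space M - ?A"
    then show "\<omega> \<in> {\<omega>\<in>space M. has_chain comp_le (nat \<lceil>x\<rceil>) (\<Xi> \<omega> \<inter> square (real n * s))}"
      using diag_counts_chain[of \<omega> K n] assms(4) by (auto simp: ceiling_le_longest_iff)
  qed
  also have "\<dots> \<le> chain_prob t (nat \<lceil>x\<rceil>)" by (rule chain_prob_mono[OF assms(3) order_refl])
  finally show ?thesis .
qed

end

section \<open>Lower and upper tails in large squares\<close>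

lemma chain_prob_le_1: "chain_prob t k \<le> 1"
  unfolding chain_prob_def by (rule prob_le_1)

lemma chain_prob_lower_tail:
  assumes \<eta>: "\<eta> > 0"
  shows "((\<lambda>t. chain_prob t (nat \<lceil>(growth - \<eta>) * t\<rceil>)) \<longlongrightarrow> 1) at_top"
proof -
  \<comment> \<open>The margin \<eta> is split per unit of side: a quarter for missing the supremum,
    a quarter for the deviation in Chebyshev's inequality, and half for the part of the diagonal
    that the small squares leave uncovered.\<close>
  have "\<exists>y\<in>{mean_trunc s K / s | s K. s \<ge> 1}. growth - \<eta> / 4 < y"
    unfolding growth_def
    by (rule less_cSupD) (use \<eta> in \<open>auto intro: exI[of _ 1]\<close>)
  then obtain s K where s: "s \<ge> 1" and K: "growth - \<eta> / 4 < mean_trunc s K / s" by auto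
  define \<epsilon> where "\<epsilon> = s * \<eta> / 4"
  have e: "\<epsilon> > 0" using s \<eta> by (simp add: \<epsilon>_def)
  define n where "n t = nat \<lfloor>t / s\<rfloor>" for t
  have nt: "real (n t) \<le> t / s" "t / s - 1 \<le> real (n t)" if "t \<ge> 0" for t
    using that s by (auto simp: n_def of_nat_nat)
  have lim_n: "filterlim (\<lambda>t. real (n t)) at_top at_top"
    unfolding filterlim_at_top
  proof
    fix Z :: real
    show "\<forall>\<^sub>F t in at_top. Z \<le> real (n t)"
      using eventually_ge_at_top[of 0] eventually_ge_at_top[of "s * (Z + 1)"]
    proof eventually_elim
      case (elim t)
      then have "Z + 1 \<le> t / s" using s by (simp add: field_simps)
      then show ?case using nt(2)[OF elim(1)] by linarith
    qed
  qed
  have lim: "((\<lambda>t. 1 - (real K)\<^sup>2 / (real (n t) * \<epsilon>\<^sup>2)) \<longlongrightarrow> 1 - 0) at_top"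
    using e by (intro tendsto_diff tendsto_const tendsto_divide_0[OF tendsto_const]
        filterlim_at_top_imp_at_infinity filterlim_at_top_mult_tendsto_pos[OF tendsto_const _ lim_n]) auto
  \<comment> \<open>The first threshold makes the number of small squares positive. The second makes
    the uncovered length, at most \<open>s\<close>, worth no more than half of the margin.\<close>
  have lower: "\<forall>\<^sub>F t in at_top. 1 - (real K)\<^sup>2 / (real (n t) * \<epsilon>\<^sup>2) \<le> chain_prob t (nat \<lceil>(growth - \<eta>) * t\<rceil>)"
    using eventually_ge_at_top[of "2 * s"] eventually_ge_at_top[of "s * \<bar>growth - \<eta> / 2\<bar> * 2 / \<eta>"]
  proof eventually_elim
    case (elim t)
    have t: "t \<ge> 0" using elim s by simp
    have "t / s \<ge> 2" using elim s by (simp add: field_simps)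
    then have "real (n t) > 0" using nt(2)[OF t] by linarith
    then have n0: "n t > 0" by simp
    have ns: "real (n t) * s \<le> t" "t - s \<le> real (n t) * s"
      using nt[OF t] s by (auto simp: field_simps)
    have "(growth - \<eta>) * t \<le> real (n t) * (mean_trunc s K - \<epsilon>)"
    proof -
      have "(growth - \<eta> / 2) * (t - real (n t) * s) \<le> \<bar>growth - \<eta> / 2\<bar> * s"
      proof -
        have "(growth - \<eta> / 2) * (t - real (n t) * s) \<le> \<bar>growth - \<eta> / 2\<bar> * (t - real (n t) * s)"
          using ns by (intro mult_right_mono) auto
        also have "\<dots> \<le> \<bar>growth - \<eta> / 2\<bar> * s" using ns by (intro mult_left_mono) auto
        finally show ?thesis .
      qed
      also have "\<dots> \<le> t * \<eta> / 2" using elim(2) \<eta> by (simp add: field_simps)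
      finally have "(growth - \<eta>) * t \<le> real (n t) * (s * (growth - \<eta> / 2))"
        by (simp add: algebra_simps)
      also have "\<dots> \<le> real (n t) * (mean_trunc s K - \<epsilon>)"
        using K s by (intro mult_left_mono) (auto simp: \<epsilon>_def field_simps)
      finally show ?thesis .
    qed
    then show ?case using chain_prob_lower[OF _ e n0 ns(1)] s by simp
  qed
  show ?thesis
    by (rule tendsto_sandwich[OF lower _ lim[simplified] tendsto_const]) (simp add: chain_prob_le_1)
qed

text \<open>Let \<open>p\<close> be the upper tail, at length \<open>K\<close>, and \<open>q\<close>
  the probability of a length \<open>J\<close> just below the typical one. The tail sum gives
  \<open>J * q + (K - J) * p \<le> growth * t\<close>; as \<open>q\<close> tends to 1, the first
  term nearly exhausts the bound and leaves little room for \<open>p\<close>.\<close>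

lemma chain_prob_upper_tail:
  assumes \<epsilon>: "\<epsilon> > 0"
  shows "((\<lambda>t. chain_prob t (nat \<lceil>(growth + \<epsilon>) * t\<rceil>)) \<longlongrightarrow> 0) at_top"
proof (rule order_tendstoI)
  fix a :: real assume a: "a < 0"
  have "a < chain_prob t k" for t k
    using a measure_nonneg[of M] unfolding chain_prob_def by (rule order_less_le_trans)
  then show "\<forall>\<^sub>F t in at_top. a < chain_prob t (nat \<lceil>(growth + \<epsilon>) * t\<rceil>)" by simp
next
  fix e :: real assume e: "0 < e"
  \<comment> \<open>Chosen so that \<open>2 * \<eta> = \<epsilon> * e\<close>, the bound that
    \<open>\<epsilon> * p\<close> meets in the end.\<close>
  define \<eta> where "\<eta> = \<epsilon> * e / 2"
  have \<eta>: "\<eta> > 0" using \<epsilon> e by (simp add: \<eta>_def)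
  have "((\<lambda>t. growth - (growth - \<eta>) * chain_prob t (nat \<lceil>(growth - \<eta>) * t\<rceil>)) \<longlongrightarrow>
      growth - (growth - \<eta>) * 1) at_top"
    by (intro tendsto_intros chain_prob_lower_tail \<eta>)
  then have "\<forall>\<^sub>F t in at_top. growth - (growth - \<eta>) * chain_prob t (nat \<lceil>(growth - \<eta>) * t\<rceil>) < 2 * \<eta>"
    by (rule order_tendstoD) (use \<eta> in simp)
  then show "\<forall>\<^sub>F t in at_top. chain_prob t (nat \<lceil>(growth + \<epsilon>) * t\<rceil>) < e"
    using eventually_ge_at_top[of 1]
  proof eventually_elim
    case (elim t)
    define K where "K = nat \<lceil>(growth + \<epsilon>) * t\<rceil>"
    define J where "J = nat \<lceil>(growth - \<eta>) * t\<rceil>"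
    define p where "p = chain_prob t K"
    define q where "q = chain_prob t J"
    have t: "t > 0" using elim by simp
    have "(growth - \<eta>) * t \<le> (growth + \<epsilon>) * t" using t \<epsilon> \<eta> by (intro mult_right_mono) auto
    then have JK: "J \<le> K" unfolding J_def K_def by (intro nat_mono ceiling_mono)
    have pq: "p \<le> q" unfolding p_def q_def by (rule chain_prob_mono[OF order_refl JK])
    \<comment> \<open>Chain probabilities decrease in the length: terms up to \<open>J\<close> are
      at least \<open>q\<close>, the remaining ones up to \<open>K\<close> at least
      \<open>p\<close>.\<close>
    have "(\<Sum>k\<in>{1..J}. q) + (\<Sum>k\<in>{J<..K}. p) \<le> (\<Sum>k\<in>{1..J}. chain_prob t k) + (\<Sum>k\<in>{J<..K}. chain_prob t k)"
      unfolding p_def q_def by (intro add_mono sum_mono chain_prob_mono) auto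
    also have "\<dots> = mean_trunc t K"
    proof -
      have "{1..K} = {1..J} \<union> {J<..K}" using JK by auto
      moreover have "sum (chain_prob t) ({1..J} \<union> {J<..K}) = sum (chain_prob t) {1..J} + sum (chain_prob t) {J<..K}"
        by (rule sum.union_disjoint) auto
      ultimately show ?thesis unfolding mean_trunc_def by presburger
    qed
    also have "\<dots> \<le> growth * t"
      using mean_trunc_le_growth[of t K] elim(2) by (simp add: field_simps)
    finally have "real J * q + (real K - real J) * p \<le> growth * t"
      using JK by (simp add: of_nat_diff)
    then have "real J * (q - p) + real K * p \<le> growth * t" by (simp add: algebra_simps)
    moreover have "(growth - \<eta>) * t * (q - p) \<le> real J * (q - p)"
      using pq by (intro mult_right_mono) (auto simp: J_def real_nat_ceiling_ge)
    moreover have "(growth + \<epsilon>) * t * p \<le> real K * p"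
      by (intro mult_right_mono) (auto simp: K_def p_def chain_prob_def real_nat_ceiling_ge)
    ultimately have "((growth - \<eta>) * (q - p) + (growth + \<epsilon>) * p) * t \<le> growth * t"
      by (simp add: algebra_simps)
    then have "(growth - \<eta>) * (q - p) + (growth + \<epsilon>) * p \<le> growth" using t by simp
    then have "\<epsilon> * p + \<eta> * p \<le> growth - (growth - \<eta>) * q" by (simp add: algebra_simps)
    also have "\<dots> < \<epsilon> * e" using elim(1) by (simp add: q_def J_def \<eta>_def)
    finally have "\<epsilon> * p + \<eta> * p < \<epsilon> * e" .
    moreover have "0 \<le> \<eta> * p" using \<eta> by (simp add: p_def chain_prob_def)
    ultimately have "\<epsilon> * p < \<epsilon> * e" by linarith
    then show ?case using \<epsilon> by (simp add: p_def K_def)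
  qed
qed

end

section \<open>Area-preserving coordinates adapted to the cone\<close>

lemma box_real_pair: "box l u = {fst l<..<fst u} \<times> {snd l<..<snd u}" for l u :: "real \<times> real"
  by (cases l; cases u) (auto simp: box_def Basis_prod_def)

lemma measure_preservingI:
  assumes m: "\<Phi> \<in> borel_measurable borel"
    and e: "\<And>l1 u1 l2 u2. l1 \<le> u1 \<Longrightarrow> l2 \<le> u2 \<Longrightarrow>
      emeasure lborel (\<Phi> -` ({l1<..<u1} \<times> {l2<..<u2})) = ennreal ((u1 - l1) * (u2 - l2))"
  shows "measure_preserving \<Phi>"
proof -
  have "lborel = distr lborel borel \<Phi>"
  proof (rule lborel_eqI)
    fix l u :: "real \<times> real" assume lu: "\<And>b. b \<in> Basis \<Longrightarrow> l \<bullet> b \<le> u \<bullet> b"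
    have le: "fst l \<le> fst u" "snd l \<le> snd u"
      using lu[of "(1, 0)"] lu[of "(0, 1)"] by (auto simp: Basis_prod_def inner_prod_def)
    have "emeasure (distr lborel borel \<Phi>) (box l u) = emeasure lborel (\<Phi> -` box l u)"
      using m by (subst emeasure_distr) auto
    also have "\<dots> = ennreal ((fst u - fst l) * (snd u - snd l))"
      unfolding box_real_pair by (rule e[OF le])
    also have "\<dots> = (\<Prod>b\<in>Basis. (u - l) \<bullet> b)"
      by (simp add: Basis_prod_def prod.union_disjoint inner_prod_def mult.commute)
    finally show "emeasure (distr lborel borel \<Phi>) (box l u) = (\<Prod>b\<in>Basis. (u - l) \<bullet> b)" .
  qed simp
  then show ?thesis using m by (simp add: measure_preserving_def)
qed

text \<open>By Fubini it suffices to look at vertical slices, on which the shear is a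
  translation.\<close>

lemma measure_preserving_shear_snd: "measure_preserving (\<lambda>z. (fst z, snd z + q * fst z))"
proof (rule measure_preservingI)
  show m: "(\<lambda>z. (fst z, snd z + q * fst z)) \<in> borel_measurable borel"
    by (intro borel_measurable_continuous_onI continuous_intros)
  fix l1 u1 l2 u2 :: real assume le: "l1 \<le> u1" "l2 \<le> u2"
  let ?A = "(\<lambda>z. (fst z, snd z + q * fst z)) -` ({l1<..<u1} \<times> {l2<..<u2})"
  have "open ({l1<..<u1} \<times> {l2<..<u2})" by (intro open_Times) auto
  then have "?A \<in> sets (borel :: (real \<times> real) measure)"
    using measurable_sets[OF m, of "{l1<..<u1} \<times> {l2<..<u2}"] by simp
  then have A: "?A \<in> sets (lborel \<Otimes>\<^sub>M lborel)" by (subst lborel_prod) simp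
  have "emeasure lborel ?A = (\<integral>\<^sup>+x. emeasure lborel (Pair x -` ?A) \<partial>lborel)"
    using lborel.emeasure_pair_measure_alt[OF A] by (simp add: lborel_prod)
  also have "\<dots> = (\<integral>\<^sup>+x. ennreal (u2 - l2) * indicator {l1<..<u1} x \<partial>lborel)"
  proof (rule nn_integral_cong)
    fix x :: real
    have "Pair x -` ?A = (if x \<in> {l1<..<u1} then {l2 - q * x<..<u2 - q * x} else {})"
      by auto
    then show "emeasure lborel (Pair x -` ?A) = ennreal (u2 - l2) * indicator {l1<..<u1} x"
      using le by simp
  qed
  also have "\<dots> = ennreal ((u1 - l1) * (u2 - l2))"
    using le by (simp add: nn_integral_cmult ennreal_mult mult.commute)
  finally show "emeasure lborel ?A = ennreal ((u1 - l1) * (u2 - l2))" .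
qed

lemma measure_preserving_shear_fst: "measure_preserving (\<lambda>z. (fst z + q * snd z, snd z))"
proof (rule measure_preservingI)
  show m: "(\<lambda>z. (fst z + q * snd z, snd z)) \<in> borel_measurable borel"
    by (intro borel_measurable_continuous_onI continuous_intros)
  fix l1 u1 l2 u2 :: real assume le: "l1 \<le> u1" "l2 \<le> u2"
  let ?A = "(\<lambda>z. (fst z + q * snd z, snd z)) -` ({l1<..<u1} \<times> {l2<..<u2})"
  have "open ({l1<..<u1} \<times> {l2<..<u2})" by (intro open_Times) auto
  then have "?A \<in> sets (borel :: (real \<times> real) measure)"
    using measurable_sets[OF m, of "{l1<..<u1} \<times> {l2<..<u2}"] by simp
  then have A: "?A \<in> sets (lborel \<Otimes>\<^sub>M lborel)" by (subst lborel_prod) simp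
  have "emeasure lborel ?A = (\<integral>\<^sup>+y. emeasure lborel ((\<lambda>x. (x, y)) -` ?A) \<partial>lborel)"
    using lborel_pair.emeasure_pair_measure_alt2[OF A] by (simp add: lborel_prod)
  also have "\<dots> = (\<integral>\<^sup>+y. ennreal (u1 - l1) * indicator {l2<..<u2} y \<partial>lborel)"
  proof (rule nn_integral_cong)
    fix y :: real
    have "(\<lambda>x. (x, y)) -` ?A = (if y \<in> {l2<..<u2} then {l1 - q * y<..<u1 - q * y} else {})"
      by auto
    then show "emeasure lborel ((\<lambda>x. (x, y)) -` ?A) = ennreal (u1 - l1) * indicator {l2<..<u2} y"
      using le by simp
  qed
  also have "\<dots> = ennreal ((u1 - l1) * (u2 - l2))"
    using le by (simp add: nn_integral_cmult ennreal_mult)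
  finally show "emeasure lborel ?A = ennreal ((u1 - l1) * (u2 - l2))" .
qed

lemma measure_preserving_squeeze:
  assumes p: "p > 0"
  shows "measure_preserving (\<lambda>z. (p * fst z, snd z / p))"
proof (rule measure_preservingI)
  show "(\<lambda>z. (p * fst z, snd z / p)) \<in> borel_measurable borel"
    using p by (intro borel_measurable_continuous_onI continuous_intros) auto
  fix l1 u1 l2 u2 :: real assume le: "l1 \<le> u1" "l2 \<le> u2"
  have "(\<lambda>z. (p * fst z, snd z / p)) -` ({l1<..<u1} \<times> {l2<..<u2}) = box (l1 / p, l2 * p) (u1 / p, u2 * p)"
    using p by (auto simp: box_real_pair field_simps)
  then show "emeasure lborel ((\<lambda>z. (p * fst z, snd z / p)) -` ({l1<..<u1} \<times> {l2<..<u2})) =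
      ennreal ((u1 - l1) * (u2 - l2))"
    using le p by (simp add: emeasure_lborel_box_eq Basis_prod_def prod.union_disjoint inner_prod_def
        divide_right_mono mult_right_mono left_diff_distrib[symmetric] diff_divide_distrib[symmetric])
qed

definition cone_coord :: "real \<Rightarrow> real \<Rightarrow> real \<times> real \<Rightarrow> real \<times> real" where
  "cone_coord \<alpha> \<beta> z = ((\<beta> * fst z - snd z) / sqrt (\<beta> - \<alpha>), (snd z - \<alpha> * fst z) / sqrt (\<beta> - \<alpha>))"

definition cone_point :: "real \<Rightarrow> real \<Rightarrow> real \<times> real \<Rightarrow> real \<times> real" where
  "cone_point \<alpha> \<beta> v = ((fst v + snd v) / sqrt (\<beta> - \<alpha>), (\<alpha> * fst v + \<beta> * snd v) / sqrt (\<beta> - \<alpha>))"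

text \<open>In the original plane this is a parallelogram with sides of slopes \<alpha> and \<beta>.
  It is half-open like \<open>square\<close>, so that rescaling identifies the two exactly.\<close>

definition cone_rect :: "real \<Rightarrow> real \<Rightarrow> real \<times> real \<Rightarrow> real \<times> real \<Rightarrow> (real \<times> real) set" where
  "cone_rect \<alpha> \<beta> v w = cone_coord \<alpha> \<beta> -` ({fst v..<fst w} \<times> {snd v..<snd w})"

text \<open>The two slope inequalities add up to
  \<open>0 \<le> (\<beta> - \<alpha>) * (fst q - fst p)\<close>, so they already imply the condition
  on the first coordinates.\<close>

lemma slope_le_iff_comp_le:
  assumes "\<alpha> < \<beta>"
  shows "slope_le \<alpha> \<beta> p q \<longleftrightarrow> comp_le (cone_coord \<alpha> \<beta> p) (cone_coord \<alpha> \<beta> q)"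
proof -
  have "fst p \<le> fst q" if "\<alpha> * (fst q - fst p) \<le> snd q - snd p" "snd q - snd p \<le> \<beta> * (fst q - fst p)"
  proof -
    have "0 \<le> (\<beta> - \<alpha>) * (fst q - fst p)" using that by (simp add: left_diff_distrib)
    then show ?thesis using assms by (simp add: zero_le_mult_iff)
  qed
  then show ?thesis
    using assms by (auto simp: slope_le_def comp_le_def cone_coord_def divide_le_cancel algebra_simps)
qed

lemma cone_point_coord:
  assumes "\<alpha> < \<beta>"
  shows "cone_point \<alpha> \<beta> (cone_coord \<alpha> \<beta> z) = z" "cone_coord \<alpha> \<beta> (cone_point \<alpha> \<beta> v) = v"
proof -
  define \<kappa> where "\<kappa> = sqrt (\<beta> - \<alpha>)"
  have \<kappa>: "\<kappa> \<noteq> 0" "\<beta> - \<alpha> = \<kappa> * \<kappa>" using assms by (auto simp: \<kappa>_def)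
  have b: "\<beta> = \<alpha> + \<kappa> * \<kappa>" using \<kappa>(2) by simp
  show "cone_point \<alpha> \<beta> (cone_coord \<alpha> \<beta> z) = z"
    unfolding cone_point_def cone_coord_def \<kappa>_def[symmetric]
    using \<kappa>(1) by (cases z) (simp add: b field_simps)
  show "cone_coord \<alpha> \<beta> (cone_point \<alpha> \<beta> v) = v"
    unfolding cone_point_def cone_coord_def \<kappa>_def[symmetric]
    using \<kappa>(1) by (cases v) (simp add: b field_simps)
qed

text \<open>The map factors into a vertical shear by \<open>- \<alpha>\<close>, a horizontal shear
  by \<open>- 1 / \<kappa>^2\<close> and a squeeze by \<kappa>, each of which preserves
  area.\<close>

lemma measure_preserving_cone_coord:
  assumes "\<alpha> < \<beta>"
  shows "measure_preserving (cone_coord \<alpha> \<beta>)"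
proof -
  define \<kappa> where "\<kappa> = sqrt (\<beta> - \<alpha>)"
  have \<kappa>: "\<kappa> > 0" "\<kappa> * \<kappa> = \<beta> - \<alpha>" using assms by (auto simp: \<kappa>_def)
  define f where "f z = (fst z, snd z + (- \<alpha>) * fst z)" for z :: "real \<times> real"
  define g where "g z = (fst z + (- 1 / (\<kappa> * \<kappa>)) * snd z, snd z)" for z :: "real \<times> real"
  define h where "h z = (\<kappa> * fst z, snd z / \<kappa>)" for z :: "real \<times> real"
  have "measure_preserving f" "measure_preserving g" "measure_preserving h"
    unfolding f_def g_def h_def
    by (rule measure_preserving_shear_snd measure_preserving_shear_fst measure_preserving_squeeze[OF \<kappa>(1)])+
  then have "measure_preserving (\<lambda>z. h (g (f z)))"
    using measure_preserving_comp[of "\<lambda>z. g (f z)" h] measure_preserving_comp[of f g] by blast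
  also have "(\<lambda>z. h (g (f z))) = cone_coord \<alpha> \<beta>"
  proof
    fix z :: "real \<times> real"
    have "\<kappa> * (fst z - (snd z - \<alpha> * fst z) / (\<kappa> * \<kappa>)) = (\<kappa> * \<kappa> * fst z - (snd z - \<alpha> * fst z)) / \<kappa>"
      using \<kappa>(1) by (simp add: field_simps)
    also have "\<dots> = (\<beta> * fst z - snd z) / \<kappa>" unfolding \<kappa>(2) by (simp add: algebra_simps)
    finally show "h (g (f z)) = cone_coord \<alpha> \<beta> z"
      by (simp add: cone_coord_def \<kappa>_def[symmetric] f_def g_def h_def)
  qed
  finally show ?thesis .
qed

context quadrant_poisson
begin

text \<open>The preimage of the square may stick out of the quadrant, where there are no points.
  Only a part \<open>D\<close> of the square is then visible, which yields an inequality; for a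
  preimage inside the quadrant the law is that of the full square.\<close>

lemma square_chain_transfer:
  assumes mp: "measure_preserving \<Phi>" and cont: "continuous_on UNIV \<Phi>'"
    and inv: "\<And>z. \<Phi>' (\<Phi> z) = z" and ord: "\<And>x y. R x y \<longleftrightarrow> comp_le (\<Phi> x) (\<Phi> y)"
  shows "{\<omega>\<in>space M. has_chain R k (\<Xi> \<omega> \<inter> \<Phi> -` square s)} \<in> events"
    "prob {\<omega>\<in>space M. has_chain R k (\<Xi> \<omega> \<inter> \<Phi> -` square s)} \<le> chain_prob s k"
    "\<Phi> -` square s \<subseteq> quadrant \<Longrightarrow> (\<And>z. \<Phi> (\<Phi>' z) = z) \<Longrightarrow>
      prob {\<omega>\<in>space M. has_chain R k (\<Xi> \<omega> \<inter> \<Phi> -` square s)} = chain_prob s k"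
    "bounded (\<Phi> -` square s)"
proof -
  define D where "D = square s \<inter> \<Phi>' -` quadrant"
  have sq: "square s \<in> sets borel" "bounded (square s)" "square s \<subseteq> quadrant"
    using square_admissible[of s] by (auto simp: admissible_def)
  have "square s \<subseteq> cbox (0, 0) (s, s)" by (auto simp: square_def cbox_Pair_eq)
  then have "\<Phi> -` square s \<subseteq> \<Phi>' ` cbox (0, 0) (s, s)" using inv by (metis image_eqI subsetD subsetI vimageE)
  moreover have "compact (\<Phi>' ` cbox (0, 0) (s, s))"
    by (intro compact_continuous_image compact_cbox) (rule continuous_on_subset[OF cont], simp)
  ultimately show bdd: "bounded (\<Phi> -` square s)" using compact_imp_bounded bounded_subset by blast
  have "closed quadrant" unfolding quadrant_def by (intro closed_Times) auto
  then have "closed (\<Phi>' -` quadrant)" using cont by (simp add: closed_vimage)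
  then have Db: "D \<in> sets borel" unfolding D_def using sq by (intro sets.Int) auto
  have Dv: "\<Phi> -` D = \<Phi> -` square s \<inter> quadrant"
  proof -
    have "\<Phi> z \<in> D \<longleftrightarrow> \<Phi> z \<in> square s \<and> z \<in> quadrant" for z by (simp add: D_def inv)
    then show ?thesis by blast
  qed
  have aD: "admissible \<Phi> D"
    unfolding admissible_def Dv using mp Db bounded_subset[OF sq(2)] bounded_subset[OF bdd]
    by (auto simp: D_def)
  have DQ: "D \<subseteq> quadrant" using sq by (auto simp: D_def)
  have inj: "inj \<Phi>" using inv by (metis injI)
  have eq: "{\<omega>\<in>space M. has_chain R k (\<Xi> \<omega> \<inter> \<Phi> -` square s)} =
      {\<omega>\<in>space M. has_chain R k (\<Xi> \<omega> \<inter> \<Phi> -` D)}"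
  proof -
    have "\<Xi> \<omega> \<inter> \<Phi> -` square s = \<Xi> \<omega> \<inter> \<Phi> -` D" if "\<omega> \<in> space M" for \<omega>
      using points_in_region[OF that] unfolding Dv by blast
    then show ?thesis by auto
  qed
  note transfer = chain_prob_transfer[OF aD DQ inj ord, of k]
  show "{\<omega>\<in>space M. has_chain R k (\<Xi> \<omega> \<inter> \<Phi> -` square s)} \<in> events"
    unfolding eq by (rule transfer(1))
  have "prob {\<omega>\<in>space M. has_chain comp_le k (\<Xi> \<omega> \<inter> D)} \<le> chain_prob s k"
    unfolding chain_prob_def
  proof (intro finite_measure_mono chain_event closed_rel_comp_le square_admissible subsetI)
    fix \<omega> assume "\<omega> \<in> {\<omega>\<in>space M. has_chain comp_le k (\<Xi> \<omega> \<inter> D)}"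
    moreover have "\<Xi> \<omega> \<inter> D \<subseteq> \<Xi> \<omega> \<inter> square s" by (auto simp: D_def)
    ultimately show "\<omega> \<in> {\<omega>\<in>space M. has_chain comp_le k (\<Xi> \<omega> \<inter> square s)}"
      using has_chain_mono[OF _ _ order_refl, of comp_le k] by blast
  qed
  then show "prob {\<omega>\<in>space M. has_chain R k (\<Xi> \<omega> \<inter> \<Phi> -` square s)} \<le> chain_prob s k"
    unfolding eq using transfer(2) by simp
  assume Q: "\<Phi> -` square s \<subseteq> quadrant" and inv': "\<And>z. \<Phi> (\<Phi>' z) = z"
  have "D = square s" using Q inv' by (force simp: D_def)
  then show "prob {\<omega>\<in>space M. has_chain R k (\<Xi> \<omega> \<inter> \<Phi> -` square s)} = chain_prob s k"
    using transfer(2) unfolding eq chain_prob_def by simp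
qed

lemma cone_rect_chain:
  assumes ab: "\<alpha> < \<beta>" and uv: "fst v < fst w" "snd v < snd w"
  defines "s \<equiv> sqrt ((fst w - fst v) * (snd w - snd v))"
  shows "{\<omega>\<in>space M. has_chain (slope_le \<alpha> \<beta>) k (\<Xi> \<omega> \<inter> cone_rect \<alpha> \<beta> v w)} \<in> events"
    "prob {\<omega>\<in>space M. has_chain (slope_le \<alpha> \<beta>) k (\<Xi> \<omega> \<inter> cone_rect \<alpha> \<beta> v w)} \<le> chain_prob s k"
    "cone_rect \<alpha> \<beta> v w \<subseteq> quadrant \<Longrightarrow>
      prob {\<omega>\<in>space M. has_chain (slope_le \<alpha> \<beta>) k (\<Xi> \<omega> \<inter> cone_rect \<alpha> \<beta> v w)} = chain_prob s k"
    "bounded (cone_rect \<alpha> \<beta> v w)"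
proof -
  \<comment> \<open>The squeeze factor that makes both sides of the rectangle equal to
    \<open>s\<close> while preserving its area.\<close>
  define p where "p = sqrt ((snd w - snd v) / (fst w - fst v))"
  have p: "p > 0" using uv by (simp add: p_def)
  have *: "sqrt (b / a) * a = sqrt (a * b)" "b / sqrt (b / a) = sqrt (a * b)" if "a > 0" "b > 0" for a b :: real
    using that real_div_sqrt[of a] real_div_sqrt[of b]
    by (simp_all add: real_sqrt_mult real_sqrt_divide) (metis mult.commute times_divide_eq_right)+
  have s: "p * (fst w - fst v) = s" "(snd w - snd v) / p = s"
    using *[of "fst w - fst v" "snd w - snd v"] uv by (simp_all add: s_def p_def)
  define h where "h z = (p * fst z, snd z / p)" for z :: "real \<times> real"
  define \<Phi> where "\<Phi> z = h (cone_coord \<alpha> \<beta> z - v)" for z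
  define \<Phi>' where "\<Phi>' z = cone_point \<alpha> \<beta> ((fst z / p, p * snd z) + v)" for z
  have mp: "measure_preserving \<Phi>"
    using measure_preserving_comp[OF measure_preserving_comp[OF measure_preserving_cone_coord[OF ab]
      measure_preserving_translation[of v]] measure_preserving_squeeze[OF p, folded h_def]]
    unfolding \<Phi>_def[abs_def] .
  have cont: "continuous_on UNIV \<Phi>'"
    unfolding \<Phi>'_def cone_point_def using p ab by (intro continuous_intros) auto
  have "(fst a - fst v, snd a - snd v) + v = a" for a :: "real \<times> real"
    by (simp add: prod_eq_iff)
  then have inv: "\<Phi>' (\<Phi> z) = z" "\<Phi> (\<Phi>' z) = z" for z
    using p by (simp_all add: \<Phi>_def h_def \<Phi>'_def cone_point_coord[OF ab])
  have ord: "slope_le \<alpha> \<beta> x y \<longleftrightarrow> comp_le (\<Phi> x) (\<Phi> y)" for x y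
    using p by (simp add: slope_le_iff_comp_le[OF ab] comp_le_def \<Phi>_def h_def divide_le_cancel)
  have eq: "cone_rect \<alpha> \<beta> v w = \<Phi> -` square s"
  proof -
    have "0 \<le> p * (x - fst v) \<and> p * (x - fst v) < s \<longleftrightarrow> fst v \<le> x \<and> x < fst w" for x
      unfolding s(1)[symmetric] using p by (simp add: zero_le_mult_iff)
    moreover have "0 \<le> (y - snd v) / p \<and> (y - snd v) / p < s \<longleftrightarrow> snd v \<le> y \<and> y < snd w" for y
      unfolding s(2)[symmetric] using p by (simp add: divide_less_cancel zero_le_divide_iff)
    ultimately show ?thesis
      unfolding set_eq_iff vimage_eq cone_rect_def square_def \<Phi>_def h_def mem_Times_iff
        atLeastLessThan_iff fst_conv snd_conv fst_diff snd_diff by blast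
  qed
  note T = square_chain_transfer[OF mp cont inv(1) ord]
  show "{\<omega>\<in>space M. has_chain (slope_le \<alpha> \<beta>) k (\<Xi> \<omega> \<inter> cone_rect \<alpha> \<beta> v w)} \<in> events"
    "prob {\<omega>\<in>space M. has_chain (slope_le \<alpha> \<beta>) k (\<Xi> \<omega> \<inter> cone_rect \<alpha> \<beta> v w)} \<le> chain_prob s k"
    "cone_rect \<alpha> \<beta> v w \<subseteq> quadrant \<Longrightarrow>
      prob {\<omega>\<in>space M. has_chain (slope_le \<alpha> \<beta>) k (\<Xi> \<omega> \<inter> cone_rect \<alpha> \<beta> v w)} = chain_prob s k"
    "bounded (cone_rect \<alpha> \<beta> v w)"
    unfolding eq by (fact T(1), fact T(2), rule T(3)[OF _ inv(2)], assumption, fact T(4))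
qed

text \<open>Dilation by \<open>t\<close> multiplies the side of the equivalent square by
  \<open>t\<close>, so both tails reduce to those of squares. The upper tail covers rectangles that
  leave the quadrant; the lower tail is stated inside it.\<close>

lemma cone_rect_tails:
  fixes v w :: "real \<times> real"
  assumes ab: "\<alpha> < \<beta>" and uv: "fst v < fst w" "snd v < snd w" and \<epsilon>: "\<epsilon> > 0"
  defines "s \<equiv> sqrt ((fst w - fst v) * (snd w - snd v))"
  shows "((\<lambda>t. prob {\<omega>\<in>space M. (growth + \<epsilon>) * s * t \<le>
      real (longest (slope_le \<alpha> \<beta>) (\<Xi> \<omega> \<inter> cone_rect \<alpha> \<beta> (t *\<^sub>R v) (t *\<^sub>R w)))}) \<longlongrightarrow> 0) at_top"
    (is "((\<lambda>t. prob (?U t)) \<longlongrightarrow> 0) at_top")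
    "\<forall>t>0. {\<omega>\<in>space M. x \<le> real (longest (slope_le \<alpha> \<beta>) (\<Xi> \<omega> \<inter> cone_rect \<alpha> \<beta> (t *\<^sub>R v) (t *\<^sub>R w)))} \<in> events"
    "(\<And>t. t > 0 \<Longrightarrow> cone_rect \<alpha> \<beta> (t *\<^sub>R v) (t *\<^sub>R w) \<subseteq> quadrant) \<Longrightarrow>
     ((\<lambda>t. prob {\<omega>\<in>space M. real (longest (slope_le \<alpha> \<beta>) (\<Xi> \<omega> \<inter> cone_rect \<alpha> \<beta> (t *\<^sub>R v) (t *\<^sub>R w)))
       < (growth - \<epsilon>) * s * t}) \<longlongrightarrow> 0) at_top"
proof -
  have s: "s > 0" using uv by (simp add: s_def)
  have uvt: "fst (t *\<^sub>R v) < fst (t *\<^sub>R w)" "snd (t *\<^sub>R v) < snd (t *\<^sub>R w)" if "t > 0" for t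
    using uv that by auto
  have st: "sqrt ((fst (t *\<^sub>R w) - fst (t *\<^sub>R v)) * (snd (t *\<^sub>R w) - snd (t *\<^sub>R v))) = s * t" if "t > 0" for t
  proof -
    have "(fst (t *\<^sub>R w) - fst (t *\<^sub>R v)) * (snd (t *\<^sub>R w) - snd (t *\<^sub>R v)) =
        ((fst w - fst v) * (snd w - snd v)) * t\<^sup>2" by (simp add: algebra_simps power2_eq_square)
    then show ?thesis using that by (simp add: s_def real_sqrt_mult)
  qed
  have ev_eq: "{\<omega>\<in>space M. x \<le> real (longest (slope_le \<alpha> \<beta>) (\<Xi> \<omega> \<inter> cone_rect \<alpha> \<beta> (t *\<^sub>R v) (t *\<^sub>R w)))} =
      {\<omega>\<in>space M. has_chain (slope_le \<alpha> \<beta>) (nat \<lceil>x\<rceil>) (\<Xi> \<omega> \<inter> cone_rect \<alpha> \<beta> (t *\<^sub>R v) (t *\<^sub>R w))}"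
    if "t > 0" for t x
    using cone_rect_chain(4)[OF ab uvt[OF that]] finite_points by (auto simp: ceiling_le_longest_iff)
  show meas: "\<forall>t>0. {\<omega>\<in>space M. x \<le> real (longest (slope_le \<alpha> \<beta>) (\<Xi> \<omega> \<inter> cone_rect \<alpha> \<beta> (t *\<^sub>R v) (t *\<^sub>R w)))} \<in> events"
    for x
    using cone_rect_chain(1)[OF ab uvt] by (simp add: ev_eq)
  have lim: "filterlim (\<lambda>t. s * t) at_top at_top"
    using s by (intro filterlim_tendsto_pos_mult_at_top[OF tendsto_const] filterlim_ident) auto
  show "((\<lambda>t. prob (?U t)) \<longlongrightarrow> 0) at_top"
  proof (rule tendsto_sandwich[OF _ _ tendsto_const])
    show "((\<lambda>t. chain_prob (s * t) (nat \<lceil>(growth + \<epsilon>) * (s * t)\<rceil>)) \<longlongrightarrow> 0) at_top"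
      by (rule filterlim_compose[OF chain_prob_upper_tail[OF \<epsilon>] lim])
    show "\<forall>\<^sub>F t in at_top. prob (?U t) \<le> chain_prob (s * t) (nat \<lceil>(growth + \<epsilon>) * (s * t)\<rceil>)"
      using eventually_gt_at_top[of 0]
    proof eventually_elim
      case (elim t)
      show ?case using cone_rect_chain(2)[OF ab uvt[OF elim]] st[OF elim]
        by (simp add: ev_eq[OF elim] mult.assoc)
    qed
  qed simp
  assume Q: "\<And>t. t > 0 \<Longrightarrow> cone_rect \<alpha> \<beta> (t *\<^sub>R v) (t *\<^sub>R w) \<subseteq> quadrant"
  have "((\<lambda>t. 1 - chain_prob (s * t) (nat \<lceil>(growth - \<epsilon>) * (s * t)\<rceil>)) \<longlongrightarrow> 1 - 1) at_top"
    by (intro tendsto_diff tendsto_const filterlim_compose[OF chain_prob_lower_tail[OF \<epsilon>] lim])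
  moreover have "\<forall>\<^sub>F t in at_top. 1 - chain_prob (s * t) (nat \<lceil>(growth - \<epsilon>) * (s * t)\<rceil>) =
      prob {\<omega>\<in>space M. real (longest (slope_le \<alpha> \<beta>) (\<Xi> \<omega> \<inter> cone_rect \<alpha> \<beta> (t *\<^sub>R v) (t *\<^sub>R w)))
       < (growth - \<epsilon>) * s * t}" (is "\<forall>\<^sub>F t in at_top. _ = prob (?L t)")
    using eventually_gt_at_top[of 0]
  proof eventually_elim
    case (elim t)
    let ?x = "(growth - \<epsilon>) * s * t"
    let ?G = "{\<omega>\<in>space M. ?x \<le> real (longest (slope_le \<alpha> \<beta>) (\<Xi> \<omega> \<inter> cone_rect \<alpha> \<beta> (t *\<^sub>R v) (t *\<^sub>R w)))}"
    have "?L t = space M - ?G" by auto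
    moreover have "?G \<in> events" using meas[of ?x] elim by blast
    ultimately have "prob (?L t) = 1 - prob ?G" using prob_compl[of ?G] by presburger
    also have "prob ?G = chain_prob (s * t) (nat \<lceil>(growth - \<epsilon>) * (s * t)\<rceil>)"
      unfolding ev_eq[OF elim] using cone_rect_chain(3)[OF ab uvt[OF elim] Q[OF elim]] st[OF elim]
      by (simp add: mult.assoc)
    finally show ?case by simp
  qed
  ultimately show "((\<lambda>t. prob {\<omega>\<in>space M. real (longest (slope_le \<alpha> \<beta>) (\<Xi> \<omega> \<inter> cone_rect \<alpha> \<beta> (t *\<^sub>R v) (t *\<^sub>R w)))
       < (growth - \<epsilon>) * s * t}) \<longlongrightarrow> 0) at_top"
    by (simp add: Lim_transform_eventually)
qed

end

section \<open>Concavity and the deterministic optimum\<close>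

lemma slope_le_refl: "slope_le \<alpha> \<beta> p p"
  by (simp add: slope_le_def)

lemma slope_le_trans:
  "slope_le \<alpha> \<beta> p q \<Longrightarrow> slope_le \<alpha> \<beta> q r \<Longrightarrow> slope_le \<alpha> \<beta> p r"
  by (simp add: slope_le_def algebra_simps)

lemma closed_rel_slope_le: "closed_rel (slope_le \<alpha> \<beta>)"
  unfolding closed_rel_def
proof (intro allI impI, elim conjE)
  fix u v :: "nat \<Rightarrow> real \<times> real" and p q
  assume *: "\<forall>j. slope_le \<alpha> \<beta> (u j) (v j)" and lim: "u \<longlonglongrightarrow> p" "v \<longlonglongrightarrow> q"
  note l = tendsto_fst[OF lim(1)] tendsto_snd[OF lim(1)] tendsto_fst[OF lim(2)] tendsto_snd[OF lim(2)]
  have "fst p \<le> fst q"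
    by (rule LIMSEQ_le[OF l(1) l(3)]) (use * in \<open>auto simp: slope_le_def\<close>)
  moreover have "\<alpha> * (fst q - fst p) \<le> snd q - snd p"
    by (rule LIMSEQ_le[OF tendsto_mult_left[OF tendsto_diff[OF l(3) l(1)]] tendsto_diff[OF l(4) l(2)]])
      (use * in \<open>auto simp: slope_le_def\<close>)
  moreover have "snd q - snd p \<le> \<beta> * (fst q - fst p)"
    by (rule LIMSEQ_le[OF tendsto_diff[OF l(4) l(2)] tendsto_mult_left[OF tendsto_diff[OF l(3) l(1)]]])
      (use * in \<open>auto simp: slope_le_def\<close>)
  ultimately show "slope_le \<alpha> \<beta> p q" by (simp add: slope_le_def)
qed

text \<open>Transitivity turns the condition on neighbours into one on all pairs, so that chains can
  be handled as general path events.\<close>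

lemma max_chain_length_eq_longest:
  "max_chain_length \<alpha> \<beta> X x y = longest (slope_le \<alpha> \<beta>) (X \<inter> ({0..x} \<times> {0..y}))"
  "slope_chain \<alpha> \<beta> X x y ps \<longleftrightarrow> set ps \<subseteq> X \<inter> ({0..x} \<times> {0..y}) \<and> distinct ps \<and> sorted_wrt (slope_le \<alpha> \<beta>) ps"
proof -
  have "transp (slope_le \<alpha> \<beta>)" by (rule transpI) (rule slope_le_trans)
  then show *: "slope_chain \<alpha> \<beta> X x y ps \<longleftrightarrow> set ps \<subseteq> X \<inter> ({0..x} \<times> {0..y}) \<and> distinct ps \<and> sorted_wrt (slope_le \<alpha> \<beta>) ps"
    for ps by (simp add: slope_chain_def successively_conv_sorted_wrt)
  have "{length ps | ps. slope_chain \<alpha> \<beta> X x y ps} = {k. has_chain (slope_le \<alpha> \<beta>) k (X \<inter> ({0..x} \<times> {0..y}))}"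
    unfolding * has_chain_def path_in_def by auto
  then show "max_chain_length \<alpha> \<beta> X x y = longest (slope_le \<alpha> \<beta>) (X \<inter> ({0..x} \<times> {0..y}))"
    by (simp add: max_chain_length_def longest_def)
qed

text \<open>The piece of the list from position \<open>i\<close> to position \<open>j\<close>
  includes both ends, hence the extra 1; reflexivity covers the comparison of each end with
  itself.\<close>

lemma has_chain_segment:
  assumes ps: "distinct ps" "sorted_wrt R ps" and refl: "\<And>x. R x x" and ij: "i \<le> j" "j < length ps"
  shows "has_chain R (j - i + 1) {q \<in> set ps. R (ps ! i) q \<and> R q (ps ! j)}"
  unfolding has_chain_def path_in_def
proof (intro exI conjI)
  let ?qs = "drop i (take (Suc j) ps)"
  show "distinct ?qs" "sorted_wrt R ?qs" using ps by (auto intro: sorted_wrt_drop sorted_wrt_take)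
  show len: "length ?qs = j - i + 1" using ij by simp
  show "set ?qs \<subseteq> {q \<in> set ps. R (ps ! i) q \<and> R q (ps ! j)}"
  proof
    fix q assume "q \<in> set ?qs"
    then obtain l where l: "l < j - i + 1" "q = ps ! (i + l)"
      using ij unfolding in_set_conv_nth len by auto
    have "R (ps ! i) (ps ! (i + l))"
      using sorted_wrt_nth_less[OF ps(2), of i "i + l"] refl l ij by (cases "l = 0") auto
    moreover have "R (ps ! (i + l)) (ps ! j)"
      using sorted_wrt_nth_less[OF ps(2), of "i + l" j] refl l ij by (cases "i + l = j") auto
    ultimately show "q \<in> {q \<in> set ps. R (ps ! i) q \<and> R q (ps ! j)}" using l ij by auto
  qed
qed

text \<open>The side of the square equivalent to the cone rectangle spanned by \<open>p\<close> and
  \<open>q\<close>. Up to the factor \<open>growth\<close>, it is the length per unit of scale of a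
  longest chain between their dilates.\<close>

definition gain :: "real \<Rightarrow> real \<Rightarrow> real \<times> real \<Rightarrow> real \<times> real \<Rightarrow> real" where
  "gain \<alpha> \<beta> p q = sqrt ((fst (cone_coord \<alpha> \<beta> q) - fst (cone_coord \<alpha> \<beta> p)) *
     (snd (cone_coord \<alpha> \<beta> q) - snd (cone_coord \<alpha> \<beta> p)))"

text \<open>
  Up to a positive factor, \<open>tangent\<close> is the differential of the concave homogeneous gain at a displacement
  of slope \<open>\<theta>\<close>; in the coordinates \<open>u = \<beta> dx - dy\<close>, \<open>v = dy - \<alpha> dx\<close> it is \<open>(\<theta> - \<alpha>) u + (\<beta> - \<theta>) v\<close>.
\<close>

definition tangent :: "real \<Rightarrow> real \<Rightarrow> real \<Rightarrow> real \<times> real \<Rightarrow> real" where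
  "tangent \<alpha> \<beta> \<theta> z = (\<theta> * (\<alpha> + \<beta>) - 2 * \<alpha> * \<beta>) * fst z + (\<alpha> + \<beta> - 2 * \<theta>) * snd z"

lemma tangent_diff: "tangent \<alpha> \<beta> \<theta> (q - p) = tangent \<alpha> \<beta> \<theta> q - tangent \<alpha> \<beta> \<theta> p"
  by (simp add: tangent_def algebra_simps)

text \<open>This is \<open>2 * sqrt (x * y) \<le> x + y\<close> for \<open>x = u * Q\<close> and
  \<open>y = v * P\<close>; the factor \<open>s\<close> is what brings the weights \<open>P\<close>
  and \<open>Q\<close> under the root. Equality forces \<open>u * Q = v * P\<close>, and
  \<open>v * P - u * Q\<close> is \<open>\<beta> - \<alpha>\<close> times
  \<open>dy - \<theta> * dx\<close>.\<close>

lemma gain_le_tangent: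
  assumes ab: "\<alpha> < \<theta>" "\<theta> < \<beta>" and le: "slope_le \<alpha> \<beta> p q"
  defines "s \<equiv> sqrt ((\<beta> - \<alpha>) * (\<beta> - \<theta>) * (\<theta> - \<alpha>))"
  shows "2 * s * gain \<alpha> \<beta> p q \<le> tangent \<alpha> \<beta> \<theta> (q - p)"
    "2 * s * gain \<alpha> \<beta> p q = tangent \<alpha> \<beta> \<theta> (q - p) \<Longrightarrow> snd q - snd p = \<theta> * (fst q - fst p)"
proof -
  define dx dy where "dx = fst q - fst p" and "dy = snd q - snd p"
  define u v P Q where "u = \<beta> * dx - dy" and "v = dy - \<alpha> * dx" and "P = \<beta> - \<theta>" and "Q = \<theta> - \<alpha>"
  have pos: "u \<ge> 0" "v \<ge> 0" "P > 0" "Q > 0" "\<beta> - \<alpha> > 0"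
    using le ab by (auto simp: u_def v_def P_def Q_def dx_def dy_def slope_le_def)
  have "fst (cone_coord \<alpha> \<beta> q) - fst (cone_coord \<alpha> \<beta> p) = u / sqrt (\<beta> - \<alpha>)"
    "snd (cone_coord \<alpha> \<beta> q) - snd (cone_coord \<alpha> \<beta> p) = v / sqrt (\<beta> - \<alpha>)"
    by (simp_all add: cone_coord_def u_def v_def dx_def dy_def diff_divide_distrib[symmetric] algebra_simps)
  then have "gain \<alpha> \<beta> p q = sqrt (u * v / (\<beta> - \<alpha>))"
    using pos by (simp add: gain_def)
  then have g: "s * gain \<alpha> \<beta> p q = sqrt ((u * Q) * (v * P))"
    unfolding s_def using pos by (simp add: P_def[symmetric] Q_def[symmetric] ac_simps flip: real_sqrt_mult)
  have t: "tangent \<alpha> \<beta> \<theta> (q - p) = u * Q + v * P"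
    by (simp add: tangent_def u_def v_def P_def Q_def dx_def dy_def algebra_simps)
  have sq: "u * Q + v * P - 2 * sqrt ((u * Q) * (v * P)) = (sqrt (u * Q) - sqrt (v * P))\<^sup>2"
    using pos by (simp add: power2_diff real_sqrt_mult power_mult_distrib)
  then show "2 * s * gain \<alpha> \<beta> p q \<le> tangent \<alpha> \<beta> \<theta> (q - p)"
    using zero_le_power2[of "sqrt (u * Q) - sqrt (v * P)"] g t by linarith
  assume "2 * s * gain \<alpha> \<beta> p q = tangent \<alpha> \<beta> \<theta> (q - p)"
  then have "(sqrt (u * Q) - sqrt (v * P))\<^sup>2 = 0" using sq g t by linarith
  then have "u * Q = v * P" by simp
  then have "(\<beta> - \<alpha>) * (dy - \<theta> * dx) = 0"
    by (simp add: u_def v_def P_def Q_def algebra_simps)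
  then show "snd q - snd p = \<theta> * (fst q - fst p)" using pos by (simp add: dx_def dy_def)
qed

lemma continuous_on_gain:
  assumes "continuous_on S f" "continuous_on S g"
  shows "continuous_on S (\<lambda>x. gain \<alpha> \<beta> (f x) (g x))"
proof (cases "\<alpha> = \<beta>")
  \<comment> \<open>In this degenerate case division by \<open>sqrt 0\<close> yields 0, so the
    function is constant.\<close>
  case True
  then show ?thesis by (simp add: gain_def cone_coord_def)
next
  case False
  then show ?thesis unfolding gain_def cone_coord_def
    using assms by (intro continuous_intros) auto
qed

lemma closed_slope_le:
  "closed {x. slope_le \<alpha> \<beta> (f x) (g x)}" if "continuous_on UNIV f" "continuous_on UNIV g" for f g :: "'a::topological_space \<Rightarrow> real \<times> real"
  unfolding slope_le_def using that
  by (intro closed_Collect_conj closed_Collect_le continuous_intros)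

text \<open>A common setting for the three regimes: \<open>(A, \<theta> * A)\<close> is the optimal
  displacement, which fits into the box and maximises the linear functional there. It will have
  \<open>A = a\<close> when it uses the full width and \<open>A = b / \<theta>\<close> when it uses
  the full height.\<close>

locale cone_box =
  fixes a b \<alpha> \<beta> \<theta> A :: real
  assumes ab: "0 < a" "0 < b" and cone: "0 < \<alpha>" "\<alpha> < \<theta>" "\<theta> < \<beta>"
    and A: "0 < A" "A \<le> a" "\<theta> * A \<le> b"
    and tangent_max: "\<And>z. fst z \<le> a \<Longrightarrow> snd z \<le> b \<Longrightarrow>
      tangent \<alpha> \<beta> \<theta> z \<le> tangent \<alpha> \<beta> \<theta> (A, \<theta> * A)"
begin

definition optimum :: real where
  "optimum = gain \<alpha> \<beta> (0, 0) (A, \<theta> * A)"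

abbreviation box0 :: "(real \<times> real) set" where
  "box0 \<equiv> {0..a} \<times> {0..b}"

lemma tangent_on_line: "tangent \<alpha> \<beta> \<theta> (x, \<theta> * x) = 2 * (\<beta> - \<theta>) * (\<theta> - \<alpha>) * x"
  by (simp add: tangent_def algebra_simps)

lemma optimum_eq: "2 * sqrt ((\<beta> - \<alpha>) * (\<beta> - \<theta>) * (\<theta> - \<alpha>)) * optimum = tangent \<alpha> \<beta> \<theta> (A, \<theta> * A)"
proof -
  have "optimum = sqrt (((\<beta> - \<theta>) * A) * ((\<theta> - \<alpha>) * A) / (\<beta> - \<alpha>))"
    using cone by (simp add: optimum_def gain_def cone_coord_def algebra_simps)
  then have "sqrt ((\<beta> - \<alpha>) * (\<beta> - \<theta>) * (\<theta> - \<alpha>)) * optimum = sqrt (((\<beta> - \<theta>) * (\<theta> - \<alpha>) * A)\<^sup>2)"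
    using cone by (simp add: power2_eq_square ac_simps flip: real_sqrt_mult)
  also have "\<dots> = (\<beta> - \<theta>) * (\<theta> - \<alpha>) * A" using cone A by simp
  finally show ?thesis unfolding tangent_on_line by (simp only: mult.assoc)
qed

lemma optimum_pos: "optimum > 0"
proof -
  have "tangent \<alpha> \<beta> \<theta> (A, \<theta> * A) > 0" unfolding tangent_on_line using cone A by simp
  then have "0 < 2 * sqrt ((\<beta> - \<alpha>) * (\<beta> - \<theta>) * (\<theta> - \<alpha>)) * optimum" unfolding optimum_eq .
  moreover have "2 * sqrt ((\<beta> - \<alpha>) * (\<beta> - \<theta>) * (\<theta> - \<alpha>)) > 0" using cone by simp
  ultimately show ?thesis by (metis zero_less_mult_pos)
qed

text \<open>The linear functional telescopes along the four points and is bounded by its value at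
  the optimal displacement. A sum of gains reaching \<open>optimum\<close> therefore forces equality
  in all three AM-GM bounds, hence slope \<theta> throughout, and equality for the total
  displacement, hence width \<open>A\<close>.\<close>

lemma gain_sum_maximal:
  assumes p: "p0 \<in> box0" "p3 \<in> box0"
    and le: "slope_le \<alpha> \<beta> p0 p1" "slope_le \<alpha> \<beta> p1 p2" "slope_le \<alpha> \<beta> p2 p3"
    and ge: "gain \<alpha> \<beta> p0 p1 + gain \<alpha> \<beta> p1 p2 + gain \<alpha> \<beta> p2 p3 \<ge> optimum"
  shows "fst p3 = fst p0 + A" "snd p1 - snd p0 = \<theta> * (fst p1 - fst p0)"
    "snd p2 - snd p1 = \<theta> * (fst p2 - fst p1)" "snd p3 - snd p2 = \<theta> * (fst p3 - fst p2)"
proof -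
  define s where "s = 2 * sqrt ((\<beta> - \<alpha>) * (\<beta> - \<theta>) * (\<theta> - \<alpha>))"
  have s: "s > 0" using cone by (simp add: s_def)
  note g = gain_le_tangent[OF cone(2,3), folded s_def]
  have "tangent \<alpha> \<beta> \<theta> (p3 - p0) \<le> tangent \<alpha> \<beta> \<theta> (A, \<theta> * A)"
    using p by (intro tangent_max) auto
  moreover have "tangent \<alpha> \<beta> \<theta> (p3 - p0) =
      tangent \<alpha> \<beta> \<theta> (p1 - p0) + tangent \<alpha> \<beta> \<theta> (p2 - p1) + tangent \<alpha> \<beta> \<theta> (p3 - p2)"
    by (simp add: tangent_diff)
  moreover have "tangent \<alpha> \<beta> \<theta> (A, \<theta> * A) \<le> s * gain \<alpha> \<beta> p0 p1 + s * gain \<alpha> \<beta> p1 p2 + s * gain \<alpha> \<beta> p2 p3"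
    using mult_left_mono[OF ge, of s] s optimum_eq by (simp add: s_def algebra_simps)
  ultimately have eq: "s * gain \<alpha> \<beta> p0 p1 = tangent \<alpha> \<beta> \<theta> (p1 - p0)"
      "s * gain \<alpha> \<beta> p1 p2 = tangent \<alpha> \<beta> \<theta> (p2 - p1)" "s * gain \<alpha> \<beta> p2 p3 = tangent \<alpha> \<beta> \<theta> (p3 - p2)"
      "tangent \<alpha> \<beta> \<theta> (p3 - p0) = tangent \<alpha> \<beta> \<theta> (A, \<theta> * A)"
    using g(1)[OF le(1)] g(1)[OF le(2)] g(1)[OF le(3)] by linarith+
  show 1: "snd p1 - snd p0 = \<theta> * (fst p1 - fst p0)" by (rule g(2)[OF le(1) eq(1)])
  show 2: "snd p2 - snd p1 = \<theta> * (fst p2 - fst p1)" by (rule g(2)[OF le(2) eq(2)])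
  show 3: "snd p3 - snd p2 = \<theta> * (fst p3 - fst p2)" by (rule g(2)[OF le(3) eq(3)])
  have "snd p3 - snd p0 = \<theta> * (fst p3 - fst p0)" using 1 2 3 by (simp add: algebra_simps)
  then have "p3 - p0 = (fst p3 - fst p0, \<theta> * (fst p3 - fst p0))" by (simp add: prod_eq_iff)
  then have "2 * (\<beta> - \<theta>) * (\<theta> - \<alpha>) * (fst p3 - fst p0) = 2 * (\<beta> - \<theta>) * (\<theta> - \<alpha>) * A"
    using eq(4) tangent_on_line by metis
  then show "fst p3 = fst p0 + A" using cone by simp
qed

lemma gain_deficit:
  fixes g :: "real \<times> real \<Rightarrow> real \<times> real \<Rightarrow> real"
  assumes g: "continuous_on UNIV (\<lambda>z. g (fst z) (snd z))" and \<delta>: "\<delta> > 0"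
    and opt: "\<And>p0 p1 p2 p3. \<lbrakk>p0 \<in> box0; p1 \<in> box0; p2 \<in> box0; p3 \<in> box0;
      slope_le \<alpha> \<beta> p0 p1; slope_le \<alpha> \<beta> p1 p2; slope_le \<alpha> \<beta> p2 p3;
      fst p3 = fst p0 + A; snd p1 - snd p0 = \<theta> * (fst p1 - fst p0);
      snd p2 - snd p1 = \<theta> * (fst p2 - fst p1); snd p3 - snd p2 = \<theta> * (fst p3 - fst p2)\<rbrakk> \<Longrightarrow>
      g p1 p2 \<le> 0 \<and> g p2 p1 \<le> 0"
  obtains \<mu> where "\<mu> > 0"
    "\<And>p0 p1 p2 p3. \<lbrakk>p0 \<in> box0; p1 \<in> box0; p2 \<in> box0; p3 \<in> box0;
      slope_le \<alpha> \<beta> p0 p1; slope_le \<alpha> \<beta> p1 p2; slope_le \<alpha> \<beta> p2 p3; g p1 p2 \<ge> \<delta> \<or> g p2 p1 \<ge> \<delta>\<rbrakk> \<Longrightarrow>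
      gain \<alpha> \<beta> p0 p1 + gain \<alpha> \<beta> p1 p2 + gain \<alpha> \<beta> p2 p3 \<le> optimum - \<mu>"
proof -
  define f where "f x = (case x of (p0, p1, p2, p3) \<Rightarrow> gain \<alpha> \<beta> p0 p1 + gain \<alpha> \<beta> p1 p2 + gain \<alpha> \<beta> p2 p3)"
    for x :: "(real \<times> real) \<times> (real \<times> real) \<times> (real \<times> real) \<times> (real \<times> real)"
  define Z where "Z = (box0 \<times> box0 \<times> box0 \<times> box0) \<inter>
    {x. slope_le \<alpha> \<beta> (fst x) (fst (snd x))} \<inter> {x. slope_le \<alpha> \<beta> (fst (snd x)) (fst (snd (snd x)))} \<inter>
    {x. slope_le \<alpha> \<beta> (fst (snd (snd x))) (snd (snd (snd x)))} \<inter>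
    ({x. \<delta> \<le> g (fst (snd x)) (fst (snd (snd x)))} \<union> {x. \<delta> \<le> g (fst (snd (snd x))) (fst (snd x))})"
  have gc: "continuous_on UNIV (\<lambda>x. g (u x) (v x))" if "continuous_on UNIV u" "continuous_on UNIV v"
    for u v :: "(real \<times> real) \<times> (real \<times> real) \<times> (real \<times> real) \<times> (real \<times> real) \<Rightarrow> real \<times> real"
    using continuous_on_compose2[OF g continuous_on_Pair[OF that]] by simp
  have "compact Z" unfolding Z_def
    by (intro compact_Int_closed compact_Times compact_Icc closed_Un closed_slope_le closed_Collect_le
        gc continuous_intros)
  moreover have "continuous_on Z f" unfolding f_def split_beta
    by (intro continuous_on_add continuous_on_gain continuous_intros)
  ultimately have "Z = {} \<or> (\<exists>x\<in>Z. \<forall>y\<in>Z. f y \<le> f x)"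
    using continuous_attains_sup by blast
  moreover have lt: "f x < optimum" if x: "x \<in> Z" for x
  proof (rule ccontr)
    assume "\<not> f x < optimum"
    moreover obtain p0 p1 p2 p3 where xe: "x = (p0, p1, p2, p3)" by (cases x) auto
    ultimately have ge: "gain \<alpha> \<beta> p0 p1 + gain \<alpha> \<beta> p1 p2 + gain \<alpha> \<beta> p2 p3 \<ge> optimum"
      by (simp add: f_def)
    have p: "p0 \<in> box0" "p1 \<in> box0" "p2 \<in> box0" "p3 \<in> box0" "slope_le \<alpha> \<beta> p0 p1" "slope_le \<alpha> \<beta> p1 p2"
      "slope_le \<alpha> \<beta> p2 p3" "\<delta> \<le> g p1 p2 \<or> \<delta> \<le> g p2 p1"
      using x unfolding Z_def xe by simp_all
    show False
      using opt[OF p(1-7) gain_sum_maximal[OF p(1,4-7) ge]] p(8) \<delta> by linarith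
  qed
  \<comment> \<open>The deficit is the gap between \<open>optimum\<close> and the maximum; if no
    configuration deviates, 1 serves as well.\<close>
  ultimately obtain \<mu> where \<mu>: "\<mu> > 0" "\<And>x. x \<in> Z \<Longrightarrow> f x \<le> optimum - \<mu>"
  proof (elim disjE bexE)
    fix x assume "x \<in> Z" "\<forall>y\<in>Z. f y \<le> f x"
    then show ?thesis using lt by (intro that[of "optimum - f x"]) auto
  qed (auto intro: that[of 1])
  show ?thesis
  proof (rule that[OF \<mu>(1)])
    fix p0 p1 p2 p3 assume "p0 \<in> box0" "p1 \<in> box0" "p2 \<in> box0" "p3 \<in> box0"
      "slope_le \<alpha> \<beta> p0 p1" "slope_le \<alpha> \<beta> p1 p2" "slope_le \<alpha> \<beta> p2 p3" "g p1 p2 \<ge> \<delta> \<or> g p2 p1 \<ge> \<delta>"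
    then have "(p0, p1, p2, p3) \<in> Z" by (simp add: Z_def)
    from \<mu>(2)[OF this] show "gain \<alpha> \<beta> p0 p1 + gain \<alpha> \<beta> p1 p2 + gain \<alpha> \<beta> p2 p3 \<le> optimum - \<mu>"
      by (simp add: f_def)
  qed
qed

end

section \<open>Deviation of optimal paths\<close>

lemma bounded_cone_coord: "bounded S \<Longrightarrow> bounded (cone_coord \<alpha> \<beta> ` S)"
proof -
  assume "bounded S"
  then obtain r where "\<forall>z\<in>S. norm z \<le> r" by (auto simp: bounded_iff)
  then have "S \<subseteq> cball 0 r" by auto
  moreover have "compact (cone_coord \<alpha> \<beta> ` cball 0 r)"
  proof (cases "\<alpha> = \<beta>")
    case True
    then show ?thesis by (simp add: cone_coord_def[abs_def] image_constant_conv)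
  next
    case False
    then show ?thesis unfolding cone_coord_def
      by (intro compact_continuous_image continuous_intros compact_cball) auto
  qed
  ultimately show ?thesis by (meson bounded_subset compact_imp_bounded image_mono)
qed

lemma cone_coord_scaleR: "cone_coord \<alpha> \<beta> (t *\<^sub>R z) = t *\<^sub>R cone_coord \<alpha> \<beta> z"
  by (simp add: cone_coord_def algebra_simps)

context quadrant_poisson
begin

lemma closed_rectangle_admissible: "admissible (\<lambda>x. x) ({0..x} \<times> {0..y})"
proof -
  have "closed ({0..x} \<times> {0..y})" by (intro closed_Times) auto
  moreover have "bounded ({0..x} \<times> {0..y})" by (intro bounded_Times) auto
  moreover have "{0..x} \<times> {0..y} \<subseteq> quadrant" by (auto simp: quadrant_def)
  ultimately show ?thesis by (simp add: admissible_def)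
qed

text \<open>Optimality is the presence of a chain of length \<open>k\<close> without one of length
  \<open>Suc k\<close>, and the strict inequality is a countable union of closed ones with margin
  \<open>1 / Suc m\<close>. At fixed positions \<open>i\<close> and \<open>j\<close> each of these
  is a path event for a condition closed under limits.\<close>

lemma optimal_path_event:
  fixes g :: "real \<times> real \<Rightarrow> real \<times> real \<Rightarrow> real"
  assumes g: "continuous_on UNIV (\<lambda>z. g (fst z) (snd z))"
  shows "{\<omega>\<in>space M. \<exists>ps. optimal_path \<alpha> \<beta> (\<Xi> \<omega>) x y ps \<and> (\<exists>p\<in>set ps. \<exists>q\<in>set ps. g p q > r)} \<in> events"
    (is "?E \<in> events")
proof -
  let ?B = "{0..x} \<times> {0..y}"
  define C where "C k i j m ps \<longleftrightarrow> chain (slope_le \<alpha> \<beta>) k ps \<and> i < k \<and> j < k \<and> r + 1 / real (Suc m) \<le> g (ps ! i) (ps ! j)"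
    for k i j m :: nat and ps
  have "limit_closed (C k i j m)" for k i j m
    unfolding limit_closed_def
  proof (intro allI impI, elim conjE)
    fix q p assume *: "\<forall>l. C k i j m (q l) \<and> length (q l) = length p"
      and lim: "\<forall>i<length p. (\<lambda>l. q l ! i) \<longlonglongrightarrow> p ! i"
    have ch: "chain (slope_le \<alpha> \<beta>) k p"
      using limit_closed_chain[OF closed_rel_slope_le[of \<alpha> \<beta>], of k] * lim
      unfolding limit_closed_def C_def by blast
    have ij: "i < k" "j < k" using * by (auto simp: C_def)
    have "(\<lambda>l. (q l ! i, q l ! j)) \<longlonglongrightarrow> (p ! i, p ! j)"
      using lim ch ij by (intro tendsto_Pair) auto
    then have "(\<lambda>l. g (q l ! i) (q l ! j)) \<longlonglongrightarrow> g (p ! i) (p ! j)"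
      using continuous_on_tendsto_compose[OF g, of "\<lambda>l. (q l ! i, q l ! j)" "(p ! i, p ! j)" sequentially] by simp
    then have "r + 1 / real (Suc m) \<le> g (p ! i) (p ! j)"
      by (rule LIMSEQ_le_const) (use * in \<open>auto simp: C_def\<close>)
    then show "C k i j m p" using ch ij by (simp add: C_def)
  qed
  then have P: "{\<omega>\<in>space M. path_in (C k i j m) (\<Xi> \<omega> \<inter> ?B)} \<in> events" for k i j m
    using path_event(1)[OF closed_rectangle_admissible] by simp
  let ?H = "\<lambda>k. {\<omega>\<in>space M. has_chain (slope_le \<alpha> \<beta>) k (\<Xi> \<omega> \<inter> ?B)}"
  have H: "?H k \<in> events" for k
    by (rule chain_event[OF closed_rel_slope_le closed_rectangle_admissible])
  have "?E = (\<Union>k. (?H k - ?H (Suc k)) \<inter> (\<Union>i. \<Union>j. \<Union>m. {\<omega>\<in>space M. path_in (C k i j m) (\<Xi> \<omega> \<inter> ?B)}))"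
  proof (intro set_eqI iffI)
    fix \<omega> assume "\<omega> \<in> ?E"
    then obtain ps p q where \<omega>: "\<omega> \<in> space M" and ps: "optimal_path \<alpha> \<beta> (\<Xi> \<omega>) x y ps"
      and pq: "p \<in> set ps" "q \<in> set ps" "g p q > r" by auto
    have fin: "finite (\<Xi> \<omega> \<inter> ?B)"
      using finite_points[OF \<omega>] closed_rectangle_admissible by (simp add: admissible_def)
    obtain i j where ij: "i < length ps" "j < length ps" "ps ! i = p" "ps ! j = q"
      using pq by (metis in_set_conv_nth)
    obtain m where "1 / real (Suc m) < g p q - r"
      using pq(3) reals_Archimedean[of "g p q - r"] by (auto simp: inverse_eq_divide)
    then have "path_in (C (length ps) i j m) (\<Xi> \<omega> \<inter> ?B)"
      using ps ij unfolding path_in_def optimal_path_def max_chain_length_eq_longest(2) C_def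
      by (intro exI[of _ ps]) auto
    moreover have "\<omega> \<in> ?H (length ps) - ?H (Suc (length ps))"
      using ps \<omega> by (simp add: optimal_path_def max_chain_length_eq_longest(1) has_chain_iff[OF fin])
    ultimately show "\<omega> \<in> (\<Union>k. (?H k - ?H (Suc k)) \<inter> (\<Union>i. \<Union>j. \<Union>m. {\<omega>\<in>space M. path_in (C k i j m) (\<Xi> \<omega> \<inter> ?B)}))"
      using \<omega> by blast
  next
    fix \<omega> assume "\<omega> \<in> (\<Union>k. (?H k - ?H (Suc k)) \<inter> (\<Union>i. \<Union>j. \<Union>m. {\<omega>\<in>space M. path_in (C k i j m) (\<Xi> \<omega> \<inter> ?B)}))"
    then obtain k i j m where \<omega>: "\<omega> \<in> ?H k" "\<omega> \<notin> ?H (Suc k)" "path_in (C k i j m) (\<Xi> \<omega> \<inter> ?B)" by blast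
    then have sp: "\<omega> \<in> space M" by simp
    have fin: "finite (\<Xi> \<omega> \<inter> ?B)"
      using finite_points[OF sp] closed_rectangle_admissible by (simp add: admissible_def)
    have k: "longest (slope_le \<alpha> \<beta>) (\<Xi> \<omega> \<inter> ?B) = k"
      using \<omega>(1,2) by (simp add: has_chain_iff[OF fin])
    obtain ps where ps: "distinct ps" "set ps \<subseteq> \<Xi> \<omega> \<inter> ?B" "C k i j m ps"
      using \<omega>(3) by (auto simp: path_in_def)
    have "optimal_path \<alpha> \<beta> (\<Xi> \<omega>) x y ps"
      using ps k by (simp add: optimal_path_def max_chain_length_eq_longest C_def)
    moreover have "ps ! i \<in> set ps" "ps ! j \<in> set ps" using ps(3) by (auto simp: C_def)
    moreover have "0 < 1 / real (Suc m)" by simp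
    then have "g (ps ! i) (ps ! j) > r" using ps(3) unfolding C_def by linarith
    ultimately show "\<omega> \<in> ?E" using sp by blast
  qed
  also have "\<dots> \<in> events" using H P by (intro sets.countable_UN' sets.Int sets.Diff) auto
  finally show ?thesis .
qed

end

section \<open>Rectangles on a grid and the union bound\<close>

definition grid_low :: "nat \<Rightarrow> int \<times> int \<Rightarrow> real \<times> real" where
  "grid_low N i = (of_int (fst i) / real N, of_int (snd i) / real N)"

definition grid_up :: "nat \<Rightarrow> int \<times> int \<Rightarrow> real \<times> real" where
  "grid_up N i = ((of_int (fst i) + 1) / real N, (of_int (snd i) + 1) / real N)"

text \<open>The discretised \<open>gain\<close>: the rectangle runs from the lower corner of one
  cell to the upper corner of the other.\<close>

definition grid_side :: "nat \<Rightarrow> int \<times> int \<Rightarrow> int \<times> int \<Rightarrow> real" where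
  "grid_side N i j = sqrt ((fst (grid_up N j) - fst (grid_low N i)) * (snd (grid_up N j) - snd (grid_low N i)))"

lemma grid_bounds:
  assumes "N > 0"
  shows "fst (grid_low N (cell N z)) \<le> fst z" "fst z < fst (grid_up N (cell N z))"
    "snd (grid_low N (cell N z)) \<le> snd z" "snd z < snd (grid_up N (cell N z))"
    "fst (grid_up N (cell N z)) \<le> fst z + 1 / N" "fst z - 1 / N \<le> fst (grid_low N (cell N z))"
    "snd (grid_up N (cell N z)) \<le> snd z + 1 / N" "snd z - 1 / N \<le> snd (grid_low N (cell N z))"
proof -
  have *: "\<lfloor>N * x\<rfloor> / N \<le> x" "x < (\<lfloor>N * x\<rfloor> + 1) / N" "(\<lfloor>N * x\<rfloor> + 1) / N \<le> x + 1 / N" "x - 1 / N \<le> \<lfloor>N * x\<rfloor> / N"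
    for x :: real
  proof -
    have f: "\<lfloor>N * x\<rfloor> \<le> N * x" "N * x < \<lfloor>N * x\<rfloor> + 1" by linarith+
    show "\<lfloor>N * x\<rfloor> / N \<le> x" "x < (\<lfloor>N * x\<rfloor> + 1) / N"
      using assms f by (simp_all add: field_simps)
    then show "(\<lfloor>N * x\<rfloor> + 1) / N \<le> x + 1 / N" "x - 1 / N \<le> \<lfloor>N * x\<rfloor> / N"
      by (simp_all add: add_divide_distrib)
  qed
  show "fst (grid_low N (cell N z)) \<le> fst z" "fst z < fst (grid_up N (cell N z))"
    "snd (grid_low N (cell N z)) \<le> snd z" "snd z < snd (grid_up N (cell N z))"
    "fst (grid_up N (cell N z)) \<le> fst z + 1 / N" "fst z - 1 / N \<le> fst (grid_low N (cell N z))"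
    "snd (grid_up N (cell N z)) \<le> snd z + 1 / N" "snd z - 1 / N \<le> snd (grid_low N (cell N z))"
    using * by (simp_all add: grid_low_def grid_up_def cell_def)
qed

text \<open>Rounding outward adds at most \<open>2 / N\<close> to each side and
  \<open>(8 * D + 4) / N\<close> to the area; the square root is subadditive.\<close>

lemma grid_side_le:
  assumes N: "N > 0" and le: "comp_le z w"
    and D: "\<bar>fst z\<bar> \<le> D" "\<bar>snd z\<bar> \<le> D" "\<bar>fst w\<bar> \<le> D" "\<bar>snd w\<bar> \<le> D"
  shows "grid_side N (cell N z) (cell N w) \<le>
    sqrt ((fst w - fst z) * (snd w - snd z)) + sqrt ((8 * D + 4) / N)"
proof -
  define u v where "u = fst w - fst z" and "v = snd w - snd z"
  have uv: "0 \<le> u" "0 \<le> v" "u + v \<le> 4 * D" using le D by (auto simp: u_def v_def comp_le_def)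
  note g = grid_bounds[OF N]
  have "(fst (grid_up N (cell N w)) - fst (grid_low N (cell N z))) *
      (snd (grid_up N (cell N w)) - snd (grid_low N (cell N z))) \<le> (u + 2 / N) * (v + 2 / N)"
  proof -
    have "2 / real N = 1 / N + 1 / N" "0 \<le> 1 / real N" by simp_all
    then show ?thesis using uv g[of z] g[of w] unfolding u_def v_def by (intro mult_mono) linarith+
  qed
  also have "\<dots> = u * v + (2 * (u + v) + 4 / N) / N"
    by (simp add: algebra_simps add_divide_distrib)
  also have "\<dots> \<le> u * v + (8 * D + 4) / N"
  proof (intro add_left_mono divide_right_mono)
    have "4 / real N \<le> 4" using N by (simp add: field_simps)
    moreover have "2 * (u + v) \<le> 8 * D" using uv by simp
    ultimately show "2 * (u + v) + 4 / real N \<le> 8 * D + 4" by (intro add_mono)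
  qed simp
  finally have "grid_side N (cell N z) (cell N w) \<le> sqrt (u * v + (8 * D + 4) / N)"
    unfolding grid_side_def by (rule real_sqrt_le_mono)
  also have "\<dots> \<le> sqrt (u * v) + sqrt ((8 * D + 4) / N)"
    using uv by (intro sqrt_add_le_add_sqrt) auto
  finally show ?thesis by (simp add: u_def v_def)
qed

locale cone_poisson = quadrant_poisson M \<Xi> + cone_box a b \<alpha> \<beta> \<theta> A
  for M :: "'w measure" and \<Xi> a b \<alpha> \<beta> \<theta> A
begin

lemma ab_less: "\<alpha> < \<beta>" using cone by simp

text \<open>In cone coordinates, the far corner of the parallelogram whose diagonal is the optimal
  displacement from the origin.\<close>

definition apex :: "real \<times> real" where
  "apex = cone_coord \<alpha> \<beta> (A, \<theta> * A)"

lemma apex_pos: "fst apex > 0" "snd apex > 0"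
  using cone A by (simp_all add: apex_def cone_coord_def)

lemma optimum_apex: "optimum = sqrt (fst apex * snd apex)"
  by (simp add: optimum_def gain_def apex_def cone_coord_def)

text \<open>Both original coordinates increase along the two cone directions because \<alpha> and
  \<beta> are positive, so the far corner bounds the whole parallelogram. Optimal paths in the box
  are thus at least as long as the longest chain in it.\<close>

lemma apex_rect_subset:
  assumes t: "t > 0"
  shows "cone_rect \<alpha> \<beta> (t *\<^sub>R (0, 0)) (t *\<^sub>R apex) \<subseteq> {0..a * t} \<times> {0..b * t}"
proof
  fix z assume z: "z \<in> cone_rect \<alpha> \<beta> (t *\<^sub>R (0, 0)) (t *\<^sub>R apex)"
  define u v where "u = fst (cone_coord \<alpha> \<beta> z)" and "v = snd (cone_coord \<alpha> \<beta> z)"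
  have uv: "0 \<le> u" "u \<le> t * fst apex" "0 \<le> v" "v \<le> t * snd apex"
    using z by (auto simp: cone_rect_def u_def v_def mem_Times_iff)
  have k: "sqrt (\<beta> - \<alpha>) > 0" using ab_less by simp
  have ap: "(fst apex + snd apex) / sqrt (\<beta> - \<alpha>) = A" "(\<alpha> * fst apex + \<beta> * snd apex) / sqrt (\<beta> - \<alpha>) = \<theta> * A"
    using cone_point_coord(1)[OF ab_less, of "(A, \<theta> * A)"] by (simp_all add: apex_def cone_point_def)
  have z': "fst z = (u + v) / sqrt (\<beta> - \<alpha>)" "snd z = (\<alpha> * u + \<beta> * v) / sqrt (\<beta> - \<alpha>)"
    using cone_point_coord(1)[OF ab_less, of z] by (simp_all add: cone_point_def u_def v_def prod_eq_iff)
  have "fst z \<le> t * ((fst apex + snd apex) / sqrt (\<beta> - \<alpha>))"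
    unfolding z' times_divide_eq_right
    using uv k by (intro divide_right_mono) (auto simp: algebra_simps)
  then have x: "fst z \<le> t * A" by (simp only: ap)
  have "\<alpha> * u \<le> \<alpha> * (t * fst apex)" "\<beta> * v \<le> \<beta> * (t * snd apex)"
    using uv cone by (auto intro!: mult_left_mono)
  then have "snd z \<le> t * ((\<alpha> * fst apex + \<beta> * snd apex) / sqrt (\<beta> - \<alpha>))"
    unfolding z' times_divide_eq_right
    using k by (intro divide_right_mono) (auto simp: algebra_simps)
  then have y: "snd z \<le> t * (\<theta> * A)" by (simp only: ap)
  have "0 \<le> fst z" "0 \<le> snd z" unfolding z' using uv k cone by simp_all
  moreover have "fst z \<le> a * t" using order_trans[OF x mult_left_mono[OF A(2)]] t by (simp add: mult.commute)
  moreover have "snd z \<le> b * t" using order_trans[OF y mult_left_mono[OF A(3)]] t by (simp add: mult.commute)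
  ultimately show "z \<in> {0..a * t} \<times> {0..b * t}" by (simp add: mem_Times_iff)
qed

definition grid_count :: "nat \<Rightarrow> real \<Rightarrow> int \<times> int \<Rightarrow> int \<times> int \<Rightarrow> 'w \<Rightarrow> real" where
  "grid_count N t i j \<omega> =
    real (longest (slope_le \<alpha> \<beta>) (\<Xi> \<omega> \<inter> cone_rect \<alpha> \<beta> (t *\<^sub>R grid_low N i) (t *\<^sub>R grid_up N j)))"

text \<open>Points of the path between two positions lie in the rectangle spanned by these
  positions, and rounding outward keeps them inside. This replaces random endpoints by deterministic
  rectangles.\<close>

lemma segment_le_grid_count:
  assumes N: "N > 0" and t: "t > 0" and \<omega>: "\<omega> \<in> space M"
    and ps: "set ps \<subseteq> \<Xi> \<omega>" "distinct ps" "sorted_wrt (slope_le \<alpha> \<beta>) ps" and ij: "i \<le> j" "j < length ps"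
  defines "c \<equiv> \<lambda>k. cell N (cone_coord \<alpha> \<beta> ((1 / t) *\<^sub>R ps ! k))"
  shows "real (j - i + 1) \<le> grid_count N t (c i) (c j) \<omega>"
proof -
  let ?R = "cone_rect \<alpha> \<beta> (t *\<^sub>R grid_low N (c i)) (t *\<^sub>R grid_up N (c j))"
  have le: "comp_le (cone_coord \<alpha> \<beta> (ps ! i)) (cone_coord \<alpha> \<beta> (ps ! j))"
    unfolding slope_le_iff_comp_le[OF ab_less, symmetric]
    using sorted_wrt_nth_less[OF ps(3), of i j] ij slope_le_refl by (cases "i = j") auto
  have sc: "cone_coord \<alpha> \<beta> (ps ! k) = t *\<^sub>R cone_coord \<alpha> \<beta> ((1 / t) *\<^sub>R ps ! k)" for k
    using t by (simp add: cone_coord_scaleR)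
  note g = grid_bounds[OF N, of "cone_coord \<alpha> \<beta> ((1 / t) *\<^sub>R ps ! k)" for k, folded c_def]
  have lo: "fst (t *\<^sub>R grid_low N (c i)) \<le> fst (cone_coord \<alpha> \<beta> (ps ! i))"
      "snd (t *\<^sub>R grid_low N (c i)) \<le> snd (cone_coord \<alpha> \<beta> (ps ! i))"
    unfolding sc using g(1,3) t by (simp_all add: c_def)
  have up: "fst (cone_coord \<alpha> \<beta> (ps ! j)) < fst (t *\<^sub>R grid_up N (c j))"
      "snd (cone_coord \<alpha> \<beta> (ps ! j)) < snd (t *\<^sub>R grid_up N (c j))"
    unfolding sc using g(2,4) t by (simp_all add: c_def)
  have "has_chain (slope_le \<alpha> \<beta>) (j - i + 1) {q \<in> set ps. slope_le \<alpha> \<beta> (ps ! i) q \<and> slope_le \<alpha> \<beta> q (ps ! j)}"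
    by (rule has_chain_segment[OF ps(2,3) slope_le_refl ij])
  moreover have "{q \<in> set ps. slope_le \<alpha> \<beta> (ps ! i) q \<and> slope_le \<alpha> \<beta> q (ps ! j)} \<subseteq> \<Xi> \<omega> \<inter> ?R"
    using ps(1) lo up
    by (auto simp: slope_le_iff_comp_le[OF ab_less] comp_le_def cone_rect_def mem_Times_iff)
  ultimately have hc: "has_chain (slope_le \<alpha> \<beta>) (j - i + 1) (\<Xi> \<omega> \<inter> ?R)"
    using has_chain_mono by blast
  have "fst (t *\<^sub>R grid_low N (c i)) < fst (t *\<^sub>R grid_up N (c j))"
    "snd (t *\<^sub>R grid_low N (c i)) < snd (t *\<^sub>R grid_up N (c j))"
    using lo up le by (auto simp: comp_le_def)
  from cone_rect_chain(4)[OF ab_less this] have "finite (\<Xi> \<omega> \<inter> ?R)"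
    by (rule finite_points[OF \<omega>])
  from has_chain_iff[OF this] hc show ?thesis unfolding grid_count_def by simp
qed

text \<open>The deviation \<open>g\<close> is abstract so that the three regimes become instances.
  Homogeneity brings the picture at scale \<open>t\<close> back to a fixed box, and
  \<open>opt\<close> says that optimal configurations do not deviate.\<close>

lemma vanishing_deviation:
  fixes g :: "real \<times> real \<Rightarrow> real \<times> real \<Rightarrow> real"
  assumes gc: "continuous_on UNIV (\<lambda>z. g (fst z) (snd z))" and \<delta>: "\<delta> > 0"
    and hom: "\<And>c p q. c > 0 \<Longrightarrow> g (c *\<^sub>R p) (c *\<^sub>R q) = c * g p q"
    and opt: "\<And>p0 p1 p2 p3. \<lbrakk>p0 \<in> box0; p1 \<in> box0; p2 \<in> box0; p3 \<in> box0;
      slope_le \<alpha> \<beta> p0 p1; slope_le \<alpha> \<beta> p1 p2; slope_le \<alpha> \<beta> p2 p3;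
      fst p3 = fst p0 + A; snd p1 - snd p0 = \<theta> * (fst p1 - fst p0);
      snd p2 - snd p1 = \<theta> * (fst p2 - fst p1); snd p3 - snd p2 = \<theta> * (fst p3 - fst p2)\<rbrakk> \<Longrightarrow>
      g p1 p2 \<le> 0 \<and> g p2 p1 \<le> 0"
  shows "vanishing_probability M (\<lambda>t \<omega>. \<exists>ps. optimal_path \<alpha> \<beta> (\<Xi> \<omega>) (a * t) (b * t) ps \<and>
    (\<exists>p\<in>set ps. \<exists>q\<in>set ps. g p q > t * \<delta>))"
  unfolding vanishing_probability_def
proof (intro conjI allI impI)
  let ?bad = "\<lambda>t. {\<omega>\<in>space M. \<exists>ps. optimal_path \<alpha> \<beta> (\<Xi> \<omega>) (a * t) (b * t) ps \<and>
    (\<exists>p\<in>set ps. \<exists>q\<in>set ps. g p q > t * \<delta>)}"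
  show bad: "?bad t \<in> events" for t by (rule optimal_path_event[OF gc])
  obtain \<mu> where \<mu>: "\<mu> > 0"
    and deficit: "\<And>p0 p1 p2 p3. \<lbrakk>p0 \<in> box0; p1 \<in> box0; p2 \<in> box0; p3 \<in> box0;
      slope_le \<alpha> \<beta> p0 p1; slope_le \<alpha> \<beta> p1 p2; slope_le \<alpha> \<beta> p2 p3; g p1 p2 \<ge> \<delta> \<or> g p2 p1 \<ge> \<delta>\<rbrakk> \<Longrightarrow>
      gain \<alpha> \<beta> p0 p1 + gain \<alpha> \<beta> p1 p2 + gain \<alpha> \<beta> p2 p3 \<le> optimum - \<mu>"
  proof (rule gain_deficit[OF gc \<delta>], goal_cases)
    case (1 p0 p1 p2 p3)
    show ?case by (rule opt) (fact 1)+
  next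
    case (2 \<mu>)
    show ?case by (rule that) (fact 2)+
  qed
  have bb: "bounded (cone_coord \<alpha> \<beta> ` box0)"
    by (intro bounded_cone_coord bounded_Times) auto
  then obtain D where D: "D > 0" "\<And>z. z \<in> box0 \<Longrightarrow> norm (cone_coord \<alpha> \<beta> z) \<le> D"
    by (auto simp: bounded_pos)
  have D': "\<bar>fst (cone_coord \<alpha> \<beta> z)\<bar> \<le> D" "\<bar>snd (cone_coord \<alpha> \<beta> z)\<bar> \<le> D" if "z \<in> box0" for z
    using D(2)[OF that] norm_fst_le[of "fst (cone_coord \<alpha> \<beta> z)" "snd (cone_coord \<alpha> \<beta> z)"]
      norm_snd_le[of "snd (cone_coord \<alpha> \<beta> z)" "fst (cone_coord \<alpha> \<beta> z)"] by auto
  \<comment> \<open>Each of the three segments may lose \<open>\<mu> / 6\<close> to rounding, so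
    half of the deficit survives.\<close>
  obtain N where N: "N > 0" "sqrt ((8 * D + 4) / real N) \<le> \<mu> / 6"
  proof -
    obtain n where n: "real n > (8 * D + 4) / (\<mu> / 6)\<^sup>2" using reals_Archimedean2 by blast
    have "0 < (8 * D + 4) / (\<mu> / 6)\<^sup>2" using D \<mu> by simp
    then have n0: "real n > 0" using n by linarith
    then have "(8 * D + 4) / real n \<le> (\<mu> / 6)\<^sup>2" using n \<mu> by (simp add: field_simps)
    then have "sqrt ((8 * D + 4) / real n) \<le> \<mu> / 6" using \<mu> by (intro real_le_lsqrt) auto
    then show ?thesis using n0 by (intro that[of n]) auto
  qed
  \<comment> \<open>Chosen so that \<open>2 * \<epsilon> * optimum = growth * \<mu> / 2\<close>: the
    remaining half of the deficit pays for the errors in both tails.\<close>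
  define \<epsilon> where "\<epsilon> = growth * \<mu> / (4 * optimum)"
  have \<epsilon>: "\<epsilon> > 0" using growth_pos \<mu> optimum_pos by (simp add: \<epsilon>_def)
  have budget: "(growth + \<epsilon>) * (optimum - \<mu> / 2) \<le> (growth - \<epsilon>) * optimum"
  proof -
    have "\<epsilon> * optimum = growth * \<mu> / 4" using optimum_pos by (simp add: \<epsilon>_def)
    moreover have "0 \<le> \<epsilon> * \<mu>" using \<epsilon> \<mu> by simp
    ultimately show ?thesis by (simp add: algebra_simps)
  qed
  define I where "I = cell N ` cone_coord \<alpha> \<beta> ` box0"
  \<comment> \<open>A finite family that does not depend on \<open>t\<close>, as the union bound
    requires.\<close>
  define J where "J = {(i, j). i \<in> I \<and> j \<in> I \<and> fst i \<le> fst j \<and> snd i \<le> snd j}"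
  have "J \<subseteq> I \<times> I" by (auto simp: J_def)
  then have finJ: "finite J" using finite_cells[OF bb, of N] unfolding I_def by (meson finite_SigmaI finite_subset)
  have Jpos: "fst (grid_low N (fst x)) < fst (grid_up N (snd x))" "snd (grid_low N (fst x)) < snd (grid_up N (snd x))"
    if "x \<in> J" for x
    using that N(1) by (auto simp: J_def grid_low_def grid_up_def divide_less_cancel)
  define U where "U x t = {\<omega>\<in>space M. (growth + \<epsilon>) * grid_side N (fst x) (snd x) * t \<le> grid_count N t (fst x) (snd x) \<omega>}"
    for x t
  have U: "U x t \<in> events" "((\<lambda>t. prob (U x t)) \<longlongrightarrow> 0) at_top" if "x \<in> J" "t > 0" for x t
    using cone_rect_tails(1,2)[OF ab_less Jpos[OF that(1)] \<epsilon>] that(2)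
    by (simp_all add: U_def[abs_def] grid_count_def grid_side_def)
  define L where "L t = {\<omega>\<in>space M. real (longest (slope_le \<alpha> \<beta>)
    (\<Xi> \<omega> \<inter> cone_rect \<alpha> \<beta> (t *\<^sub>R (0, 0)) (t *\<^sub>R apex))) < (growth - \<epsilon>) * optimum * t}" for t
  have apex0: "fst (0::real, 0::real) < fst apex" "snd (0::real, 0::real) < snd apex" using apex_pos by auto
  have boxq: "{0..x} \<times> {0..y} \<subseteq> quadrant" for x y :: real by (auto simp: quadrant_def)
  have L: "L t \<in> events" "((\<lambda>t. prob (L t)) \<longlongrightarrow> 0) at_top" if "t > 0" for t
  proof -
    note T = cone_rect_tails(2,3)[OF ab_less apex0 \<epsilon>]
    have "L t = space M - {\<omega>\<in>space M. (growth - \<epsilon>) * optimum * t \<le> real (longest (slope_le \<alpha> \<beta>)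
      (\<Xi> \<omega> \<inter> cone_rect \<alpha> \<beta> (t *\<^sub>R (0, 0)) (t *\<^sub>R apex)))}" by (auto simp: L_def)
    moreover have "{\<omega>\<in>space M. (growth - \<epsilon>) * optimum * t \<le> real (longest (slope_le \<alpha> \<beta>)
      (\<Xi> \<omega> \<inter> cone_rect \<alpha> \<beta> (t *\<^sub>R (0, 0)) (t *\<^sub>R apex)))} \<in> events"
      using T(1)[rule_format, OF that] by simp
    ultimately show "L t \<in> events" by simp
    show "((\<lambda>t. prob (L t)) \<longlongrightarrow> 0) at_top"
      using T(2)[OF order_trans[OF apex_rect_subset boxq]] by (simp add: L_def[abs_def] optimum_apex)
  qed
  have cover: "?bad t \<subseteq> (\<Union>x\<in>J. U x t) \<union> L t" if t: "t > 0" for t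
  proof
    fix \<omega> assume "\<omega> \<in> ?bad t"
    then obtain ps p q where \<omega>: "\<omega> \<in> space M" and ps: "optimal_path \<alpha> \<beta> (\<Xi> \<omega>) (a * t) (b * t) ps"
      and pq: "p \<in> set ps" "q \<in> set ps" "g p q > t * \<delta>" by auto
    show "\<omega> \<in> (\<Union>x\<in>J. U x t) \<union> L t"
    proof (rule ccontr)
      assume *: "\<omega> \<notin> (\<Union>x\<in>J. U x t) \<union> L t"
      have nU: "grid_count N t (fst x) (snd x) \<omega> < (growth + \<epsilon>) * grid_side N (fst x) (snd x) * t" if "x \<in> J" for x
      proof -
        have "\<omega> \<notin> U x t" using * that by blast
        then show ?thesis using \<omega> by (simp add: U_def not_le)
      qed
      have "\<omega> \<notin> L t" using * by blast
      then have nL: "(growth - \<epsilon>) * optimum * t \<le> real (longest (slope_le \<alpha> \<beta>)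
          (\<Xi> \<omega> \<inter> cone_rect \<alpha> \<beta> (t *\<^sub>R (0, 0)) (t *\<^sub>R apex)))"
        using \<omega> by (simp add: L_def not_less)
      let ?B = "{0..a * t} \<times> {0..b * t}"
      have fin: "finite (\<Xi> \<omega> \<inter> ?B)"
        using finite_points[OF \<omega>] closed_rectangle_admissible by (simp add: admissible_def)
      have chain: "set ps \<subseteq> \<Xi> \<omega> \<inter> ?B" "distinct ps" "sorted_wrt (slope_le \<alpha> \<beta>) ps"
        and len: "length ps = longest (slope_le \<alpha> \<beta>) (\<Xi> \<omega> \<inter> ?B)"
        using ps by (simp_all add: optimal_path_def max_chain_length_eq_longest)
      define n where "n = length ps"
      have lower: "(growth - \<epsilon>) * optimum * t \<le> real n"
      proof -
        let ?R = "cone_rect \<alpha> \<beta> (t *\<^sub>R (0, 0)) (t *\<^sub>R apex)"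
        have sub: "\<Xi> \<omega> \<inter> ?R \<subseteq> \<Xi> \<omega> \<inter> ?B" using apex_rect_subset[OF t] by blast
        then have "finite (\<Xi> \<omega> \<inter> ?R)" using fin finite_subset by blast
        then have "has_chain (slope_le \<alpha> \<beta>) (longest (slope_le \<alpha> \<beta>) (\<Xi> \<omega> \<inter> ?R)) (\<Xi> \<omega> \<inter> ?R)"
          by (simp add: has_chain_iff)
        then have "has_chain (slope_le \<alpha> \<beta>) (longest (slope_le \<alpha> \<beta>) (\<Xi> \<omega> \<inter> ?R)) (\<Xi> \<omega> \<inter> ?B)"
          using has_chain_mono[OF _ sub order_refl] by blast
        then show ?thesis using nL len by (simp add: has_chain_iff[OF fin] n_def)
      qed
      obtain ip iq where ipq: "ip < n" "iq < n" "ps ! ip = p" "ps ! iq = q"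
        using pq unfolding n_def by (metis in_set_conv_nth)
      \<comment> \<open>The pair is put into path order, so \<open>g\<close> may appear with its
        arguments exchanged.\<close>
      define i j where "i = min ip iq" and "j = max ip iq"
      have ij: "i \<le> j" "j < n" using ipq by (auto simp: i_def j_def)
      define z where "z k = (1 / t) *\<^sub>R ps ! k" for k
      define c where "c k = cell N (cone_coord \<alpha> \<beta> (z k))" for k
      have zbox: "z k \<in> box0" if "k < n" for k
      proof -
        have "ps ! k \<in> ?B" using chain(1) that nth_mem[of k ps] by (auto simp: n_def)
        then show ?thesis using t by (auto simp: z_def mem_Times_iff field_simps)
      qed
      have zle: "slope_le \<alpha> \<beta> (z k) (z l)" if "k \<le> l" "l < n" for k l
      proof -
        have "slope_le \<alpha> \<beta> (ps ! k) (ps ! l)"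
          using sorted_wrt_nth_less[OF chain(3), of k l] that slope_le_refl by (cases "k = l") (auto simp: n_def)
        then show ?thesis
          using t unfolding z_def slope_le_iff_comp_le[OF ab_less] cone_coord_scaleR comp_le_def
          by (simp add: divide_right_mono)
      qed
      have seg: "real (l - k + 1) \<le> (growth + \<epsilon>) * (gain \<alpha> \<beta> (z k) (z l) + \<mu> / 6) * t"
        if kl: "k \<le> l" "l < n" for k l
      proof -
        have kn: "k < n" using kl by simp
        have cle: "comp_le (cone_coord \<alpha> \<beta> (z k)) (cone_coord \<alpha> \<beta> (z l))"
          using zle[OF kl] by (simp add: slope_le_iff_comp_le[OF ab_less])
        then have "fst (c k) \<le> fst (c l)" "snd (c k) \<le> snd (c l)"
          unfolding c_def cell_def comp_le_def by (auto intro!: floor_mono mult_left_mono)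
        then have inJ: "(c k, c l) \<in> J"
          using zbox[OF kn] zbox[OF kl(2)] by (auto simp: J_def I_def c_def)
        have "set ps \<subseteq> \<Xi> \<omega>" using chain(1) by blast
        then have "real (l - k + 1) \<le> grid_count N t (c k) (c l) \<omega>"
          using segment_le_grid_count[OF N(1) t \<omega> _ chain(2,3) kl[unfolded n_def]] by (simp add: c_def z_def)
        also have "\<dots> \<le> (growth + \<epsilon>) * grid_side N (c k) (c l) * t" using nU[OF inJ] by simp
        also have "\<dots> \<le> (growth + \<epsilon>) * (gain \<alpha> \<beta> (z k) (z l) + \<mu> / 6) * t"
        proof (intro mult_right_mono mult_left_mono)
          show "grid_side N (c k) (c l) \<le> gain \<alpha> \<beta> (z k) (z l) + \<mu> / 6"
            using grid_side_le[OF N(1) cle D'[OF zbox[OF kn]] D'[OF zbox[OF kl(2)]]] N(2)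
            by (simp add: c_def gain_def)
        qed (use growth_pos \<epsilon> t in auto)
        finally show ?thesis .
      qed
      have gz: "g (z k) (z l) = g (ps ! k) (ps ! l) / t" for k l
        using hom[of "1 / t" "ps ! k" "ps ! l"] t by (simp add: z_def)
      have "g (z ip) (z iq) > \<delta>" using pq(3) t unfolding gz ipq by (simp add: field_simps)
      then have gd: "g (z i) (z j) \<ge> \<delta> \<or> g (z j) (z i) \<ge> \<delta>"
        by (cases "ip \<le> iq") (auto simp: i_def j_def)
      \<comment> \<open>The outer points are the first and last points of the path itself, wherever
        these lie in the box.\<close>
      have "gain \<alpha> \<beta> (z 0) (z i) + gain \<alpha> \<beta> (z i) (z j) + gain \<alpha> \<beta> (z j) (z (n - 1)) \<le> optimum - \<mu>"
        using ij by (intro deficit zbox zle gd) auto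
      then have sum: "gain \<alpha> \<beta> (z 0) (z i) + \<mu> / 6 + (gain \<alpha> \<beta> (z i) (z j) + \<mu> / 6) +
          (gain \<alpha> \<beta> (z j) (z (n - 1)) + \<mu> / 6) \<le> optimum - \<mu> / 2" by simp
      \<comment> \<open>The points at positions \<open>i\<close> and \<open>j\<close> are each
        counted twice, so the sum is \<open>n + 2\<close>; this supplies the strict inequality for
        the contradiction.\<close>
      have "real n < real (i - 0 + 1) + real (j - i + 1) + real (n - 1 - j + 1)" using ij by simp
      also have "\<dots> \<le> (growth + \<epsilon>) * (gain \<alpha> \<beta> (z 0) (z i) + \<mu> / 6) * t +
          (growth + \<epsilon>) * (gain \<alpha> \<beta> (z i) (z j) + \<mu> / 6) * t +
          (growth + \<epsilon>) * (gain \<alpha> \<beta> (z j) (z (n - 1)) + \<mu> / 6) * t"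
        using ij by (intro add_mono seg) auto
      also have "\<dots> = (growth + \<epsilon>) * (gain \<alpha> \<beta> (z 0) (z i) + \<mu> / 6 + (gain \<alpha> \<beta> (z i) (z j) + \<mu> / 6) +
          (gain \<alpha> \<beta> (z j) (z (n - 1)) + \<mu> / 6)) * t" by (simp only: distrib_left distrib_right)
      also have "\<dots> \<le> (growth + \<epsilon>) * (optimum - \<mu> / 2) * t"
        using sum growth_pos \<epsilon> t by (intro mult_right_mono mult_left_mono) auto
      also have "\<dots> \<le> (growth - \<epsilon>) * optimum * t"
        using budget t by (intro mult_right_mono) auto
      finally show False using lower by simp
    qed
  qed
  show "((\<lambda>t. prob (?bad t)) \<longlongrightarrow> 0) at_top"
  proof (rule tendsto_sandwich[OF _ _ tendsto_const])
    have "((\<lambda>t. (\<Sum>x\<in>J. prob (U x t)) + prob (L t)) \<longlongrightarrow> (\<Sum>x\<in>J. 0) + 0) at_top"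
      by (intro tendsto_add tendsto_sum U(2)[OF _ zero_less_one] L(2)[OF zero_less_one])
    then show "((\<lambda>t. (\<Sum>x\<in>J. prob (U x t)) + prob (L t)) \<longlongrightarrow> 0) at_top" by simp
    show "\<forall>\<^sub>F t in at_top. prob (?bad t) \<le> (\<Sum>x\<in>J. prob (U x t)) + prob (L t)"
      using eventually_gt_at_top[of 0]
    proof eventually_elim
      case (elim t)
      have ev: "(\<Union>x\<in>J. U x t) \<in> events" using U(1)[OF _ elim] finJ by (intro sets.finite_UN) auto
      have "prob (?bad t) \<le> prob ((\<Union>x\<in>J. U x t) \<union> L t)"
        using cover[OF elim] ev L(1)[OF elim] by (intro finite_measure_mono sets.Un)
      also have "\<dots> \<le> prob (\<Union>x\<in>J. U x t) + prob (L t)"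
        using ev L(1)[OF elim] by (intro measure_Un_le)
      also have "prob (\<Union>x\<in>J. U x t) \<le> (\<Sum>x\<in>J. prob (U x t))"
        using U(1)[OF _ elim] finJ by (intro finite_measure_subadditive_finite) auto
      finally show ?case by simp
    qed
  qed simp
qed

end

section \<open>The three slope regimes\<close>

lemma vanishing_probability_cong:
  assumes "\<And>t \<omega>. t > 0 \<Longrightarrow> \<omega> \<in> space M \<Longrightarrow> E t \<omega> \<longleftrightarrow> F t \<omega>" "vanishing_probability M F"
  shows "vanishing_probability M E"
proof -
  have eq: "{\<omega>\<in>space M. E t \<omega>} = {\<omega>\<in>space M. F t \<omega>}" if "t > 0" for t
    using assms(1)[OF that] by auto
  have "\<forall>\<^sub>F t in at_top. measure M {\<omega>\<in>space M. F t \<omega>} = measure M {\<omega>\<in>space M. E t \<omega>}"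
    using eventually_gt_at_top[of "0::real"] by eventually_elim (simp add: eq)
  then show ?thesis
    using assms(2) eq unfolding vanishing_probability_def by (auto intro: Lim_transform_eventually)
qed

definition offset :: "real \<Rightarrow> real \<times> real \<Rightarrow> real" where
  "offset \<theta> p = snd p - \<theta> * fst p"

text \<open>
  Each point of a path restricts the admissible shift of the strip to an interval, so by Helly's theorem
  in dimension one a path leaves every shifted strip as soon as two of its points do.
\<close>

definition vertical_gap :: "real \<Rightarrow> real \<times> real \<Rightarrow> real \<times> real \<Rightarrow> real" where
  "vertical_gap \<theta> p q = max (- offset \<theta> p) (max (offset \<theta> q - snd p) ((offset \<theta> q - offset \<theta> p) / 2))"

definition horizontal_gap :: "real \<Rightarrow> real \<times> real \<Rightarrow> real \<times> real \<Rightarrow> real" where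
  "horizontal_gap \<theta> p q = max (offset \<theta> p) (max (- offset \<theta> q - \<theta> * fst p) ((offset \<theta> p - offset \<theta> q) / 2))"

lemma mem_vertical_strip:
  "p \<in> (+) (0, c) ` strip R \<theta> \<longleftrightarrow> 0 \<le> fst p \<and> c \<le> snd p \<and> \<bar>offset \<theta> p - c\<bar> \<le> R"
proof -
  have "p \<in> (+) (0, c) ` strip R \<theta> \<longleftrightarrow> p - (0, c) \<in> strip R \<theta>"
    by (metis (no_types, lifting) add_diff_cancel_left' diff_add_cancel add.commute image_iff)
  then show ?thesis by (cases p) (auto simp: strip_def offset_def algebra_simps)
qed

lemma mem_horizontal_strip:
  "p \<in> (+) (c, 0) ` strip R \<theta> \<longleftrightarrow> c \<le> fst p \<and> 0 \<le> snd p \<and> \<bar>offset \<theta> p + \<theta> * c\<bar> \<le> R"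
proof -
  have "p \<in> (+) (c, 0) ` strip R \<theta> \<longleftrightarrow> p - (c, 0) \<in> strip R \<theta>"
    by (metis (no_types, lifting) add_diff_cancel_left' diff_add_cancel add.commute image_iff)
  then show ?thesis by (cases p) (auto simp: strip_def offset_def algebra_simps)
qed

text \<open>Each point \<open>p\<close> confines the shift \<open>c\<close> to the interval from
  \<open>offset \<theta> p - R\<close> to \<open>offset \<theta> p + R\<close> and to that from 0 to
  \<open>snd p\<close>. The three terms of the gap compare lower bounds with upper bounds: 0 with
  the upper end for \<open>p\<close>, then the lower end for \<open>q\<close> with
  \<open>snd p\<close> and with the upper end for \<open>p\<close>.\<close>

lemma escapes_vertical_strips_iff:
  assumes P: "finite P" "P \<subseteq> quadrant"
  shows "(\<forall>c\<ge>0. \<not> P \<subseteq> (+) (0, c) ` strip R \<theta>) \<longleftrightarrow> (\<exists>p\<in>P. \<exists>q\<in>P. vertical_gap \<theta> p q > R)"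
    (is "?L \<longleftrightarrow> ?R")
proof (rule iffI, rule ccontr)
  assume L: ?L and "\<not> ?R"
  then have le: "\<And>p q. p \<in> P \<Longrightarrow> q \<in> P \<Longrightarrow> vertical_gap \<theta> p q \<le> R" by (meson not_le)
  have ne: "P \<noteq> {}" using L by auto
  define m where "m = Max (offset \<theta> ` P)"
  have "m \<in> offset \<theta> ` P" unfolding m_def using P ne by (intro Max_in) auto
  then obtain q where q: "q \<in> P" "m = offset \<theta> q" by auto
  \<comment> \<open>The smallest shift that meets all lower bounds.\<close>
  define c where "c = max 0 (m - R)"
  have "p \<in> (+) (0, c) ` strip R \<theta>" if p: "p \<in> P" for p
  proof -
    have "offset \<theta> p \<le> m" unfolding m_def using P p by (intro Max_ge) auto
    moreover have "0 \<le> fst p" "0 \<le> snd p" using P p by (auto simp: quadrant_def)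
    moreover have "- offset \<theta> p \<le> R" "m - snd p \<le> R" "m - offset \<theta> p \<le> 2 * R"
      using le[OF p q(1)] by (simp_all add: vertical_gap_def q(2))
    ultimately show ?thesis
      unfolding mem_vertical_strip c_def max_def abs_le_iff by (auto split: if_splits)
  qed
  then have "P \<subseteq> (+) (0, c) ` strip R \<theta>" by blast
  then show False using L by (simp add: c_def)
next
  assume ?R
  then obtain p q where pq: "p \<in> P" "q \<in> P" "vertical_gap \<theta> p q > R" by blast
  show ?L
  proof (intro allI impI notI)
    fix c :: real assume c: "c \<ge> 0" "P \<subseteq> (+) (0, c) ` strip R \<theta>"
    then have "p \<in> (+) (0, c) ` strip R \<theta>" "q \<in> (+) (0, c) ` strip R \<theta>" using pq by auto
    then have "c \<le> snd p" "\<bar>offset \<theta> p - c\<bar> \<le> R" "\<bar>offset \<theta> q - c\<bar> \<le> R"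
      by (simp_all only: mem_vertical_strip)
    then have "vertical_gap \<theta> p q \<le> R" unfolding vertical_gap_def abs_le_iff using c(1) by auto
    then show False using pq(3) by simp
  qed
qed

text \<open>In terms of \<open>\<theta> * c\<close> the constraints are those of vertical shifts
  with \<open>- offset \<theta> p\<close> for the offset and \<open>\<theta> * fst p\<close> for the
  height, hence the minimum of the offsets below.\<close>

lemma escapes_horizontal_strips_iff:
  assumes P: "finite P" "P \<subseteq> quadrant" and \<theta>: "\<theta> > 0"
  shows "(\<forall>c\<ge>0. \<not> P \<subseteq> (+) (c, 0) ` strip R \<theta>) \<longleftrightarrow> (\<exists>p\<in>P. \<exists>q\<in>P. horizontal_gap \<theta> p q > R)"
    (is "?L \<longleftrightarrow> ?R")
proof (rule iffI, rule ccontr)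
  assume L: ?L and "\<not> ?R"
  then have le: "\<And>p q. p \<in> P \<Longrightarrow> q \<in> P \<Longrightarrow> horizontal_gap \<theta> p q \<le> R" by (meson not_le)
  have ne: "P \<noteq> {}" using L by auto
  define m where "m = Min (offset \<theta> ` P)"
  have "m \<in> offset \<theta> ` P" unfolding m_def using P ne by (intro Min_in) auto
  then obtain q where q: "q \<in> P" "m = offset \<theta> q" by auto
  define c where "c = max 0 (- m - R) / \<theta>"
  have c: "\<theta> * c = max 0 (- m - R)" "0 \<le> c" using \<theta> by (simp_all add: c_def)
  have "p \<in> (+) (c, 0) ` strip R \<theta>" if p: "p \<in> P" for p
  proof -
    have "m \<le> offset \<theta> p" unfolding m_def using P p by (intro Min_le) auto
    moreover have x: "0 \<le> fst p" "0 \<le> snd p" using P p by (auto simp: quadrant_def)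
    moreover have "0 \<le> \<theta> * fst p" using x \<theta> by simp
    moreover have "offset \<theta> p \<le> R" "- m - \<theta> * fst p \<le> R" "offset \<theta> p - m \<le> 2 * R"
      using le[OF p q(1)] by (simp_all add: horizontal_gap_def q(2))
    ultimately have "\<theta> * c \<le> \<theta> * fst p \<and> 0 \<le> snd p \<and> \<bar>offset \<theta> p + \<theta> * c\<bar> \<le> R"
      unfolding c(1) max_def abs_le_iff by (auto split: if_splits)
    then show ?thesis using \<theta> by (simp add: mem_horizontal_strip)
  qed
  then have "P \<subseteq> (+) (c, 0) ` strip R \<theta>" by blast
  then show False using L c(2) by blast
next
  assume ?R
  then obtain p q where pq: "p \<in> P" "q \<in> P" "horizontal_gap \<theta> p q > R" by blast
  show ?L
  proof (intro allI impI notI)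
    fix c :: real assume c: "c \<ge> 0" "P \<subseteq> (+) (c, 0) ` strip R \<theta>"
    then have *: "p \<in> (+) (c, 0) ` strip R \<theta>" "q \<in> (+) (c, 0) ` strip R \<theta>" using pq by auto
    then have "\<theta> * c \<le> \<theta> * fst p" "0 \<le> \<theta> * c" using \<theta> c(1) by (simp_all add: mem_horizontal_strip)
    moreover have "\<bar>offset \<theta> p + \<theta> * c\<bar> \<le> R" "\<bar>offset \<theta> q + \<theta> * c\<bar> \<le> R"
      using * by (simp_all only: mem_horizontal_strip)
    ultimately have "horizontal_gap \<theta> p q \<le> R" unfolding horizontal_gap_def abs_le_iff by auto
    then show False using pq(3) by simp
  qed
qed

lemma optimal_path_in_quadrant:
  "optimal_path \<alpha> \<beta> X x y ps \<Longrightarrow> set ps \<subseteq> quadrant"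
  by (auto simp: optimal_path_def slope_chain_def quadrant_def)

lemma offset_scaleR: "offset \<theta> (c *\<^sub>R p) = c * offset \<theta> p"
  by (simp add: offset_def algebra_simps)

lemma max_mult_pos: "c > 0 \<Longrightarrow> max (c * x) (c * y) = c * max x y" for c :: real
  by (simp add: max_mult_distrib_left)

theorem theorem3:
  fixes M :: "'w measure" and \<Xi> :: "'w \<Rightarrow> (real \<times> real) set" and a b \<alpha> \<beta> :: real
  assumes "homogeneous_poisson_process M quadrant 1 \<Xi>"
    and "0 < a" and "0 < b" and "0 < \<alpha>" and "\<alpha> < \<beta>"
  shows
    "((\<alpha> + \<beta>) / 2 \<ge> b / a \<and> b / a \<ge> 2 / (1 / \<beta> + 1 / \<alpha>) \<longrightarrow>
        (\<forall>\<delta>>0. vanishing_probability M (\<lambda>t \<omega>.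
           \<exists>ps. optimal_path \<alpha> \<beta> (\<Xi> \<omega>) (a * t) (b * t) ps \<and>
                \<not> set ps \<subseteq> strip (t * \<delta>) (b / a)))) \<and>
     (b / a > (\<alpha> + \<beta>) / 2 \<longrightarrow>
        (\<forall>\<delta>>0. vanishing_probability M (\<lambda>t \<omega>.
           \<exists>ps. optimal_path \<alpha> \<beta> (\<Xi> \<omega>) (a * t) (b * t) ps \<and>
                (\<forall>c\<ge>0. \<not> set ps \<subseteq> (+) (0, c) ` strip (t * \<delta>) ((\<alpha> + \<beta>) / 2))))) \<and>
     (b / a < 2 / (1 / \<beta> + 1 / \<alpha>) \<longrightarrow>
        (\<forall>\<delta>>0. vanishing_probability M (\<lambda>t \<omega>.
           \<exists>ps. optimal_path \<alpha> \<beta> (\<Xi> \<omega>) (a * t) (b * t) ps \<and>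
                (\<forall>c\<ge>0. \<not> set ps \<subseteq> (+) (c, 0) ` strip (t * \<delta>) (2 / (1 / \<beta> + 1 / \<alpha>))))))"
proof (intro conjI impI allI)
  have "prob_space M" using assms(1) by (simp add: homogeneous_poisson_process_def)
  then have qp: "quadrant_poisson M \<Xi>"
    using assms(1) by (simp add: quadrant_poisson_def poisson_points_def poisson_points_axioms_def)
  note ab = assms(2-5)
  have harm: "2 / (1 / \<beta> + 1 / \<alpha>) = 2 * \<alpha> * \<beta> / (\<alpha> + \<beta>)"
    using ab by (simp add: field_simps)
  have means: "\<alpha> < 2 * \<alpha> * \<beta> / (\<alpha> + \<beta>)" "(\<alpha> + \<beta>) / 2 < \<beta>" "\<alpha> < (\<alpha> + \<beta>) / 2"
      "2 * \<alpha> * \<beta> / (\<alpha> + \<beta>) < \<beta>"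
    using ab by (simp_all add: field_simps)
  have sq: "0 \<le> (\<beta> - \<alpha>) * (\<beta> - \<alpha>)" by simp
  fix \<delta> :: real assume \<delta>: "0 < \<delta>"
  {
    assume th: "(\<alpha> + \<beta>) / 2 \<ge> b / a \<and> b / a \<ge> 2 / (1 / \<beta> + 1 / \<alpha>)"
    define \<theta> where "\<theta> = b / a"
    have b: "\<theta> * a = b" using ab by (simp add: \<theta>_def)
    \<comment> \<open>The two bounds on the slope in this regime say that both coefficients of
      \<open>tangent\<close> are nonnegative, so the far corner of the box maximises it.\<close>
    have m: "\<theta> * (\<alpha> + \<beta>) - 2 * \<alpha> * \<beta> \<ge> 0" "\<alpha> + \<beta> - 2 * \<theta> \<ge> 0"
      using th ab unfolding harm \<theta>_def[symmetric] by (simp_all add: field_simps)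
    interpret cone_poisson M \<Xi> a b \<alpha> \<beta> \<theta> a
    proof (intro cone_poisson.intro qp cone_box.intro)
      show "\<alpha> < \<theta>" "\<theta> < \<beta>" using th means unfolding harm \<theta>_def[symmetric] by linarith+
      fix z :: "real \<times> real" assume "fst z \<le> a" "snd z \<le> b"
      then have "(\<theta> * (\<alpha> + \<beta>) - 2 * \<alpha> * \<beta>) * fst z \<le> (\<theta> * (\<alpha> + \<beta>) - 2 * \<alpha> * \<beta>) * a"
        "(\<alpha> + \<beta> - 2 * \<theta>) * snd z \<le> (\<alpha> + \<beta> - 2 * \<theta>) * b"
        using m by (intro mult_left_mono; simp)+
      then show "tangent \<alpha> \<beta> \<theta> z \<le> tangent \<alpha> \<beta> \<theta> (a, \<theta> * a)"
        unfolding tangent_def b by simp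
    qed (use ab b in auto)
    \<comment> \<open>The strip is fixed in this regime, so the deviation of a single point from the
      diagonal decides.\<close>
    let ?g = "\<lambda>p q :: real \<times> real. \<bar>offset \<theta> p\<bar>"
    have "vanishing_probability M (\<lambda>t \<omega>. \<exists>ps. optimal_path \<alpha> \<beta> (\<Xi> \<omega>) (a * t) (b * t) ps \<and>
        (\<exists>p\<in>set ps. \<exists>q\<in>set ps. ?g p q > t * \<delta>))"
    proof (rule vanishing_deviation[OF _ \<delta>])
      show "continuous_on UNIV (\<lambda>z. ?g (fst z) (snd z))"
        unfolding offset_def by (intro continuous_intros)
      show "\<bar>offset \<theta> (c *\<^sub>R p)\<bar> = c * \<bar>offset \<theta> p\<bar>" if "c > 0" for c p and q :: "real \<times> real"
        using that by (simp add: offset_scaleR abs_mult)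
      fix p0 p1 p2 p3 assume p: "p0 \<in> box0" "p1 \<in> box0" "p2 \<in> box0" "p3 \<in> box0"
        and "fst p3 = fst p0 + a" and s: "snd p1 - snd p0 = \<theta> * (fst p1 - fst p0)"
          "snd p2 - snd p1 = \<theta> * (fst p2 - fst p1)" "snd p3 - snd p2 = \<theta> * (fst p3 - fst p2)"
      \<comment> \<open>A displacement of width \<open>a\<close> within the box has to start on the
        left edge. Its height is then \<open>b\<close>, so it starts at the origin.\<close>
      then have "fst p0 = 0" "fst p3 = a" by (auto simp: mem_Times_iff)
      moreover from this have "snd p3 - snd p0 = b"
        using s b by (simp add: algebra_simps)
      then have "snd p0 = 0" using p by (auto simp: mem_Times_iff)
      ultimately show "\<bar>offset \<theta> p1\<bar> \<le> 0 \<and> \<bar>offset \<theta> p2\<bar> \<le> 0"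
        using s by (simp add: offset_def algebra_simps)
    qed
    then show "vanishing_probability M (\<lambda>t \<omega>. \<exists>ps. optimal_path \<alpha> \<beta> (\<Xi> \<omega>) (a * t) (b * t) ps \<and>
        \<not> set ps \<subseteq> strip (t * \<delta>) (b / a))"
    proof (rule vanishing_probability_cong[rotated])
      fix t :: real and \<omega>
      have "\<not> set ps \<subseteq> strip (t * \<delta>) (b / a) \<longleftrightarrow> (\<exists>p\<in>set ps. \<exists>q\<in>set ps. ?g p q > t * \<delta>)"
        if "optimal_path \<alpha> \<beta> (\<Xi> \<omega>) (a * t) (b * t) ps" for ps
      proof -
        have "p \<in> strip (t * \<delta>) (b / a) \<longleftrightarrow> \<not> \<bar>offset \<theta> p\<bar> > t * \<delta>" if "p \<in> set ps" for p
        proof -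
          have "p \<in> quadrant"
            using that optimal_path_in_quadrant[OF \<open>optimal_path \<alpha> \<beta> (\<Xi> \<omega>) (a * t) (b * t) ps\<close>] by blast
          then show ?thesis by (cases p) (auto simp: strip_def offset_def \<theta>_def quadrant_def)
        qed
        then show ?thesis by blast
      qed
      then show "(\<exists>ps. optimal_path \<alpha> \<beta> (\<Xi> \<omega>) (a * t) (b * t) ps \<and> \<not> set ps \<subseteq> strip (t * \<delta>) (b / a)) \<longleftrightarrow>
        (\<exists>ps. optimal_path \<alpha> \<beta> (\<Xi> \<omega>) (a * t) (b * t) ps \<and> (\<exists>p\<in>set ps. \<exists>q\<in>set ps. ?g p q > t * \<delta>))"
        by blast
    qed
  }
  {
    assume th: "b / a > (\<alpha> + \<beta>) / 2"
    define \<theta> where "\<theta> = (\<alpha> + \<beta>) / 2"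
    have b: "\<theta> * a \<le> b" using th ab by (simp add: \<theta>_def field_simps)
    have t0: "\<theta> > 0" using ab by (simp add: \<theta>_def)
    \<comment> \<open>At the arithmetic mean the coefficient of the height vanishes, and that of the
      width equals \<open>(\<beta> - \<alpha>)^2 / 2\<close>.\<close>
    have m: "\<theta> * (\<alpha> + \<beta>) - 2 * \<alpha> * \<beta> \<ge> 0" "\<alpha> + \<beta> - 2 * \<theta> = 0"
      using sq by (simp_all add: \<theta>_def field_simps)
    interpret cone_poisson M \<Xi> a b \<alpha> \<beta> \<theta> a
    proof (intro cone_poisson.intro qp cone_box.intro)
      show "\<alpha> < \<theta>" "\<theta> < \<beta>" using means by (simp_all add: \<theta>_def)
      fix z :: "real \<times> real" assume "fst z \<le> a"
      then have "(\<theta> * (\<alpha> + \<beta>) - 2 * \<alpha> * \<beta>) * fst z \<le> (\<theta> * (\<alpha> + \<beta>) - 2 * \<alpha> * \<beta>) * a"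
        using m(1) by (intro mult_left_mono) simp_all
      then show "tangent \<alpha> \<beta> \<theta> z \<le> tangent \<alpha> \<beta> \<theta> (a, \<theta> * a)"
        unfolding tangent_def m(2) by simp
    qed (use ab b in auto)
    have "vanishing_probability M (\<lambda>t \<omega>. \<exists>ps. optimal_path \<alpha> \<beta> (\<Xi> \<omega>) (a * t) (b * t) ps \<and>
        (\<exists>p\<in>set ps. \<exists>q\<in>set ps. vertical_gap \<theta> p q > t * \<delta>))"
    proof (rule vanishing_deviation[OF _ \<delta>])
      show "continuous_on UNIV (\<lambda>z. vertical_gap \<theta> (fst z) (snd z))"
        unfolding vertical_gap_def offset_def by (intro continuous_intros) auto
      show "vertical_gap \<theta> (c *\<^sub>R p) (c *\<^sub>R q) = c * vertical_gap \<theta> p q" if "c > 0" for c p q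
        unfolding vertical_gap_def max_mult_pos[OF that, symmetric]
        by (simp add: offset_scaleR algebra_simps)
      fix p0 p1 p2 p3 assume p: "p0 \<in> box0" "p1 \<in> box0" "p2 \<in> box0" "p3 \<in> box0"
        and "fst p3 = fst p0 + a" and s: "snd p1 - snd p0 = \<theta> * (fst p1 - fst p0)"
          "snd p2 - snd p1 = \<theta> * (fst p2 - fst p1)"
      then have "fst p0 = 0" by (auto simp: mem_Times_iff)
      \<comment> \<open>An optimal configuration starts on the left edge at some height
        \<open>snd p0\<close>, which is the shift of its strip.\<close>
      then have "offset \<theta> p1 = snd p0" "offset \<theta> p2 = snd p0"
        using s by (simp_all add: offset_def algebra_simps)
      moreover have "0 \<le> \<theta> * fst p1" "0 \<le> \<theta> * fst p2" "0 \<le> snd p0"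
        using p t0 by (auto simp: mem_Times_iff)
      ultimately show "vertical_gap \<theta> p1 p2 \<le> 0 \<and> vertical_gap \<theta> p2 p1 \<le> 0"
        by (simp add: vertical_gap_def offset_def)
    qed
    then show "vanishing_probability M (\<lambda>t \<omega>. \<exists>ps. optimal_path \<alpha> \<beta> (\<Xi> \<omega>) (a * t) (b * t) ps \<and>
        (\<forall>c\<ge>0. \<not> set ps \<subseteq> (+) (0, c) ` strip (t * \<delta>) ((\<alpha> + \<beta>) / 2)))"
      by (rule vanishing_probability_cong[rotated])
        (use escapes_vertical_strips_iff[OF finite_set optimal_path_in_quadrant] in \<open>simp add: \<theta>_def cong: conj_cong\<close>)
  }
  {
    assume th: "b / a < 2 / (1 / \<beta> + 1 / \<alpha>)"
    define \<theta> where "\<theta> = 2 * \<alpha> * \<beta> / (\<alpha> + \<beta>)"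
    have t0: "\<theta> > 0" using ab by (simp add: \<theta>_def)
    have ba: "b / \<theta> \<le> a"
      using th ab t0 unfolding harm \<theta>_def[symmetric] by (simp add: field_simps)
    \<comment> \<open>At the harmonic mean the coefficient of the width vanishes, and that of the
      height equals \<open>(\<beta> - \<alpha>)^2 / (\<alpha> + \<beta>)\<close>.\<close>
    have m: "\<theta> * (\<alpha> + \<beta>) - 2 * \<alpha> * \<beta> = 0" "\<alpha> + \<beta> - 2 * \<theta> \<ge> 0"
      using ab sq by (simp_all add: \<theta>_def field_simps)
    interpret cone_poisson M \<Xi> a b \<alpha> \<beta> \<theta> "b / \<theta>"
    proof (intro cone_poisson.intro qp cone_box.intro)
      show "\<alpha> < \<theta>" "\<theta> < \<beta>" using means by (simp_all add: \<theta>_def)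
      fix z :: "real \<times> real" assume "snd z \<le> b"
      then have "(\<alpha> + \<beta> - 2 * \<theta>) * snd z \<le> (\<alpha> + \<beta> - 2 * \<theta>) * b"
        using m(2) by (intro mult_left_mono) simp_all
      then show "tangent \<alpha> \<beta> \<theta> z \<le> tangent \<alpha> \<beta> \<theta> (b / \<theta>, \<theta> * (b / \<theta>))"
        unfolding tangent_def m(1) using t0 by simp
    qed (use ab ba t0 in auto)
    have "vanishing_probability M (\<lambda>t \<omega>. \<exists>ps. optimal_path \<alpha> \<beta> (\<Xi> \<omega>) (a * t) (b * t) ps \<and>
        (\<exists>p\<in>set ps. \<exists>q\<in>set ps. horizontal_gap \<theta> p q > t * \<delta>))"
    proof (rule vanishing_deviation[OF _ \<delta>])
      show "continuous_on UNIV (\<lambda>z. horizontal_gap \<theta> (fst z) (snd z))"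
        unfolding horizontal_gap_def offset_def by (intro continuous_intros) auto
      show "horizontal_gap \<theta> (c *\<^sub>R p) (c *\<^sub>R q) = c * horizontal_gap \<theta> p q" if "c > 0" for c p q
        unfolding horizontal_gap_def max_mult_pos[OF that, symmetric]
        by (simp add: offset_scaleR algebra_simps)
      fix p0 p1 p2 p3 assume p: "p0 \<in> box0" "p1 \<in> box0" "p2 \<in> box0" "p3 \<in> box0"
        and le: "slope_le \<alpha> \<beta> p0 p1" "slope_le \<alpha> \<beta> p1 p2" "slope_le \<alpha> \<beta> p2 p3"
        and A: "fst p3 = fst p0 + b / \<theta>" and s: "snd p1 - snd p0 = \<theta> * (fst p1 - fst p0)"
          "snd p2 - snd p1 = \<theta> * (fst p2 - fst p1)" "snd p3 - snd p2 = \<theta> * (fst p3 - fst p2)"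
      have "snd p3 - snd p0 = \<theta> * (fst p3 - fst p0)" using s by (simp add: algebra_simps)
      also have "\<dots> = b" using A t0 by simp
      \<comment> \<open>A displacement of height \<open>b\<close> exhausts the height of the box, so
        it starts on the bottom edge; \<open>fst p0\<close> is the shift of its strip.\<close>
      finally have "snd p0 = 0" using p by (auto simp: mem_Times_iff)
      then have "offset \<theta> p1 = - (\<theta> * fst p0)" "offset \<theta> p2 = - (\<theta> * fst p0)"
        using s by (simp_all add: offset_def algebra_simps)
      moreover have "\<theta> * fst p0 \<le> \<theta> * fst p1" "\<theta> * fst p0 \<le> \<theta> * fst p2" "0 \<le> \<theta> * fst p0"
        using p le t0 by (auto simp: mem_Times_iff slope_le_def)
      ultimately show "horizontal_gap \<theta> p1 p2 \<le> 0 \<and> horizontal_gap \<theta> p2 p1 \<le> 0"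
        by (simp add: horizontal_gap_def)
    qed
    then show "vanishing_probability M (\<lambda>t \<omega>. \<exists>ps. optimal_path \<alpha> \<beta> (\<Xi> \<omega>) (a * t) (b * t) ps \<and>
        (\<forall>c\<ge>0. \<not> set ps \<subseteq> (+) (c, 0) ` strip (t * \<delta>) (2 / (1 / \<beta> + 1 / \<alpha>))))"
      by (rule vanishing_probability_cong[rotated])
        (use escapes_horizontal_strips_iff[OF finite_set optimal_path_in_quadrant t0] in
          \<open>simp add: \<theta>_def[symmetric] harm cong: conj_cong\<close>)
  }
qed

end
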